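(* Let $0<|q|<1$, let $\mathcal{B}$ be a unital Banach algebra and $T,S\in\mathcal{B}$ with $TS=q^{-1}ST$, and let $U=U_x\cup U_y\subseteq\mathbb{C}_{xy}$ be $(\mathfrak{q},\mathfrak{d})$-open. The unital homomorphism $\mathfrak{A}_q\to\mathcal{B}$, $x\mapsto T$, $y\mapsto S$, extends to a continuous algebra homomorphism $\mathcal{O}_q(U)\to\mathcal{B}$ (along the canonical map $\mathfrak{A}_q\to\mathcal{O}_q(U)$ sending $x,y$ to $x,y$) if and only if $\sigma(T)\subseteq U_x$ and $\sigma(S)\subseteq U_y$. In that case the extension is given by $\sum_nf_n(x)y^n\mapsto\sum_nf_n(T)S^n$, with $f_n(T)$ the holomorphic functional calculus.
   Context: $\mathfrak{A}_q=\mathbb{C}\langle x,y\rangle/(xy-q^{-1}yx)$ is the quantum plane. $\sigma(\cdot)$ denotes spectrum in $\mathcal{B}$. $q$-open: standard-open subset of $\mathbb{C}$ containing $0$ and $q^nz$ for each of its points $z$, $n\in\mathbb{Z}_+$. A $(\mathfrak{q},\mathfrak{d})$-open set of $\mathbb{C}_{xy}=(\mathbb{C}\times\{0\})\cup(\{0\}\times\mathbb{C})$ is $U=U_x\cup U_y$ with $U_x$ nonempty $q$-open and $U_y=B(0,r_y)$, $0<r_y\le\infty$. $\mathcal{O}_q(U)$ is the Fréchet algebra of formal series $f=\sum_{n\ge0}f_n(x)y^n$, $f_n\in\mathcal{O}(U_x)$, with $\sum_n\|f_n\|_K\rho^n<\infty$ for all compact $K\subseteq U_x$ and $0<\rho<r_y$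 ($\|g\|_K=\sup_K|g|$), with those seminorms and product $f\cdot g=\sum_n\big(\sum_{i+j=n}f_i(z)g_j(q^iz)\big)y^n$. *)

theory Defs
  imports "HOL-Complex_Analysis.Complex_Analysis" "HOL-Library.Extended_Real"
begin

class cbanach_algebra = banach + real_normed_algebra_1 +
  fixes cscale :: "complex \<Rightarrow> 'a \<Rightarrow> 'a"
  assumes cscale_of_real: "cscale (complex_of_real r) x = scaleR r x"
    and cscale_add_left: "cscale (a + b) x = cscale a x + cscale b x"
    and cscale_add_right: "cscale a (x + y) = cscale a x + cscale a y"
    and cscale_assoc: "cscale a (cscale b x) = cscale (a * b) x"
    and cscale_mult_left: "cscale a x * y = cscale a (x * y)"
    and cscale_mult_right: "x * cscale a y = cscale a (x * y)"
    and norm_cscale: "norm (cscale a x) = cmod a * norm x"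

definition ainv :: "'a::cbanach_algebra \<Rightarrow> 'a" where
  "ainv x = (THE y. y * x = 1 \<and> x * y = 1)"

definition ainvertible :: "'a::cbanach_algebra \<Rightarrow> bool" where
  "ainvertible x \<longleftrightarrow> (\<exists>y. y * x = 1 \<and> x * y = 1)"

definition bspec :: "'a::cbanach_algebra \<Rightarrow> complex set" where
  "bspec T = {w. \<not> ainvertible (T - cscale w 1)}"

definition admissible_cycle :: "complex set \<Rightarrow> 'a::cbanach_algebra \<Rightarrow> (real \<Rightarrow> complex) list \<Rightarrow> bool" where
  "admissible_cycle U T gs \<longleftrightarrow>
     (\<forall>g\<in>set gs. valid_path g \<and> pathfinish g = pathstart g \<and> path_image g \<subseteq> U - bspec T) \<and>
     (\<forall>z\<in>bspec T. (\<Sum>g\<leftarrow>gs. winding_number g z) = 1) \<and>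
     (\<forall>z. z \<notin> U \<longrightarrow> (\<Sum>g\<leftarrow>gs. winding_number g z) = 0)"

definition riesz_integral :: "(complex \<Rightarrow> complex) \<Rightarrow> 'a::cbanach_algebra \<Rightarrow> (real \<Rightarrow> complex) list \<Rightarrow> 'a" where
  "riesz_integral f T gs = cscale (1 / (2 * pi * \<i>))
     (\<Sum>g\<leftarrow>gs. integral {0..1}
        (\<lambda>t. cscale (vector_derivative g (at t)) (cscale (f (g t)) (ainv (cscale (g t) 1 - T)))))"

text \<open>Holomorphic functional calculus f(T), for f holomorphic on U containing the
spectrum of T (value independent of the admissible cycle chosen).\<close>
definition hfc :: "complex set \<Rightarrow> (complex \<Rightarrow> complex) \<Rightarrow> 'a::cbanach_algebra \<Rightarrow> 'a" where
  "hfc U f T = (SOME v. \<exists>gs. admissible_cycle U T gs \<and> v = riesz_integral f T gs)"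

definition q_open :: "complex \<Rightarrow> complex set \<Rightarrow> bool" where
  "q_open q U \<longleftrightarrow> open U \<and> 0 \<in> U \<and> (\<forall>z\<in>U. \<forall>n::nat. q ^ n * z \<in> U)"

definition supnorm :: "complex set \<Rightarrow> (complex \<Rightarrow> complex) \<Rightarrow> real" where
  "supnorm K h = (if K = {} then 0 else (SUP z\<in>K. cmod (h z)))"

text \<open>Elements of O_q(U) are represented by their coefficient sequences f_n,
normalised to vanish outside U_x (so that representation is unique).\<close>
definition Oq_set :: "complex set \<Rightarrow> ereal \<Rightarrow> (nat \<Rightarrow> complex \<Rightarrow> complex) set" where
  "Oq_set Ux ry = {F. (\<forall>n. F n holomorphic_on Ux) \<and> (\<forall>n z. z \<notin> Ux \<longrightarrow> F n z = 0) \<and>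
     (\<forall>K \<rho>. compact K \<longrightarrow> K \<subseteq> Ux \<longrightarrow> 0 < \<rho> \<longrightarrow> ereal \<rho> < ry \<longrightarrow>
        summable (\<lambda>n. supnorm K (F n) * \<rho> ^ n))}"

definition Oq_seminorm :: "complex set \<Rightarrow> real \<Rightarrow> (nat \<Rightarrow> complex \<Rightarrow> complex) \<Rightarrow> real" where
  "Oq_seminorm K \<rho> F = (\<Sum>n. supnorm K (F n) * \<rho> ^ n)"

definition Oq_top :: "complex set \<Rightarrow> ereal \<Rightarrow> (nat \<Rightarrow> complex \<Rightarrow> complex) topology" where
  "Oq_top Ux ry = topology (\<lambda>V. V \<subseteq> Oq_set Ux ry \<and>
     (\<forall>F\<in>V. \<exists>K \<rho> \<epsilon>. compact K \<and> K \<subseteq> Ux \<and> 0 < \<rho> \<and> ereal \<rho> < ry \<and> 0 < \<epsilon> \<and>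
        {G\<in>Oq_set Ux ry. Oq_seminorm K \<rho> (\<lambda>n z. G n z - F n z) < \<epsilon>} \<subseteq> V))"

definition Oq_mult :: "complex \<Rightarrow> (nat \<Rightarrow> complex \<Rightarrow> complex) \<Rightarrow> (nat \<Rightarrow> complex \<Rightarrow> complex) \<Rightarrow> (nat \<Rightarrow> complex \<Rightarrow> complex)" where
  "Oq_mult q F G = (\<lambda>n z. \<Sum>i\<le>n. F i z * G (n - i) (q ^ i * z))"

definition Oq_one :: "complex set \<Rightarrow> nat \<Rightarrow> complex \<Rightarrow> complex" where
  "Oq_one Ux = (\<lambda>n z. if n = 0 \<and> z \<in> Ux then 1 else 0)"

definition Oq_x :: "complex set \<Rightarrow> nat \<Rightarrow> complex \<Rightarrow> complex" where
  "Oq_x Ux = (\<lambda>n z. if n = 0 \<and> z \<in> Ux then z else 0)"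

definition Oq_y :: "complex set \<Rightarrow> nat \<Rightarrow> complex \<Rightarrow> complex" where
  "Oq_y Ux = (\<lambda>n z. if n = 1 \<and> z \<in> Ux then 1 else 0)"

text \<open>Phi is a continuous unital algebra homomorphism O_q(U) -> B with x |-> T, y |-> S,
i.e. a continuous extension of the homomorphism of the quantum plane x |-> T, y |-> S
along the canonical map.\<close>
definition Oq_ext :: "complex \<Rightarrow> complex set \<Rightarrow> ereal \<Rightarrow> 'a::cbanach_algebra \<Rightarrow> 'a \<Rightarrow>
    ((nat \<Rightarrow> complex \<Rightarrow> complex) \<Rightarrow> 'a) \<Rightarrow> bool" where
  "Oq_ext q Ux ry T S \<Phi> \<longleftrightarrow>
     continuous_map (Oq_top Ux ry) euclidean \<Phi> \<and>
     (\<forall>F\<in>Oq_set Ux ry. \<forall>G\<in>Oq_set Ux ry. \<Phi> (\<lambda>n z. F n z + G n z) = \<Phi> F + \<Phi> G) \<and>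
     (\<forall>F\<in>Oq_set Ux ry. \<forall>c. \<Phi> (\<lambda>n z. c * F n z) = cscale c (\<Phi> F)) \<and>
     (\<forall>F\<in>Oq_set Ux ry. \<forall>G\<in>Oq_set Ux ry. \<Phi> (Oq_mult q F G) = \<Phi> F * \<Phi> G) \<and>
     \<Phi> (Oq_one Ux) = 1 \<and> \<Phi> (Oq_x Ux) = T \<and> \<Phi> (Oq_y Ux) = S"

end

theory Submission
  imports Defs
begin

text \<open>A bounded linear map \<open>M\<close> from \<open>\<O>(U)\<close> to the algebra with \<open>M (z f) = T M f\<close> satisfies
\<open>M f = f(T) M 1\<close>: writing \<open>f(z) = f(w) + (z - w) g\<^sub>w(z)\<close> gives
\<open>f(w) R(w) M 1 = R(w) M f + M g\<^sub>w\<close> for the resolvent \<open>R\<close>, and \<open>M g\<^sub>w\<close> is holomorphic in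
\<open>w \<in> U\<close>, so it disappears when integrated over a cycle around the spectrum. This one fact yields
that the Riesz integral is independent of the cycle, that the functional calculus is
multiplicative, the relation \<open>S f(T) = f(qT) S\<close>, and that a continuous homomorphism on
\<open>\<O>\<^sub>q(U)\<close> maps \<open>f(x)\<close> to \<open>f(T)\<close>, hence \<open>\<Sum> f\<^sub>n(x) y\<^sup>n\<close> to \<open>\<Sum> f\<^sub>n(T) S\<^sup>n\<close>. That
series converges because \<open>\<parallel>S\<^sup>n\<parallel> \<le> C \<rho>\<^sup>n\<close> as soon as \<open>\<rho>\<close> exceeds the spectral radius of \<open>S\<close>.
Conversely, a homomorphism carries the inverses of \<open>x - \<lambda>\<close> and \<open>y - \<mu>\<close> in
\<open>\<O>\<^sub>q(U)\<close>, for \<open>\<lambda> \<notin> U\<^sub>x\<close> and \<open>\<mu> \<notin> U\<^sub>y\<close>, to inverses in the algebra.\<close>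

subsection \<open>Norming functionals\<close>

text \<open>\<open>hfc\<close> picks its value by \<open>SOME\<close> among all admissible cycles,
  so it carries no information until such a cycle is known to exist and all of them are known to
  agree. \<open>Ux\<close> is an arbitrary open set around \<open>0\<close>, possibly disconnected
  or with holes. Hence Cauchy's theorem is needed in its homology form, for lists of loops whose
  total winding number vanishes off the set, and the cycle itself is cut out of a square grid. The
  integrands take values in the algebra; identities between their integrals are reduced to scalar
  ones by applying complex functionals, which is why the proof begins with Hahn-Banach.
  Integrability does not follow from such tests and is obtained from local primitives. Stating
  uniqueness for bounded linear maps that turn multiplication by \<open>z\<close> into
  multiplication by \<open>T\<close>, rather than for algebra homomorphisms, avoids approximation by
  rational functions and covers maps that are not multiplicative, such as
  \<open>f \<mapsto> S * f(T)\<close>, whose operator is \<open>cscale q T\<close>.\<close>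

definition sublinear :: "('a::real_vector \<Rightarrow> real) \<Rightarrow> bool" where
  "sublinear p \<longleftrightarrow> (\<forall>x y. p (x + y) \<le> p x + p y) \<and> (\<forall>c x. 0 \<le> c \<longrightarrow> p (c *\<^sub>R x) = c * p x)"

lemma sublinear_add: "sublinear p \<Longrightarrow> p (x + y) \<le> p x + p y"
  and sublinear_scaleR: "sublinear p \<Longrightarrow> 0 \<le> c \<Longrightarrow> p (c *\<^sub>R x) = c * p x"
  by (auto simp: sublinear_def)

lemma sublinear_zero: "sublinear p \<Longrightarrow> p 0 = 0"
  using sublinear_scaleR[of p 0 0] by simp

lemma sublinear_neg: assumes "sublinear p" shows "- p (- x) \<le> p x"
  using sublinear_add[OF assms, of x "- x"] sublinear_zero[OF assms] by simp

text \<open>The lowering of \<open>p\<close> in the direction \<open>y\<close>. For sublinear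
  \<open>p\<close> the value \<open>t = 1\<close> gives \<open>tilt p y (- y) \<le> - p y\<close>,
  so a functional that no tilt lowers is odd.\<close>

definition tilt :: "('a::real_vector \<Rightarrow> real) \<Rightarrow> 'a \<Rightarrow> 'a \<Rightarrow> real" where
  "tilt p y x = (INF t\<in>{0..}. p (x + t *\<^sub>R y) - t * p y)"

lemma tilt_lower:
  assumes "sublinear p" "0 \<le> t"
  shows "- p (- x) \<le> p (x + t *\<^sub>R y) - t * p y"
  using sublinear_add[OF assms(1), of "x + t *\<^sub>R y" "- x"] sublinear_scaleR[OF assms, of y] by simp

lemma tilt_le:
  assumes "sublinear p" "0 \<le> t"
  shows "tilt p y x \<le> p (x + t *\<^sub>R y) - t * p y"
  unfolding tilt_def
  by (rule cINF_lower) (use assms tilt_lower in \<open>auto intro!: bdd_belowI2[where m="- p (- x)"]\<close>)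

lemma tilt_greatest:
  assumes "\<And>t. 0 \<le> t \<Longrightarrow> b \<le> p (x + t *\<^sub>R y) - t * p y"
  shows "b \<le> tilt p y x"
  unfolding tilt_def by (rule cINF_greatest) (use assms in auto)

lemma tilt_le_self: "sublinear p \<Longrightarrow> tilt p y \<le> p"
  using tilt_le[of p 0 y] by (auto simp: le_fun_def)

lemma sublinear_tilt:
  assumes p: "sublinear p" shows "sublinear (tilt p y)"
  unfolding sublinear_def
proof (intro conjI allI impI)
  fix x x'
  have 1: "tilt p y (x + x') \<le> (p (x + t *\<^sub>R y) - t * p y) + (p (x' + t' *\<^sub>R y) - t' * p y)"
    if "0 \<le> t" "0 \<le> t'" for t t'
    using tilt_le[OF p, of "t + t'" y "x + x'"] that
      sublinear_add[OF p, of "x + t *\<^sub>R y" "x' + t' *\<^sub>R y"]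
    by (simp add: algebra_simps)
  have "tilt p y (x + x') - (p (x + t *\<^sub>R y) - t * p y) \<le> tilt p y x'" if "0 \<le> t" for t
    by (rule tilt_greatest) (use 1[OF that] in \<open>force simp: algebra_simps\<close>)
  then have "tilt p y (x + x') - tilt p y x' \<le> tilt p y x"
    by (intro tilt_greatest) (force simp: algebra_simps)
  then show "tilt p y (x + x') \<le> tilt p y x + tilt p y x'" by simp
next
  fix c :: real and x assume c: "0 \<le> c"
  have z: "tilt p y 0 = 0"
  proof (rule antisym)
    show "tilt p y 0 \<le> 0" using tilt_le[OF p, of 0 y 0] sublinear_zero[OF p] by simp
    show "0 \<le> tilt p y 0" by (rule tilt_greatest) (simp add: sublinear_scaleR[OF p])
  qed
  \<comment> \<open>The substitution of \<open>t / c\<close> for \<open>t\<close> gives one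
    inequality; the reverse one is the same fact for \<open>inverse c\<close> at the point
    \<open>c *\<^sub>R x\<close>.\<close>
  have le: "c * tilt p y x \<le> tilt p y (c *\<^sub>R x)" if "0 < c" for c x
  proof (rule tilt_greatest)
    fix t :: real assume t: "0 \<le> t"
    have "c *\<^sub>R (x + (t / c) *\<^sub>R y) = c *\<^sub>R x + t *\<^sub>R y" using that by (simp add: algebra_simps)
    then have "p (c *\<^sub>R x + t *\<^sub>R y) = c * p (x + (t/c) *\<^sub>R y)"
      using sublinear_scaleR[OF p, of c] that by (metis less_imp_le)
    moreover have "c * tilt p y x \<le> c * (p (x + (t/c) *\<^sub>R y) - (t/c) * p y)"
      using tilt_le[OF p, of "t/c" y x] that t by (intro mult_left_mono) auto
    ultimately show "c * tilt p y x \<le> p (c *\<^sub>R x + t *\<^sub>R y) - t * p y"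
      using that by (simp add: algebra_simps)
  qed
  show "tilt p y (c *\<^sub>R x) = c * tilt p y x"
  proof (cases "c = 0")
    case True then show ?thesis using z by simp
  next
    case False
    then have c0: "0 < c" using c by simp
    have "inverse c * tilt p y (c *\<^sub>R x) \<le> tilt p y (inverse c *\<^sub>R c *\<^sub>R x)"
      by (rule le) (use c0 in simp)
    then have "tilt p y (c *\<^sub>R x) \<le> c * tilt p y x"
      using c0 by (simp add: field_simps)
    with le[OF c0, of x] show ?thesis by simp
  qed
qed

text \<open>Supplies the bounds that Zorn's lemma asks for. The chain condition enters in
  subadditivity, where two members are replaced by the smaller one; the common majorant gives
  \<open>- p0 (- x) \<le> p x\<close>, which keeps the infimum finite.\<close>

lemma sublinear_INF_chain:
  fixes p0 :: "'a::real_vector \<Rightarrow> real"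
  assumes "C \<noteq> {}" and sl: "\<And>p. p \<in> C \<Longrightarrow> sublinear p" and le: "\<And>p. p \<in> C \<Longrightarrow> p \<le> p0"
    and chain: "\<And>p p'. p \<in> C \<Longrightarrow> p' \<in> C \<Longrightarrow> p \<le> p' \<or> p' \<le> p"
  shows "sublinear (\<lambda>x. INF p\<in>C. p x)" and "\<And>p. p \<in> C \<Longrightarrow> (\<lambda>x. INF p\<in>C. p x) \<le> p"
proof -
  let ?u = "\<lambda>x. INF p\<in>C. p x"
  have bdd: "bdd_below ((\<lambda>p. p x) ` C)" for x
  proof (rule bdd_belowI2)
    fix p assume "p \<in> C"
    then show "- p0 (- x) \<le> p x"
      using sublinear_neg[OF sl, of p x] le[of p] by (smt (verit) le_funD)
  qed
  have low: "?u x \<le> p x" if "p \<in> C" for p x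
    by (rule cINF_lower[OF bdd that])
  then show "\<And>p. p \<in> C \<Longrightarrow> (\<lambda>x. INF p\<in>C. p x) \<le> p" by (simp add: le_fun_def)
  have gr: "b \<le> ?u x" if "\<And>p. p \<in> C \<Longrightarrow> b \<le> p x" for b x
    by (rule cINF_greatest) (use that assms(1) in auto)
  show "sublinear ?u"
    unfolding sublinear_def
  proof (intro conjI allI impI)
    fix x y
    have 1: "?u (x + y) \<le> p x + p' y" if "p \<in> C" "p' \<in> C" for p p'
    proof -
      have "p \<le> p' \<or> p' \<le> p" using chain that by blast
      then obtain r where r: "r \<in> C" "r \<le> p" "r \<le> p'" using \<open>p \<in> C\<close> \<open>p' \<in> C\<close> by (metis order_refl)
      have "?u (x + y) \<le> r (x + y)" by (rule low[OF r(1)])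
      also have "\<dots> \<le> r x + r y" by (rule sublinear_add[OF sl[OF r(1)]])
      also have "\<dots> \<le> p x + p' y" using r by (simp add: le_fun_def add_mono)
      finally show ?thesis .
    qed
    have "?u (x + y) - p x \<le> ?u y" if "p \<in> C" for p
      by (rule gr) (use 1[OF that] in \<open>force simp: algebra_simps\<close>)
    then have "?u (x + y) - ?u y \<le> ?u x"
      by (intro gr) (force simp: algebra_simps)
    then show "?u (x + y) \<le> ?u x + ?u y" by simp
  next
    fix c :: real and x assume c: "0 \<le> c"
    have le1: "c * ?u x \<le> ?u (c *\<^sub>R x)" if "0 \<le> c" for c x
      by (rule gr) (use low that in \<open>auto simp: sublinear_scaleR[OF sl] intro: mult_left_mono\<close>)
    show "?u (c *\<^sub>R x) = c * ?u x"
    proof (cases "c = 0")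
      case True
      have "(\<lambda>p. p 0) ` C = {0}" using sl sublinear_zero assms(1) by force
      then have "?u 0 = 0" by simp
      then show ?thesis using True by simp
    next
      case False
      then have c0: "0 < c" using c by simp
      have "inverse c * ?u (c *\<^sub>R x) \<le> ?u (inverse c *\<^sub>R c *\<^sub>R x)"
        by (rule le1) (use c0 in simp)
      then have "?u (c *\<^sub>R x) \<le> c * ?u x" using c0 by (simp add: field_simps)
      with le1[OF c, of x] show ?thesis by simp
    qed
  qed
qed

text \<open>Minimal sublinear functionals are linear, because tilting one in any direction
cannot decrease it; starting from the norm tilted along \<^term>\<open>x0\<close> makes the functional norming.\<close>

lemma hahn_banach_norming:
  fixes x0 :: "'a::real_normed_vector"
  shows "\<exists>f::'a \<Rightarrow> real. linear f \<and> (\<forall>x. f x \<le> norm x) \<and> f x0 = norm x0"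
proof -
  have nsl: "sublinear (norm :: 'a \<Rightarrow> real)"
    by (auto simp: sublinear_def norm_triangle_ineq)
  define p0 where "p0 = tilt norm x0"
  have p0: "sublinear p0" "p0 \<le> norm" unfolding p0_def by (auto intro: sublinear_tilt nsl tilt_le_self)
  define A where "A = {p. sublinear p \<and> p \<le> p0}"
  \<comment> \<open>The order is reversed, so that a maximal element is a minimal
    functional.\<close>
  have "\<exists>m\<in>A. \<forall>a\<in>A. m \<ge> a \<longrightarrow> a = m"
  proof (rule predicate_Zorn)
    show "partial_order_on A (relation_of (\<ge>) A)"
      by (rule partial_order_on_relation_ofI) auto
    fix C assume C: "C \<in> Chains (relation_of (\<ge>) A)"
    have CA: "p \<in> A" if "p \<in> C" for p
      using C that by (auto simp: Chains_def relation_of_def)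
    have ch: "p \<le> p' \<or> p' \<le> p" if "p \<in> C" "p' \<in> C" for p p'
      using C that by (auto simp: Chains_def relation_of_def)
    show "\<exists>u\<in>A. \<forall>a\<in>C. a \<ge> u"
    proof (cases "C = {}")
      case True then show ?thesis using p0 by (auto simp: A_def)
    next
      case False
      have h: "sublinear p" "p \<le> p0" if "p \<in> C" for p using CA[OF that] by (auto simp: A_def)
      note u = sublinear_INF_chain[OF False h ch]
      obtain p where "p \<in> C" using False by blast
      then have "(\<lambda>x. INF p\<in>C. p x) \<in> A" unfolding A_def using u h(2)[of p] order_trans by blast
      then show ?thesis using u(2) by blast
    qed
  qed
  then obtain m where m: "sublinear m" "m \<le> p0" and min: "\<And>a. a \<in> A \<Longrightarrow> a \<le> m \<Longrightarrow> a = m"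
    unfolding A_def by blast
  have tm: "tilt m y = m" for y
  proof (rule min)
    show "tilt m y \<le> m" by (rule tilt_le_self[OF m(1)])
    then show "tilt m y \<in> A" unfolding A_def using sublinear_tilt[OF m(1)] m(2) by auto
  qed
  have add: "m (x + y) = m x + m y" for x y
  proof -
    have "m x \<le> m (x + y) - m y"
      using tilt_le[OF m(1), of 1 y x] unfolding tm by simp
    then show ?thesis using sublinear_add[OF m(1), of x y] by simp
  qed
  have neg: "m (- x) = - m x" for x
    using add[of x "- x"] sublinear_zero[OF m(1)] by simp
  have scale: "m (c *\<^sub>R x) = c * m x" for c x
  proof (cases "0 \<le> c")
    case True then show ?thesis by (rule sublinear_scaleR[OF m(1)])
  next
    case False
    then have "m ((- c) *\<^sub>R x) = (- c) * m x" by (intro sublinear_scaleR[OF m(1)]) auto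
    then show ?thesis using neg[of "c *\<^sub>R x"] by simp
  qed
  have le: "m x \<le> norm x" for x using m(2) p0(2) by (meson le_funD order_trans)
  \<comment> \<open>Taking \<open>t = 1\<close> in the tilt along \<open>x0\<close> bounds
    \<open>p0 (- x0)\<close> by \<open>- norm x0\<close>.\<close>
  have "m (- x0) \<le> p0 (- x0)" using m(2) by (simp add: le_fun_def)
  also have "\<dots> \<le> norm (- x0 + 1 *\<^sub>R x0) - 1 * norm x0"
    unfolding p0_def by (rule tilt_le[OF nsl]) simp
  finally have "norm x0 \<le> m x0" using neg by simp
  then have "m x0 = norm x0" using le[of x0] by simp
  moreover have "linear m" by (rule linearI) (auto simp: add scale)
  ultimately show ?thesis using le by blast
qed

subsection \<open>Complex functionals and resolvents\<close>

lemma cscale_1 [simp]: "cscale 1 x = (x::'a::cbanach_algebra)"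
  using cscale_of_real[of 1 x] by simp

lemma cscale_0_left [simp]: "cscale 0 x = (0::'a::cbanach_algebra)"
  using cscale_of_real[of 0 x] by simp

lemma cscale_0_right [simp]: "cscale a (0::'a::cbanach_algebra) = 0"
  using norm_cscale[of a "0::'a"] by simp

lemma cscale_minus_left [simp]: "cscale (- a) x = - cscale a (x::'a::cbanach_algebra)"
  using cscale_add_left[of a "- a" x] by (simp add: add_eq_0_iff)

lemma cscale_minus_right [simp]: "cscale a (- x) = - cscale a (x::'a::cbanach_algebra)"
  using cscale_add_right[of a x "- x"] by (simp add: add_eq_0_iff)

lemma cscale_diff_left: "cscale (a - b) x = cscale a x - cscale b (x::'a::cbanach_algebra)"
  using cscale_add_left[of a "- b" x] by simp

lemma cscale_diff_right: "cscale a (x - y) = cscale a x - cscale a (y::'a::cbanach_algebra)"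
  using cscale_add_right[of a x "- y"] by simp

lemma scaleR_cscale: "r *\<^sub>R cscale c x = cscale c (r *\<^sub>R (x::'a::cbanach_algebra))"
  by (simp add: cscale_of_real[symmetric] cscale_assoc mult.commute)

lemma cscale_scaleR: "cscale (r *\<^sub>R c) x = r *\<^sub>R cscale c (x::'a::cbanach_algebra)"
  by (simp add: cscale_of_real[symmetric] cscale_assoc scaleR_conv_of_real)

lemma bounded_bilinear_cscale:
  "bounded_bilinear (cscale :: complex \<Rightarrow> 'a::cbanach_algebra \<Rightarrow> 'a)"
  by (rule bounded_bilinear.intro)
     (auto simp: cscale_add_left cscale_add_right cscale_scaleR scaleR_cscale norm_cscale intro!: exI[of _ 1])

interpretation cscale: bounded_bilinear "cscale :: complex \<Rightarrow> 'a::cbanach_algebra \<Rightarrow> 'a"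
  by (rule bounded_bilinear_cscale)

definition cfunctional :: "('a::cbanach_algebra \<Rightarrow> complex) \<Rightarrow> bool" where
  "cfunctional \<phi> \<longleftrightarrow> bounded_linear \<phi> \<and> (\<forall>c x. \<phi> (cscale c x) = c * \<phi> x)"

lemma cfunctionalD: "cfunctional \<phi> \<Longrightarrow> bounded_linear \<phi>" "cfunctional \<phi> \<Longrightarrow> \<phi> (cscale c x) = c * \<phi> x"
  by (auto simp: cfunctional_def)

lemma cfunctional_mult:
  assumes "cfunctional \<phi>" shows "cfunctional (\<lambda>x. \<phi> (a * x))" "cfunctional (\<lambda>x. \<phi> (x * a))"
  using assms by (auto simp: cfunctional_def cscale_mult_left cscale_mult_right
      intro!: bounded_linear_compose[of \<phi> "\<lambda>x. a * x"] bounded_linear_compose[of \<phi> "\<lambda>x. x * a"]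
        bounded_linear_mult_right bounded_linear_mult_left)

text \<open>The factor 2 is an artefact of the crude estimate of the complexification.\<close>

lemma cfunctional_norming:
  fixes x0 :: "'a::cbanach_algebra"
  obtains \<phi> where "cfunctional \<phi>" "\<And>x. cmod (\<phi> x) \<le> 2 * norm x" "norm x0 \<le> cmod (\<phi> x0)"
proof -
  obtain f :: "'a \<Rightarrow> real" where f: "linear f" "\<And>x. f x \<le> norm x" "f x0 = norm x0"
    using hahn_banach_norming by blast
  interpret f: linear f by (rule f)
  have fabs: "\<bar>f x\<bar> \<le> norm x" for x
    using f(2)[of x] f(2)[of "- x"] by (simp add: f.neg)
  \<comment> \<open>The complex functional with real part \<open>f\<close>; the minus sign is what
    makes it commute with multiplication by \<open>\<i>\<close>.\<close>
  define \<phi> where "\<phi> x = Complex (f x) (- f (cscale \<i> x))" for x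
  have b: "cmod (\<phi> x) \<le> 2 * norm x" for x
  proof -
    have "cmod (\<phi> x) \<le> \<bar>f x\<bar> + \<bar>- f (cscale \<i> x)\<bar>"
      using cmod_le[of "\<phi> x"] by (simp add: \<phi>_def)
    also have "\<dots> \<le> norm x + norm x"
      using fabs[of x] fabs[of "cscale \<i> x"] by (simp add: norm_cscale)
    finally show ?thesis by simp
  qed
  have add: "\<phi> (x + y) = \<phi> x + \<phi> y" for x y
    by (simp add: \<phi>_def complex_eq_iff f.add cscale_add_right)
  have real: "\<phi> (r *\<^sub>R x) = of_real r * \<phi> x" for r x
    by (simp add: \<phi>_def complex_eq_iff f.scaleR scaleR_cscale[symmetric])
  have i: "\<phi> (cscale \<i> x) = \<i> * \<phi> x" for x
    by (simp add: \<phi>_def complex_eq_iff cscale_assoc f.neg)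
  have c: "\<phi> (cscale c x) = c * \<phi> x" for c x
  proof -
    have "cscale c x = Re c *\<^sub>R x + Im c *\<^sub>R cscale \<i> x"
      by (subst complex_eq[of c], subst cscale_add_left)
         (simp add: cscale_of_real[symmetric] cscale_assoc mult.commute)
    then have "\<phi> (cscale c x) = of_real (Re c) * \<phi> x + of_real (Im c) * (\<i> * \<phi> x)"
      by (simp only: add real i)
    also have "\<dots> = c * \<phi> x"
      by (subst (3) complex_eq[of c]) (simp add: algebra_simps)
    finally show ?thesis .
  qed
  have "bounded_linear \<phi>"
    by (rule bounded_linear_intro[where K=2]) (use add real b in \<open>auto simp: scaleR_conv_of_real mult.commute\<close>)
  then have "cfunctional \<phi>" using c by (simp add: cfunctional_def)
  moreover have "norm x0 \<le> cmod (\<phi> x0)"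
    using abs_Re_le_cmod[of "\<phi> x0"] f(3) by (simp add: \<phi>_def)
  ultimately show ?thesis using that b by blast
qed

lemma cfunctional_eqI:
  fixes x y :: "'a::cbanach_algebra"
  assumes "\<And>\<phi>. cfunctional \<phi> \<Longrightarrow> \<phi> x = \<phi> y"
  shows "x = y"
proof -
  obtain \<phi> where p: "cfunctional \<phi>" "norm (x - y) \<le> cmod (\<phi> (x - y))"
    using cfunctional_norming[of "x - y"] by blast
  interpret bounded_linear \<phi> using p(1) cfunctionalD by blast
  show ?thesis using p(2) assms[OF p(1)] by (simp add: diff)
qed

text \<open>The common bound 2 on the test functionals is what allows integrals to be estimated
  uniformly over them.\<close>

lemma norm_le_cfunctional:
  fixes x :: "'a::cbanach_algebra"
  assumes "\<And>\<phi>. cfunctional \<phi> \<Longrightarrow> (\<And>y. cmod (\<phi> y) \<le> 2 * norm y) \<Longrightarrow> cmod (\<phi> x) \<le> B"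
  shows "norm x \<le> B"
  using cfunctional_norming[of x] assms by (metis order_trans)

section \<open>Inverses, Neumann series and the resolvent\<close>

lemma ainv_works:
  assumes "ainvertible x" shows "ainv x * x = 1" "x * ainv x = 1"
proof -
  obtain y where y: "y * x = 1" "x * y = 1" using assms by (auto simp: ainvertible_def)
  have "ainv x * x = 1 \<and> x * ainv x = 1" unfolding ainv_def
  proof (rule theI[of _ y])
    show "y * x = 1 \<and> x * y = 1" using y by simp
    fix z assume "z * x = 1 \<and> x * z = 1"
    then show "z = y" using y by (metis mult.assoc mult_1_left mult_1_right)
  qed
  then show "ainv x * x = 1" "x * ainv x = 1" by auto
qed

lemma ainv_unique:
  assumes "y * x = 1" "x * y = 1" shows "ainvertible x" "ainv x = y"
proof -
  show a: "ainvertible x" using assms by (auto simp: ainvertible_def)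
  show "ainv x = y" using ainv_works[OF a] assms by (metis mult.assoc mult_1_left mult_1_right)
qed

lemma ainvertible_minus [simp]: "ainvertible (- x) \<longleftrightarrow> ainvertible x"
  unfolding ainvertible_def by (metis minus_minus minus_mult_commute mult_minus_left mult_minus_right)

lemma neumann:
  fixes a :: "'a::cbanach_algebra"
  assumes "norm a < 1"
  shows "ainvertible (1 - a)" "norm (ainv (1 - a)) \<le> 1 / (1 - norm a)"
proof -
  have s: "summable (\<lambda>n. a ^ n)" by (rule complete_algebra_summable_geometric[OF assms])
  have 1: "(\<Sum>n. a ^ n) = 1 + (\<Sum>n. a ^ Suc n)" using suminf_split_head[OF s] by simp
  have "(1 - a) * (\<Sum>n. a ^ n) = 1" "(\<Sum>n. a ^ n) * (1 - a) = 1"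
    using 1 suminf_mult[OF s, of a] suminf_mult2[OF s, of a]
    by (simp_all add: algebra_simps power_commutes)
  then have *: "ainvertible (1 - a)" "ainv (1 - a) = (\<Sum>n. a ^ n)" using ainv_unique by blast+
  then show "ainvertible (1 - a)" by simp
  have sn: "summable (\<lambda>n. norm a ^ n)" using assms by (simp add: summable_geometric)
  have "norm (\<Sum>n. a ^ n) \<le> (\<Sum>n. norm a ^ n)"
    by (rule norm_suminf_le[OF _ sn]) (simp add: norm_power_ineq)
  also have "\<dots> = 1 / (1 - norm a)" using suminf_geometric[of "norm a"] assms by simp
  finally show "norm (ainv (1 - a)) \<le> 1 / (1 - norm a)" using * by simp
qed

lemma ainv_mult:
  assumes "ainvertible x" "ainvertible y" shows "ainvertible (x * y)" "ainv (x * y) = ainv y * ainv x"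
proof -
  have "(ainv y * ainv x) * (x * y) = 1" "(x * y) * (ainv y * ainv x) = 1"
    using ainv_works[OF assms(1)] ainv_works[OF assms(2)] by (metis mult.assoc mult_1_left)+
  then show "ainvertible (x * y)" "ainv (x * y) = ainv y * ainv x" using ainv_unique by blast+
qed

text \<open>Write \<open>y = x * (1 - a)\<close> with \<open>norm a \<le> 1/2\<close>; at this
  threshold the Neumann bound is 2. The local bound on the inverse is what later yields continuity
  of the resolvent.\<close>

lemma ainv_perturb:
  fixes x y :: "'a::cbanach_algebra"
  assumes x: "ainvertible x" and xy: "norm (x - y) * norm (ainv x) \<le> 1/2"
  shows "ainvertible y" "norm (ainv y) \<le> 2 * norm (ainv x)"
proof -
  define a where "a = ainv x * (x - y)"
  have na: "norm a \<le> 1/2" unfolding a_def using norm_mult_ineq[of "ainv x" "x - y"] xy by (simp add: mult.commute)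
  have y: "y = x * (1 - a)"
    unfolding a_def right_diff_distrib mult_1_right
    by (simp flip: mult.assoc add: ainv_works[OF x] right_diff_distrib)
  note n = neumann[of a]
  have n1: "ainvertible (1 - a)" "norm (ainv (1 - a)) \<le> 2"
    using n na by (auto intro!: order_trans[OF n(2)] simp: field_simps)
  show "ainvertible y" using ainv_mult[OF x n1(1)] y by simp
  have "norm (ainv y) = norm (ainv (1 - a) * ainv x)" using ainv_mult[OF x n1(1)] y by simp
  also have "\<dots> \<le> norm (ainv (1 - a)) * norm (ainv x)" by (rule norm_mult_ineq)
  also have "\<dots> \<le> 2 * norm (ainv x)" using n1(2) by (intro mult_right_mono) auto
  finally show "norm (ainv y) \<le> 2 * norm (ainv x)" .
qed

definition resolvent :: "'a::cbanach_algebra \<Rightarrow> complex \<Rightarrow> 'a" where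
  "resolvent T w = ainv (cscale w 1 - T)"

text \<open>\<open>bspec\<close> is defined with \<open>T - w\<close> but the Riesz integral uses
  \<open>w - T\<close>; the sign does not affect invertibility.\<close>

lemma not_in_bspec: "w \<notin> bspec T \<longleftrightarrow> ainvertible (cscale w 1 - T)"
  unfolding bspec_def using ainvertible_minus[of "T - cscale w 1"] by (simp del: ainvertible_minus)

lemma resolvent_works:
  assumes "w \<notin> bspec T"
  shows "resolvent T w * (cscale w 1 - T) = 1" "(cscale w 1 - T) * resolvent T w = 1"
  using ainv_works assms unfolding not_in_bspec resolvent_def by blast+

lemma resolvent_mult_T:
  assumes "w \<notin> bspec T"
  shows "resolvent T w * T = cscale w (resolvent T w) - 1" "T * resolvent T w = cscale w (resolvent T w) - 1"
  using resolvent_works[OF assms]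
  by (simp_all add: algebra_simps cscale_mult_left cscale_mult_right eq_diff_eq)

lemma resolvent_perturb:
  fixes T :: "'a::cbanach_algebra"
  assumes "v \<notin> bspec T" "cmod (w - v) * norm (resolvent T v) \<le> 1/2"
  shows "w \<notin> bspec T" "norm (resolvent T w) \<le> 2 * norm (resolvent T v)"
proof -
  have "norm ((cscale v 1 - T) - (cscale w 1 - T)) = cmod (w - v)"
    by (simp add: cscale_diff_left[symmetric] norm_cscale norm_minus_commute)
  then show "w \<notin> bspec T" "norm (resolvent T w) \<le> 2 * norm (resolvent T v)"
    using ainv_perturb[of "cscale v 1 - T" "cscale w 1 - T"] assms
    unfolding not_in_bspec resolvent_def by auto
qed

lemma resolvent_diff:
  assumes "v \<notin> bspec T" "w \<notin> bspec T"
  shows "resolvent T w - resolvent T v = cscale (v - w) (resolvent T w * resolvent T v)"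
proof -
  have "resolvent T w * ((cscale v 1 - T) - (cscale w 1 - T)) * resolvent T v = resolvent T w - resolvent T v"
    using resolvent_works[OF assms(1)] resolvent_works[OF assms(2)]
    by (simp add: algebra_simps)
  moreover have "(cscale v 1 - T) - (cscale w 1 - T) = cscale (v - w) 1"
    by (simp add: cscale_diff_left)
  ultimately show ?thesis by (simp add: cscale_mult_left cscale_mult_right)
qed

lemma closed_bspec: "closed (bspec T)"
proof -
  have "open (- bspec T)"
  proof (rule openI)
    fix v assume "v \<in> - bspec T"
    then have v: "v \<notin> bspec T" by simp
    define e where "e = 1 / (2 * (norm (resolvent T v) + 1))"
    have n1: "0 < norm (resolvent T v) + 1" by (smt (verit) norm_ge_zero)
    then have e: "0 < e" by (simp add: e_def)
    have "ball v e \<subseteq> - bspec T"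
    proof
      fix w assume "w \<in> ball v e"
      then have "cmod (w - v) \<le> e" by (simp add: dist_norm norm_minus_commute)
      then have "cmod (w - v) * norm (resolvent T v) \<le> e * (norm (resolvent T v) + 1)"
        using e by (intro mult_mono) auto
      also have "\<dots> = 1/2" using n1 by (simp add: e_def field_simps)
      finally show "w \<in> - bspec T" using resolvent_perturb[OF v] by blast
    qed
    then show "\<exists>e>0. ball v e \<subseteq> - bspec T" using e by blast
  qed
  then show ?thesis by (simp add: closed_def)
qed

lemma resolvent_large:
  fixes T :: "'a::cbanach_algebra"
  assumes "norm T < cmod w"
  shows "w \<notin> bspec T" "norm (resolvent T w) \<le> 1 / (cmod w - norm T)"
proof -
  have w0: "w \<noteq> 0" using assms norm_ge_zero[of T] by auto
  define a where "a = cscale (inverse w) T"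
  have na: "norm a = norm T / cmod w" by (simp add: a_def norm_cscale norm_inverse divide_inverse mult.commute)
  then have na1: "norm a < 1" using assms w0 unfolding na by (simp add: divide_less_eq)
  have eq: "cscale w 1 - T = cscale w 1 * (1 - a)"
    using w0 by (simp add: a_def cscale_mult_left cscale_assoc right_diff_distrib)
  have i: "ainvertible (cscale w (1::'a))" "ainv (cscale w (1::'a)) = cscale (inverse w) 1"
    using w0 ainv_unique[of "cscale (inverse w) 1" "cscale w (1::'a)"]
    by (auto simp: cscale_mult_left cscale_mult_right cscale_assoc)
  note m = ainv_mult[OF i(1) neumann(1)[OF na1]]
  show "w \<notin> bspec T" unfolding not_in_bspec using m eq by simp
  have "resolvent T w = cscale (inverse w) (ainv (1 - a))"
    unfolding resolvent_def eq using m i by (simp add: cscale_mult_right)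
  then have "norm (resolvent T w) = norm (ainv (1 - a)) / cmod w"
    by (simp add: norm_cscale norm_inverse divide_inverse mult.commute)
  also have "\<dots> \<le> (1 / (1 - norm a)) / cmod w"
    by (intro divide_right_mono neumann na1) auto
  also have "\<dots> = 1 / (cmod w - norm T)"
    using w0 assms by (simp add: na field_simps)
  finally show "norm (resolvent T w) \<le> 1 / (cmod w - norm T)" .
qed

lemma compact_bspec: "compact (bspec (T::'a::cbanach_algebra))"
proof -
  have "bspec T \<subseteq> cball 0 (norm T)" using resolvent_large(1)[of T] by force
  then show ?thesis using closed_bspec bounded_subset[OF bounded_cball] compact_eq_bounded_closed by blast
qed

lemma continuous_on_resolvent: "continuous_on (- bspec T) (resolvent T)"
proof (rule continuous_at_imp_continuous_on, intro ballI)
  fix v assume "v \<in> - bspec T"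
  then have v: "v \<notin> bspec T" by simp
  have ev: "\<forall>\<^sub>F w in at v. norm (resolvent T w - resolvent T v) \<le> cmod (w - v) * (2 * norm (resolvent T v) ^ 2)"
  proof -
    have "((\<lambda>w. cmod (w - v) * norm (resolvent T v)) \<longlongrightarrow> cmod (v - v) * norm (resolvent T v)) (at v)"
      by (intro tendsto_intros)
    then have "\<forall>\<^sub>F w in at v. cmod (w - v) * norm (resolvent T v) < 1/2"
      by (rule order_tendstoD) simp
    then show ?thesis
    proof (rule eventually_mono)
      fix w assume "cmod (w - v) * norm (resolvent T v) < 1/2"
      then have w: "w \<notin> bspec T" "norm (resolvent T w) \<le> 2 * norm (resolvent T v)"
        using resolvent_perturb[OF v, of w] by auto
      have "norm (resolvent T w - resolvent T v) \<le> cmod (w - v) * (norm (resolvent T w) * norm (resolvent T v))"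
        unfolding resolvent_diff[OF v w(1)] norm_cscale
        by (subst norm_minus_commute) (intro mult_left_mono norm_mult_ineq norm_ge_zero)
      also have "\<dots> \<le> cmod (w - v) * (2 * norm (resolvent T v) * norm (resolvent T v))"
        using w by (intro mult_left_mono mult_right_mono) auto
      finally show "norm (resolvent T w - resolvent T v) \<le> cmod (w - v) * (2 * norm (resolvent T v) ^ 2)"
        by (simp add: power2_eq_square mult.assoc)
    qed
  qed
  have "((\<lambda>w. cmod (w - v) * (2 * norm (resolvent T v) ^ 2)) \<longlongrightarrow> cmod (v - v) * (2 * norm (resolvent T v) ^ 2)) (at v)"
    by (intro tendsto_intros)
  then have "((\<lambda>w. resolvent T w - resolvent T v) \<longlongrightarrow> 0) (at v)"
    by (intro Lim_null_comparison[OF ev]) simp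
  then show "isCont (resolvent T) v" unfolding isCont_def using LIM_zero_cancel by blast
qed

text \<open>By the resolvent identity the difference quotient at \<open>v\<close> equals
  \<open>- \<phi> (R(w) * R(v))\<close>, and \<open>R\<close> is continuous.\<close>

lemma holomorphic_cfunctional_resolvent:
  assumes "cfunctional \<phi>"
  shows "(\<lambda>w. \<phi> (resolvent T w)) holomorphic_on (- bspec T)"
proof -
  interpret phi: bounded_linear \<phi> using assms cfunctionalD by blast
  have op: "open (- bspec T)" using closed_bspec by blast
  have "((\<lambda>w. \<phi> (resolvent T w)) has_field_derivative - \<phi> (resolvent T v * resolvent T v)) (at v)"
    if v: "v \<in> - bspec T" for v
  proof -
    have "isCont (resolvent T) v"
      using continuous_on_resolvent[of T] op v by (simp add: continuous_on_eq_continuous_at)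
    then have "((\<lambda>w. - \<phi> (resolvent T w * resolvent T v)) \<longlongrightarrow> - \<phi> (resolvent T v * resolvent T v)) (at v)"
      by (intro tendsto_intros phi.tendsto isContD)
    moreover have "\<forall>\<^sub>F w in at v. - \<phi> (resolvent T w * resolvent T v) = (\<phi> (resolvent T w) - \<phi> (resolvent T v)) / (w - v)"
    proof -
      have "\<forall>\<^sub>F w in at v. w \<in> - bspec T - {v}"
        using op v eventually_at_in_open by blast
      then show ?thesis
      proof (rule eventually_mono)
        fix w assume w: "w \<in> - bspec T - {v}"
        then have "\<phi> (resolvent T w) - \<phi> (resolvent T v) = (v - w) * \<phi> (resolvent T w * resolvent T v)"
          using resolvent_diff[of v T w] v cfunctionalD(2)[OF assms] by (simp add: phi.diff[symmetric])
        then show "- \<phi> (resolvent T w * resolvent T v) = (\<phi> (resolvent T w) - \<phi> (resolvent T v)) / (w - v)"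
          using w by (simp add: divide_simps) (simp add: algebra_simps)
      qed
    qed
    ultimately show ?thesis unfolding has_field_derivative_iff by (rule Lim_transform_eventually)
  qed
  then show ?thesis unfolding holomorphic_on_open[OF op] by blast
qed

subsection \<open>Cauchy's theorem for cycles\<close>

definition cycle_integral :: "(real \<Rightarrow> complex) list \<Rightarrow> (complex \<Rightarrow> complex) \<Rightarrow> complex" where
  "cycle_integral gs f = (\<Sum>p\<leftarrow>gs. contour_integral p f)"

definition paths_in :: "complex set \<Rightarrow> (real \<Rightarrow> complex) list \<Rightarrow> bool" where
  "paths_in W gs \<longleftrightarrow> (\<forall>p\<in>set gs. valid_path p \<and> path_image p \<subseteq> W)"

definition loops_in :: "complex set \<Rightarrow> (real \<Rightarrow> complex) list \<Rightarrow> bool" where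
  "loops_in W gs \<longleftrightarrow> (\<forall>p\<in>set gs. valid_path p \<and> pathfinish p = pathstart p \<and> path_image p \<subseteq> W)"

lemma loops_in_imp_paths_in: "loops_in W gs \<Longrightarrow> paths_in W gs"
  by (auto simp: loops_in_def paths_in_def)

lemma paths_in_subset: "paths_in W gs \<Longrightarrow> (\<And>p. p \<in> set gs \<Longrightarrow> path_image p \<subseteq> V) \<Longrightarrow> paths_in V gs"
  by (auto simp: paths_in_def)

text \<open>Linear functionals continuous for locally uniform convergence. The abstraction lets one
  result on differentiation in a parameter serve both cycle integrals and the functionals
  \<open>\<phi> (M k)\<close> obtained from module maps \<open>M\<close>.\<close>

definition hol_functional :: "complex set \<Rightarrow> ((complex \<Rightarrow> complex) \<Rightarrow> complex) \<Rightarrow> bool" where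
  "hol_functional W \<Phi> \<longleftrightarrow>
     (\<forall>f g. f holomorphic_on W \<longrightarrow> g holomorphic_on W \<longrightarrow> \<Phi> (\<lambda>z. f z + g z) = \<Phi> f + \<Phi> g) \<and>
     (\<forall>f c. f holomorphic_on W \<longrightarrow> \<Phi> (\<lambda>z. c * f z) = c * \<Phi> f) \<and>
     (\<exists>K L. compact K \<and> K \<subseteq> W \<and> 0 \<le> L \<and>
        (\<forall>f B. f holomorphic_on W \<longrightarrow> (\<forall>z\<in>K. cmod (f z) \<le> B) \<longrightarrow> cmod (\<Phi> f) \<le> L * B))"

text \<open>A contour integral is first bounded by the supremum over an open neighbourhood of the
  path. Enclosing that neighbourhood in a compact subset of \<open>W\<close> gives the bound in the
  form that \<open>hol_functional\<close> requires.\<close>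

lemma compact_enlarge:
  fixes A :: "complex set"
  assumes "compact A" "open W" "A \<subseteq> W"
  obtains S K where "open S" "A \<subseteq> S" "S \<subseteq> K" "compact K" "K \<subseteq> W"
proof (cases "A = {}")
  case True then show ?thesis using that[of "{}" "{}"] by simp
next
  case False
  obtain e where e: "0 < e" "(\<Union>x\<in>A. ball x e) \<subseteq> W"
    using compact_subset_open_imp_ball_epsilon_subset[OF assms] by blast
  show ?thesis
  proof (rule that)
    show "open {x. infdist x A < e/2}" by (intro open_Collect_less continuous_intros)
    show "A \<subseteq> {x. infdist x A < e/2}" using e by auto
    show "{x. infdist x A < e/2} \<subseteq> {x. infdist x A \<le> e/2}" by auto
    show "compact {x. infdist x A \<le> e/2}" by (rule compact_infdist_le) (use False assms e in auto)
    show "{x. infdist x A \<le> e/2} \<subseteq> W"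
    proof
      fix x assume "x \<in> {x. infdist x A \<le> e/2}"
      moreover obtain a where "a \<in> A" "infdist x A = dist x a"
        using infdist_attains_inf[of A x] False assms(1) compact_imp_closed by blast
      ultimately have "a \<in> A" "dist a x < e" using e(1) by (auto simp: dist_commute)
      then have "x \<in> (\<Union>x\<in>A. ball x e)" by auto
      then show "x \<in> W" using e(2) by blast
    qed
  qed
qed

lemma cycle_integral_bound:
  assumes W: "open W" and gs: "paths_in W gs"
  shows "\<exists>K L. compact K \<and> K \<subseteq> W \<and> 0 \<le> L \<and>
    (\<forall>f B. f holomorphic_on W \<longrightarrow> (\<forall>z\<in>K. cmod (f z) \<le> B) \<longrightarrow> cmod (cycle_integral gs f) \<le> L * B)"
  using gs
proof (induction gs)
    case Nil
    show ?case by (rule exI[of _ "{}"], rule exI[of _ 0]) (simp add: cycle_integral_def)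
  next
    case (Cons p gs)
    have "paths_in W gs" using Cons.prems by (simp add: paths_in_def)
    from Cons.IH[OF this] obtain K L where KL: "compact K" "K \<subseteq> W" "0 \<le> L"
      "\<forall>f B. f holomorphic_on W \<longrightarrow> (\<forall>z\<in>K. cmod (f z) \<le> B) \<longrightarrow> cmod (cycle_integral gs f) \<le> L * B"
      by blast
    have g: "valid_path p" "path_image p \<subseteq> W" using Cons.prems by (auto simp: paths_in_def)
    obtain S K' where S: "open S" "path_image p \<subseteq> S" "S \<subseteq> K'" "compact K'" "K' \<subseteq> W"
      using compact_enlarge[OF compact_valid_path_image[OF g(1)] W g(2)] by blast
    obtain L' where L': "0 < L'"
      "\<forall>f B. f holomorphic_on S \<and> (\<forall>z\<in>S. cmod (f z) \<le> B) \<longrightarrow> cmod (contour_integral p f) \<le> L' * B"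
      using contour_integral_bound_exists[OF S(1) g(1) S(2)] by blast
    show ?case
    proof (intro exI conjI allI impI)
      show "compact (K \<union> K')" "K \<union> K' \<subseteq> W" "0 \<le> L' + L" using KL S L' by auto
      fix f B assume f: "f holomorphic_on W" "\<forall>z\<in>K \<union> K'. cmod (f z) \<le> B"
      have "f holomorphic_on S" using f(1) S by (meson holomorphic_on_subset order_trans)
      then have "cmod (contour_integral p f) \<le> L' * B" using L'(2) f(2) S(3) by blast
      moreover have "cmod (cycle_integral gs f) \<le> L * B" using KL(4) f by blast
      ultimately show "cmod (cycle_integral (p # gs) f) \<le> (L' + L) * B"
        using norm_triangle_ineq[of "contour_integral p f" "cycle_integral gs f"]
        by (simp add: cycle_integral_def distrib_right)
    qed
qed

lemma cycle_integral_add: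
  assumes "open W" "paths_in W gs"
    and "f holomorphic_on W" "g holomorphic_on W"
  shows "cycle_integral gs (\<lambda>z. f z + g z) = cycle_integral gs f + cycle_integral gs g"
  using assms(2) unfolding cycle_integral_def
proof (induction gs)
  case (Cons p gs)
  have "contour_integral p (\<lambda>z. f z + g z) = contour_integral p f + contour_integral p g"
    by (intro contour_integral_add contour_integrable_holomorphic_simple[OF _ assms(1)])
       (use assms Cons.prems in \<open>auto simp: paths_in_def\<close>)
  then show ?case using Cons by (simp add: paths_in_def)
qed simp

lemma cycle_integral_cmult:
  assumes "open W" "paths_in W gs" and "f holomorphic_on W"
  shows "cycle_integral gs (\<lambda>z. c * f z) = c * cycle_integral gs f"
  using assms(2) unfolding cycle_integral_def
proof (induction gs)
  case (Cons p gs)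
  have "contour_integral p (\<lambda>z. c * f z) = c * contour_integral p f"
    by (intro contour_integral_lmul contour_integrable_holomorphic_simple[OF _ assms(1)])
       (use assms Cons.prems in \<open>auto simp: paths_in_def\<close>)
  then show ?case using Cons by (simp add: distrib_left paths_in_def)
qed simp

lemma cycle_integral_cong:
  assumes "\<And>p z. p \<in> set gs \<Longrightarrow> z \<in> path_image p \<Longrightarrow> f z = g z"
  shows "cycle_integral gs f = cycle_integral gs g"
  unfolding cycle_integral_def
  by (intro arg_cong[where f=sum_list] map_cong refl contour_integral_eq) (use assms in auto)

lemma hol_functional_cycle_integral:
  assumes W: "open W" and gs: "paths_in W gs"
  shows "hol_functional W (cycle_integral gs)"
proof -
  show ?thesis
    unfolding hol_functional_def
    by (intro conjI allI impI cycle_integral_bound[OF assms] cycle_integral_add[OF assms] cycle_integral_cmult[OF assms])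
qed

text \<open>Taylor's formula, with the second derivative on the half ball estimated by Cauchy's
  inequality on discs of radius \<open>R/4\<close>. The constant depends on \<open>M\<close> and
  \<open>R\<close> alone and is therefore uniform over a family of functions.\<close>

lemma holomorphic_quadratic_remainder:
  assumes f: "f holomorphic_on ball a R" and M: "\<And>x. x \<in> ball a R \<Longrightarrow> cmod (f x) \<le> M"
    and z: "z \<in> ball a (R/2)"
  shows "cmod (f z - f a - (z - a) * deriv f a) \<le> 2 * M / (R/4)^2 * cmod (z - a)^2"
proof -
  have R: "0 < R" using z by (smt (verit) ball_eq_empty empty_iff field_sum_of_halves)
  have "cmod ((deriv ^^ 0) f z - (\<Sum>i\<le>1. (deriv ^^ i) f a * (z - a) ^ i / fact i))
      \<le> (2 * M / (R/4)^2) * cmod (z - a)^(Suc 1) / fact 1"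
  proof (rule complex_Taylor[where S="ball a (R/2)"])
    fix i x assume x: "x \<in> ball a (R/2)"
    have "x \<in> ball a R" using x R by simp
    then have "((deriv ^^ i) f has_field_derivative (deriv ^^ (Suc i)) f x) (at x)"
      using has_field_derivative_higher_deriv[OF f] by simp
    then show "((deriv ^^ i) f has_field_derivative (deriv ^^ (Suc i)) f x) (at x within ball a (R/2))"
      by (rule has_field_derivative_at_within)
  next
    fix x assume x: "x \<in> ball a (R/2)"
    have sub: "cball x (R/4) \<subseteq> ball a R"
    proof
      fix y assume "y \<in> cball x (R/4)"
      then show "y \<in> ball a R" using x dist_triangle[of a y x] R by (simp add: dist_commute)
    qed
    have "cmod ((deriv ^^ 2) f x) \<le> fact 2 * M / (R/4) ^ 2"
    proof (rule Cauchy_inequality)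
      show "f holomorphic_on ball x (R/4)" using f sub by (meson ball_subset_cball holomorphic_on_subset order_trans)
      show "continuous_on (cball x (R/4)) f" using f sub by (meson holomorphic_on_imp_continuous_on holomorphic_on_subset)
      fix y assume "cmod (x - y) = R / 4"
      then have "y \<in> cball x (R/4)" by (simp add: dist_norm)
      then show "cmod (f y) \<le> M" using sub M by blast
    qed (use R in auto)
    then show "cmod ((deriv ^^ (Suc 1)) f x) \<le> 2 * M / (R/4)^2"
      by (simp add: numeral_2_eq_2)
  qed (use z R in auto)
  then show ?thesis by (simp add: power2_eq_square algebra_simps)
qed

text \<open>Differentiation under \<open>\<Phi>\<close>. The difference quotients in
  \<open>w\<close> converge at rate \<open>C * cmod (w - w0)\<close> uniformly on the compact set
  that controls \<open>\<Phi>\<close>, so their images under \<open>\<Phi>\<close> satisfy a Cauchy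
  condition. The functional is never applied to the pointwise limit
  \<open>deriv (\<lambda>w. G w z) w0\<close>, whose holomorphy in \<open>z\<close> would have to be
  established first.\<close>

lemma holomorphic_hol_functional:
  assumes \<Phi>: "hol_functional W \<Phi>" and D: "open D"
    and G: "\<And>w. w \<in> D \<Longrightarrow> G w holomorphic_on W"
    and G': "\<And>z. z \<in> W \<Longrightarrow> (\<lambda>w. G w z) holomorphic_on D"
    and bd: "\<And>K w0. compact K \<Longrightarrow> K \<subseteq> W \<Longrightarrow> w0 \<in> D \<Longrightarrow>
       \<exists>r M. 0 < r \<and> ball w0 r \<subseteq> D \<and> (\<forall>w\<in>ball w0 r. \<forall>z\<in>K. cmod (G w z) \<le> M)"
  shows "(\<lambda>w. \<Phi> (G w)) holomorphic_on D"
  unfolding holomorphic_on_open[OF D]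
proof
  fix w0 assume w0: "w0 \<in> D"
  have add: "\<And>f g. f holomorphic_on W \<Longrightarrow> g holomorphic_on W \<Longrightarrow> \<Phi> (\<lambda>z. f z + g z) = \<Phi> f + \<Phi> g"
    and mul: "\<And>f c. f holomorphic_on W \<Longrightarrow> \<Phi> (\<lambda>z. c * f z) = c * \<Phi> f"
    using \<Phi> unfolding hol_functional_def by simp_all
  obtain K L where K: "compact K" "K \<subseteq> W" "0 \<le> L"
    and L: "\<forall>f B. f holomorphic_on W \<longrightarrow> (\<forall>z\<in>K. cmod (f z) \<le> B) \<longrightarrow> cmod (\<Phi> f) \<le> L * B"
    using \<Phi> unfolding hol_functional_def by blast
  have dif: "\<Phi> (\<lambda>z. f z - g z) = \<Phi> f - \<Phi> g" if "f holomorphic_on W" "g holomorphic_on W" for f g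
    using add[OF that(1), of "\<lambda>z. (-1) * g z"] mul[OF that(2), of "-1"] that
    by (simp add: holomorphic_on_minus)
  obtain r M where r: "0 < r" "ball w0 r \<subseteq> D" and M: "\<And>w z. w \<in> ball w0 r \<Longrightarrow> z \<in> K \<Longrightarrow> cmod (G w z) \<le> M"
    using bd[OF K(1,2) w0] by blast
  define C where "C = 2 * M / (r/4)^2"
  define Q where "Q w = (\<lambda>z. inverse (w - w0) * (G w z - G w0 z))" for w
  define q where "q w = (\<Phi> (G w) - \<Phi> (G w0)) / (w - w0)" for w
  have Qhol: "Q w holomorphic_on W" if "w \<in> ball w0 r" for w
    unfolding Q_def using G that r w0 by (intro holomorphic_intros) auto
  have \<Phi>Q: "\<Phi> (Q w) = q w" if w: "w \<in> ball w0 r" for w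
  proof -
    have h: "G w holomorphic_on W" "G w0 holomorphic_on W" using G w w0 r by auto
    then have "(\<lambda>z. G w z - G w0 z) holomorphic_on W" by (intro holomorphic_intros)
    then show ?thesis unfolding Q_def q_def by (simp add: mul dif[OF h] divide_inverse mult.commute)
  qed
  have Qb: "cmod (Q w z - deriv (\<lambda>w. G w z) w0) \<le> C * cmod (w - w0)"
    if w: "w \<in> ball w0 (r/2)" "w \<noteq> w0" and z: "z \<in> K" for w z
  proof -
    have "cmod (G w z - G w0 z - (w - w0) * deriv (\<lambda>w. G w z) w0) \<le> C * cmod (w - w0)^2"
      unfolding C_def
    proof (rule holomorphic_quadratic_remainder[OF _ _ w(1)])
      show "(\<lambda>w. G w z) holomorphic_on ball w0 r"
        using G' z K(2) r(2) by (blast intro: holomorphic_on_subset)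
    qed (use M z in auto)
    moreover have "Q w z - deriv (\<lambda>w. G w z) w0 = (G w z - G w0 z - (w - w0) * deriv (\<lambda>w. G w z) w0) / (w - w0)"
      using w by (simp add: Q_def field_simps)
    ultimately have "cmod (Q w z - deriv (\<lambda>w. G w z) w0) \<le> C * cmod (w - w0)^2 / cmod (w - w0)"
      by (simp add: norm_divide divide_right_mono)
    then show ?thesis using w by (simp add: power2_eq_square)
  qed
  have qb: "cmod (q w - q w') \<le> L * (C * cmod (w - w0) + C * cmod (w' - w0))"
    if w: "w \<in> ball w0 (r/2)" "w \<noteq> w0" and w': "w' \<in> ball w0 (r/2)" "w' \<noteq> w0" for w w'
  proof -
    have ww: "w \<in> ball w0 r" "w' \<in> ball w0 r" using w w' r by auto
    have "q w - q w' = \<Phi> (\<lambda>z. Q w z - Q w' z)"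
      using dif[OF Qhol Qhol] \<Phi>Q ww by simp
    moreover have "cmod (\<Phi> (\<lambda>z. Q w z - Q w' z)) \<le> L * (C * cmod (w - w0) + C * cmod (w' - w0))"
    proof (rule L[THEN spec, THEN spec, THEN mp, THEN mp])
      show "(\<lambda>z. Q w z - Q w' z) holomorphic_on W" using Qhol ww by (intro holomorphic_intros) auto
      show "\<forall>z\<in>K. cmod (Q w z - Q w' z) \<le> C * cmod (w - w0) + C * cmod (w' - w0)"
      proof
        fix z assume z: "z \<in> K"
        have "cmod (Q w z - Q w' z) \<le> cmod (Q w z - deriv (\<lambda>w. G w z) w0) + cmod (Q w' z - deriv (\<lambda>w. G w z) w0)"
          using norm_triangle_ineq4[of "Q w z - deriv (\<lambda>w. G w z) w0" "Q w' z - deriv (\<lambda>w. G w z) w0"] by simp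
        then show "cmod (Q w z - Q w' z) \<le> C * cmod (w - w0) + C * cmod (w' - w0)"
          using Qb[OF w z] Qb[OF w' z] by linarith
      qed
    qed
    ultimately show ?thesis by simp
  qed
  \<comment> \<open>Any sequence in the punctured half ball tending to \<open>w0\<close> would do;
    it produces the limit \<open>l\<close> by completeness. The factor \<open>r / 4\<close> keeps it
    inside radius \<open>r / 2\<close>.\<close>
  define s :: "nat \<Rightarrow> complex" where "s n = w0 + of_real (r / 4 * inverse (real (Suc n)))" for n
  have s: "cmod (s n - w0) = r / 4 * inverse (real (Suc n))" for n
    unfolding s_def using r by (simp add: norm_mult norm_divide del: of_real_mult of_real_divide of_real_inverse of_nat_Suc)
  have slim: "(\<lambda>n. cmod (s n - w0)) \<longlonglongrightarrow> 0"
    unfolding s using tendsto_mult_left[OF LIMSEQ_inverse_real_of_nat, of "r/4"] by simp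
  have sin: "s n \<in> ball w0 (r/2)" "s n \<noteq> w0" for n
  proof -
    have "inverse (real (Suc n)) \<le> 1" by (simp add: inverse_le_1_iff)
    then have "r / 4 * inverse (real (Suc n)) \<le> r / 4 * 1" using r by (intro mult_left_mono) auto
    then have "cmod (s n - w0) < r/2" unfolding s using r(1) by simp
    then show "s n \<in> ball w0 (r/2)" by (simp add: dist_norm norm_minus_commute)
    have "0 < cmod (s n - w0)" unfolding s using r(1) by simp
    then show "s n \<noteq> w0" by auto
  qed
  have "Cauchy (\<lambda>n. q (s n))"
  proof (rule metric_CauchyI)
    fix e :: real assume e: "0 < e"
    have "(\<lambda>n. L * (C * cmod (s n - w0))) \<longlonglongrightarrow> L * (C * 0)" by (intro tendsto_intros slim)
    then have "\<forall>\<^sub>F n in sequentially. L * (C * cmod (s n - w0)) < e/2"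
      by (rule order_tendstoD) (use e in simp)
    then obtain N where N: "\<And>n. n \<ge> N \<Longrightarrow> L * (C * cmod (s n - w0)) < e/2"
      by (auto simp: eventually_sequentially)
    show "\<exists>N. \<forall>m\<ge>N. \<forall>n\<ge>N. dist (q (s m)) (q (s n)) < e"
    proof (intro exI allI impI)
      fix m n assume "N \<le> m" "N \<le> n"
      then show "dist (q (s m)) (q (s n)) < e"
        using qb[OF sin[of m] sin[of n]] N[of m] N[of n] by (simp add: dist_norm distrib_left)
    qed
  qed
  then obtain l where l: "(\<lambda>n. q (s n)) \<longlonglongrightarrow> l" using Cauchy_convergent convergent_def by blast
  have ql: "cmod (q w - l) \<le> L * (C * cmod (w - w0))" if w: "w \<in> ball w0 (r/2)" "w \<noteq> w0" for w
  proof (rule LIMSEQ_le)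
    show "(\<lambda>n. cmod (q w - q (s n))) \<longlonglongrightarrow> cmod (q w - l)" by (intro tendsto_intros l)
    have "(\<lambda>n. L * (C * cmod (w - w0) + C * cmod (s n - w0))) \<longlonglongrightarrow> L * (C * cmod (w - w0) + C * 0)"
      by (intro tendsto_intros slim)
    then show "(\<lambda>n. L * (C * cmod (w - w0) + C * cmod (s n - w0))) \<longlonglongrightarrow> L * (C * cmod (w - w0))" by simp
    show "\<exists>N. \<forall>n\<ge>N. cmod (q w - q (s n)) \<le> L * (C * cmod (w - w0) + C * cmod (s n - w0))"
      using qb[OF w sin] by blast
  qed
  have "((\<lambda>w. q w - l) \<longlongrightarrow> 0) (at w0)"
  proof (rule Lim_null_comparison)
    have "\<forall>\<^sub>F w in at w0. w \<in> ball w0 (r/2) - {w0}"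
      by (rule eventually_at_in_open) (use r in auto)
    then show "\<forall>\<^sub>F w in at w0. cmod (q w - l) \<le> L * (C * cmod (w - w0))"
      by (rule eventually_mono) (use ql in blast)
    have "((\<lambda>w. L * (C * cmod (w - w0))) \<longlongrightarrow> L * (C * cmod (w0 - w0))) (at w0)" by (intro tendsto_intros)
    then show "((\<lambda>w. L * (C * cmod (w - w0))) \<longlongrightarrow> 0) (at w0)" by simp
  qed
  then have "(q \<longlongrightarrow> l) (at w0)" using LIM_zero_cancel by blast
  then show "\<exists>f'. ((\<lambda>w. \<Phi> (G w)) has_field_derivative f') (at w0)"
    unfolding has_field_derivative_iff q_def by blast
qed

section \<open>The holomorphic difference quotient\<close>

definition diff_quot :: "(complex \<Rightarrow> complex) \<Rightarrow> complex \<Rightarrow> complex \<Rightarrow> complex" where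
  "diff_quot f w z = (if z = w then deriv f w else (f z - f w) / (z - w))"

text \<open>Symmetry transfers holomorphy from the second variable, where the singularity is
  removable, to the first.\<close>

lemma diff_quot_commute: "diff_quot f w z = diff_quot f z w"
  by (auto simp: diff_quot_def) (metis minus_diff_eq minus_divide_divide)

lemma diff_quot_mult: "(z - w) * diff_quot f w z = f z - f w"
  by (simp add: diff_quot_def)

lemma holomorphic_diff_quot:
  assumes "f holomorphic_on W" "open W"
  shows "diff_quot f w holomorphic_on W" "(\<lambda>w. diff_quot f w z) holomorphic_on W"
proof -
  show *: "diff_quot f w holomorphic_on W" for w
    using pole_lemma_open[OF assms, of w] unfolding diff_quot_def[abs_def] .
  show "(\<lambda>w. diff_quot f w z) holomorphic_on W"
    using *[of z] by (simp add: diff_quot_commute[of f _ z])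
qed

text \<open>Close to the diagonal the difference quotient is bounded by the maximum principle in the
second point.\<close>

lemma diff_quot_locally_bounded:
  assumes f: "f holomorphic_on W" and W: "open W" and K: "compact K" "K \<subseteq> W" and w0: "w0 \<in> W"
  shows "\<exists>r M. 0 < r \<and> ball w0 r \<subseteq> W \<and> (\<forall>w\<in>ball w0 r. \<forall>z\<in>K. cmod (diff_quot f w z) \<le> M)"
proof -
  obtain R where R: "0 < R" "cball w0 R \<subseteq> W" using W w0 open_contains_cball by blast
  define r where "r = R / 2"
  have r: "0 < r" "cball w0 (2 * r) \<subseteq> W" using R by (auto simp: r_def)
  have "compact (K \<union> cball w0 (2 * r))" using K by auto
  moreover have fW: "continuous_on W f" using f holomorphic_on_imp_continuous_on by blast
  then have "continuous_on (K \<union> cball w0 (2 * r)) f" using K r by (intro continuous_on_subset[OF fW]) auto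
  ultimately have "bounded (f ` (K \<union> cball w0 (2 * r)))" using compact_continuous_image compact_imp_bounded by blast
  then obtain M where M: "\<And>x. x \<in> K \<union> cball w0 (2 * r) \<Longrightarrow> cmod (f x) \<le> M" unfolding bounded_iff by blast
  have M0: "0 \<le> M" using M[of w0] r by (smt (verit) UnI2 centre_in_cball norm_ge_zero)
  have far: "cmod (diff_quot f w z) \<le> 4 * M / r" if "w \<in> cball w0 (2 * r)" "z \<in> K" "r / 2 \<le> cmod (z - w)" for w z
  proof -
    have "z \<noteq> w" using that r by auto
    then have "cmod (diff_quot f w z) = cmod (f z - f w) / cmod (z - w)" by (simp add: diff_quot_def norm_divide)
    also have "\<dots> \<le> (2 * M) / (r / 2)"
      using that M[of z] M[of w] norm_triangle_ineq4[of "f z" "f w"] r M0 by (intro frac_le) auto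
    finally show ?thesis by (simp add: field_simps)
  qed
  have "cmod (diff_quot f w z) \<le> 4 * M / r" if w: "w \<in> ball w0 r" and z: "z \<in> K" for w z
  \<comment> \<open>If \<open>z\<close> has distance at least \<open>3/2 * r\<close> from
    \<open>w0\<close>, it is at least \<open>r/2\<close> away from every \<open>w\<close> in
    \<open>ball w0 r\<close>. Otherwise it is at least \<open>r/2\<close> away from the circle of
    radius \<open>2 * r\<close>, and the maximum principle carries the bound inwards.\<close>
  proof (cases "3/2 * r \<le> cmod (z - w0)")
    case True
    have "cmod (z - w0) \<le> cmod (z - w) + cmod (w - w0)" using norm_triangle_ineq[of "z - w" "w - w0"] by simp
    moreover have "cmod (w - w0) < r" using w by (simp add: dist_norm norm_minus_commute)
    ultimately have "r / 2 \<le> cmod (z - w)" using True by linarith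
    then show ?thesis using far[of w z] w z r by auto
  next
    case False
    have hol: "(\<lambda>w. diff_quot f w z) holomorphic_on W" using holomorphic_diff_quot[OF f W] by blast
    show ?thesis
    proof (rule maximum_modulus_frontier[where S="ball w0 (2 * r)" and f="\<lambda>w. diff_quot f w z"])
      show "(\<lambda>w. diff_quot f w z) holomorphic_on interior (ball w0 (2 * r))"
        using hol by (rule holomorphic_on_subset) (use r in auto)
      show "continuous_on (closure (ball w0 (2 * r))) (\<lambda>w. diff_quot f w z)"
        using hol r by (intro holomorphic_on_imp_continuous_on) (auto intro: holomorphic_on_subset)
      show "w \<in> ball w0 (2 * r)" using w r by auto
      fix v assume "v \<in> frontier (ball w0 (2 * r))"
      then have v: "cmod (v - w0) = 2 * r" using r by (simp add: frontier_ball dist_norm norm_minus_commute)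
      have "cmod (v - w0) \<le> cmod (z - v) + cmod (z - w0)"
        using norm_triangle_ineq4[of "z - w0" "z - v"] by simp
      then have "r / 2 \<le> cmod (z - v)" using v False by linarith
      then show "cmod (diff_quot f v z) \<le> 4 * M / r"
        using far[of v z] z v by (auto simp: dist_norm norm_minus_commute)
    qed auto
  qed
  moreover have "ball w0 r \<subseteq> W" using r by (intro order_trans[OF _ r(2)]) auto
  ultimately show ?thesis using r(1) by blast
qed

text \<open>One radius works for all loops of the list. This gives openness of the set of winding
  number zero and, later, permits moving a point off the grid lines.\<close>

lemma cycle_winding_locally_constant:
  assumes gs: "loops_in (- {w0}) gs"
  shows "\<exists>e>0. \<forall>w\<in>ball w0 e. (\<Sum>p\<leftarrow>gs. winding_number p w) = (\<Sum>p\<leftarrow>gs. winding_number p w0) \<and>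
    (\<forall>p\<in>set gs. w \<notin> path_image p)"
proof -
  define A where "A = (\<Inter>p\<in>set gs. {z. z \<notin> path_image p \<and> winding_number p z = winding_number p w0})"
  have "open A" unfolding A_def
    by (intro open_INT ballI open_winding_number_levelsets) (use gs in \<open>auto simp: loops_in_def valid_path_imp_path\<close>)
  moreover have "w0 \<in> A" unfolding A_def using gs by (auto simp: loops_in_def)
  ultimately obtain e where e: "0 < e" "ball w0 e \<subseteq> A" using open_contains_ball by blast
  show ?thesis
  proof (intro exI[of _ e] conjI ballI e(1))
    fix w assume "w \<in> ball w0 e"
    then have w: "w \<in> A" using e by blast
    then show "(\<Sum>p\<leftarrow>gs. winding_number p w) = (\<Sum>p\<leftarrow>gs. winding_number p w0)"
      unfolding A_def by (intro arg_cong[where f=sum_list] map_cong) auto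
    show "w \<notin> path_image p" if "p \<in> set gs" for p using w that unfolding A_def by blast
  qed
qed

lemma cycle_winding_number:
  assumes gs: "paths_in (- {w}) gs"
  shows "cycle_integral gs (\<lambda>z. 1 / (z - w)) = 2 * pi * \<i> * (\<Sum>p\<leftarrow>gs. winding_number p w)"
  using gs unfolding cycle_integral_def
proof (induction gs)
  case (Cons p gs)
  have "contour_integral p (\<lambda>z. 1 / (z - w)) = 2 * pi * \<i> * winding_number p w"
    using winding_number_valid_path[of p w] Cons.prems by (simp add: paths_in_def)
  then show ?case using Cons by (simp add: distrib_left paths_in_def)
qed simp

text \<open>Dixon's argument: integrating the difference quotient over the cycle gives a function that is
holomorphic on \<^term>\<open>W\<close> and continues, as a Cauchy integral, to the points of winding number zero.
The resulting entire function vanishes at infinity.\<close>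

lemma Cauchy_integral_formula_cycle:
  assumes W: "open W" and f: "f holomorphic_on W"
    and gs: "loops_in W gs"
    and zero: "\<And>w. w \<notin> W \<Longrightarrow> (\<Sum>p\<leftarrow>gs. winding_number p w) = 0"
    and w: "w \<in> W" "loops_in (- {w}) gs"
  shows "cycle_integral gs (\<lambda>z. f z / (z - w)) = 2 * pi * \<i> * (\<Sum>p\<leftarrow>gs. winding_number p w) * f w"
proof -
  define P where "P = (\<Union>p\<in>set gs. path_image p)"
  have cP: "compact P" unfolding P_def using gs by (intro compact_UN) (auto simp: loops_in_def intro: compact_valid_path_image)
  have PW: "P \<subseteq> W" unfolding P_def using gs by (auto simp: loops_in_def)
  have paths: "paths_in V gs" if "P \<subseteq> V" for V
    using paths_in_subset[OF loops_in_imp_paths_in[OF gs]] that unfolding P_def by blast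
  define h1 where "h1 w = cycle_integral gs (diff_quot f w)" for w
  define h2 where "h2 w = cycle_integral gs (\<lambda>z. f z / (z - w))" for w
  define V where "V = {w. w \<notin> P \<and> (\<Sum>p\<leftarrow>gs. winding_number p w) = 0}"
  have h1: "h1 holomorphic_on W"
    unfolding h1_def[abs_def]
  proof (rule holomorphic_hol_functional[where \<Phi>="cycle_integral gs" and G="diff_quot f", OF _ W])
    show "hol_functional W (cycle_integral gs)"
      by (rule hol_functional_cycle_integral[OF W paths[OF PW]])
  qed (rule holomorphic_diff_quot[OF f W] diff_quot_locally_bounded[OF f W]; assumption)+
  have h2ball: "\<exists>r>0. h2 holomorphic_on ball w0 r" if w0: "w0 \<notin> P" for w0
  proof -
    have "open (- P)" using cP compact_imp_closed by blast
    then obtain R where R: "0 < R" "cball w0 R \<subseteq> - P" using w0 open_contains_cball by blast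
    \<comment> \<open>Removing a closed disc around \<open>w0\<close> leaves the paths inside the
      domain and keeps the pole, taken in the smaller disc of radius \<open>R/2\<close>, outside
      it.\<close>
    let ?W' = "W - cball w0 R"
    have op: "open ?W'" using W by auto
    have hf: "hol_functional ?W' (cycle_integral gs)"
      using hol_functional_cycle_integral[OF op paths] R PW by blast
    have "(\<lambda>w. cycle_integral gs (\<lambda>z. f z / (z - w))) holomorphic_on ball w0 (R/2)"
    proof (rule holomorphic_hol_functional[where G="\<lambda>w z. f z / (z - w)", OF hf])
      show "(\<lambda>z. f z / (z - v)) holomorphic_on ?W'" if "v \<in> ball w0 (R/2)" for v
        using that R by (intro holomorphic_intros holomorphic_on_subset[OF f]) auto
      show "(\<lambda>v. f z / (z - v)) holomorphic_on ball w0 (R/2)" if "z \<in> ?W'" for z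
        using that R by (intro holomorphic_intros) auto
      fix K w1 assume K: "compact K" "K \<subseteq> ?W'" and w1: "w1 \<in> ball w0 (R/2)"
      have "continuous_on K f" using f K holomorphic_on_imp_continuous_on continuous_on_subset by blast
      then have "bounded (f ` K)" using K compact_continuous_image compact_imp_bounded by blast
      then obtain M where M: "\<And>z. z \<in> K \<Longrightarrow> cmod (f z) \<le> M" unfolding bounded_iff by blast
      obtain r where r: "0 < r" "ball w1 r \<subseteq> ball w0 (R/2)" using openE[OF open_ball w1] by blast
      have "cmod (f z / (z - v)) \<le> M / (R/2)" if "v \<in> ball w1 r" "z \<in> K" for v z
      proof -
        have "dist w0 v < R/2" using that r by auto
        moreover have "R < dist w0 z" using that K by auto
        ultimately have "R/2 \<le> cmod (z - v)" using dist_triangle[of w0 z v] by (simp add: dist_norm norm_minus_commute)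
        then show ?thesis
          unfolding norm_divide using M[OF that(2)] R by (intro frac_le) (auto intro: order_trans[OF norm_ge_zero])
      qed
      then show "\<exists>r M. 0 < r \<and> ball w1 r \<subseteq> ball w0 (R/2) \<and> (\<forall>w\<in>ball w1 r. \<forall>z\<in>K. cmod (f z / (z - w)) \<le> M)"
        using r by blast
    qed auto
    then show ?thesis unfolding h2_def[abs_def] using R by (intro exI[of _ "R/2"]) auto
  qed
  have h2: "h2 field_differentiable at v" if "v \<notin> P" for v
    using h2ball[OF that] by (metis centre_in_ball holomorphic_on_imp_differentiable_at open_ball)
  have eq: "h1 v = h2 v - f v * (2 * pi * \<i> * (\<Sum>p\<leftarrow>gs. winding_number p v))" if v: "v \<in> W" "v \<notin> P" for v
  proof -
    have op: "open (W - {v})" using W by auto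
    have gs': "paths_in (W - {v}) gs" by (rule paths) (use v PW in auto)
    have hf: "(\<lambda>z. f z / (z - v)) holomorphic_on W - {v}" "(\<lambda>z. 1 / (z - v)) holomorphic_on W - {v}"
      by (intro holomorphic_intros holomorphic_on_subset[OF f]; auto)+
    have "h1 v = cycle_integral gs (\<lambda>z. f z / (z - v) + (- f v) * (1 / (z - v)))"
      unfolding h1_def by (rule cycle_integral_cong) (use v in \<open>auto simp: P_def diff_quot_def diff_divide_distrib\<close>)
    also have "\<dots> = h2 v + cycle_integral gs (\<lambda>z. (- f v) * (1 / (z - v)))"
      unfolding h2_def by (rule cycle_integral_add[OF op gs' hf(1)]) (auto intro!: holomorphic_intros)
    also have "cycle_integral gs (\<lambda>z. (- f v) * (1 / (z - v))) = (- f v) * cycle_integral gs (\<lambda>z. 1 / (z - v))"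
      by (rule cycle_integral_cmult[OF op gs' hf(2)])
    also have "cycle_integral gs (\<lambda>z. 1 / (z - v)) = 2 * pi * \<i> * (\<Sum>p\<leftarrow>gs. winding_number p v)"
      by (rule cycle_winding_number[OF paths]) (use v in auto)
    finally show ?thesis by simp
  qed
  have oV: "open V"
  proof (rule openI)
    fix v assume v: "v \<in> V"
    have "loops_in (- {v}) gs"
      using gs v unfolding V_def P_def loops_in_def by blast
    from cycle_winding_locally_constant[OF this] obtain e where e: "0 < e"
      "\<forall>w\<in>ball v e. (\<Sum>p\<leftarrow>gs. winding_number p w) = (\<Sum>p\<leftarrow>gs. winding_number p v) \<and>
        (\<forall>p\<in>set gs. w \<notin> path_image p)"
      by blast
    have "ball v e \<subseteq> V"
    proof
      fix w assume "w \<in> ball v e"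
      from e(2)[rule_format, OF this] show "w \<in> V" using v unfolding V_def P_def by simp
    qed
    then show "\<exists>e>0. ball v e \<subseteq> V" using e(1) by blast
  qed
  \<comment> \<open>The two pieces agree on \<open>W \<inter> V\<close>, since there the winding
    term in \<open>eq\<close> is zero; the hypothesis on winding numbers makes
    \<open>W \<union> V\<close> the whole plane.\<close>
  define h where "h v = (if v \<in> W then h1 v else h2 v)" for v
  have hV: "h v = h2 v" if "v \<in> V" for v using eq[of v] that by (auto simp: h_def V_def)
  have "h holomorphic_on W \<union> V"
  proof (rule holomorphic_on_Un)
    show "h holomorphic_on W" using h1 by (rule holomorphic_transform) (simp add: h_def)
    have "h2 holomorphic_on V" using h2 field_differentiable_at_within by (auto simp: holomorphic_on_def V_def)
    then show "h holomorphic_on V" by (rule holomorphic_transform) (simp add: hV)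
  qed (use W oV in auto)
  moreover have "W \<union> V = UNIV" using zero PW by (auto simp: V_def)
  ultimately have hol: "h holomorphic_on UNIV" by simp
  have evV: "\<forall>\<^sub>F v in at_infinity. v \<in> V"
  proof -
    have "\<forall>\<^sub>F v in at_infinity. winding_number p v = 0" if "p \<in> set gs" for p
      using winding_number_zero_at_infinity[of p] gs that valid_path_imp_path[of p]
      by (auto simp: eventually_at_infinity loops_in_def)
    then have "\<forall>\<^sub>F v in at_infinity. \<forall>p\<in>set gs. winding_number p v = 0" by (intro eventually_ball_finite) auto
    moreover obtain R where R: "\<forall>z\<in>P. cmod z \<le> R" using compact_imp_bounded[OF cP] unfolding bounded_iff by blast
    have "\<forall>\<^sub>F v in at_infinity. v \<notin> P"
      unfolding eventually_at_infinity using R by (intro exI[of _ "R + 1"]) fastforce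
    ultimately show ?thesis
    proof eventually_elim
      case (elim v)
      then have "(\<Sum>p\<leftarrow>gs. winding_number p v) = (\<Sum>p\<leftarrow>gs. 0)" by (intro arg_cong[where f=sum_list] map_cong) auto
      then show ?case using elim by (simp add: V_def)
    qed
  qed
  have lim: "(h \<longlongrightarrow> 0) at_infinity"
  proof -
    obtain R where R: "0 < R" "P \<subseteq> ball 0 R" using bounded_subset_ballD[OF compact_imp_bounded[OF cP], of 0] by blast
    \<comment> \<open>Cutting \<open>W\<close> down to a ball around the paths keeps the controlling
      set \<open>K\<close> bounded and the kernel holomorphic for all distant
      \<open>v\<close>.\<close>
    define W' where "W' = W \<inter> ball 0 R"
    have op: "open W'" using W unfolding W'_def by auto
    have gs': "paths_in W' gs" unfolding W'_def by (rule paths) (use R(2) PW in auto)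
    obtain K L where K: "compact K" "K \<subseteq> W'" "0 \<le> L"
      and L: "\<forall>f B. f holomorphic_on W' \<longrightarrow> (\<forall>z\<in>K. cmod (f z) \<le> B) \<longrightarrow> cmod (cycle_integral gs f) \<le> L * B"
      using cycle_integral_bound[OF op gs'] by blast
    have KW: "K \<subseteq> W" "K \<subseteq> ball 0 R" using K(2) unfolding W'_def by auto
    have "continuous_on K f" using holomorphic_on_imp_continuous_on[OF f] KW(1) continuous_on_subset by blast
    then have "bounded (f ` K)" using K compact_continuous_image compact_imp_bounded by blast
    then obtain M' where "\<forall>y\<in>f ` K. cmod y \<le> M'" unfolding bounded_iff by blast
    then have M': "\<And>z. z \<in> K \<Longrightarrow> cmod (f z) \<le> M'" by blast
    define M where "M = max M' 0"
    have M: "\<And>z. z \<in> K \<Longrightarrow> cmod (f z) \<le> M" "0 \<le> M" using M' unfolding M_def by (auto intro: max.coboundedI1)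
    have "\<forall>\<^sub>F v in at_infinity. cmod v \<ge> R + 1" unfolding eventually_at_infinity by (rule exI[of _ "R + 1"]) simp
    then have ev: "\<forall>\<^sub>F v in at_infinity. cmod (h v) \<le> L * (M / (cmod v - R))"
      using evV
    proof eventually_elim
      case (elim v)
      have "cmod (h2 v) \<le> L * (M / (cmod v - R))" unfolding h2_def
      proof (rule L[rule_format])
        show "(\<lambda>z. f z / (z - v)) holomorphic_on W'"
          using elim(1) unfolding W'_def by (intro holomorphic_intros holomorphic_on_subset[OF f]) auto
        fix z assume z: "z \<in> K"
        then have "cmod z < R" using KW(2) by auto
        then have "cmod v - R \<le> cmod (z - v)" using norm_triangle_ineq2[of v z] by (simp add: norm_minus_commute)
        then show "cmod (f z / (z - v)) \<le> M / (cmod v - R)"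
          unfolding norm_divide using M z elim by (intro frac_le) auto
      qed
      then show ?case using hV[OF elim(2)] by simp
    qed
    have "filterlim (\<lambda>v::complex. cmod v - R) at_top at_infinity"
      using filterlim_tendsto_add_at_top[OF tendsto_const filterlim_norm_at_top, of "- R"] by simp
    then have "((\<lambda>v::complex. M / (cmod v - R)) \<longlongrightarrow> 0) at_infinity"
      by (rule real_tendsto_divide_at_top[OF tendsto_const])
    then have "((\<lambda>v::complex. L * (M / (cmod v - R))) \<longlongrightarrow> 0) at_infinity"
      by (rule tendsto_mult_right_zero)
    then show ?thesis using Lim_null_comparison[OF ev] by simp
  qed
  have "h w = 0" by (rule Liouville_weak_0[OF hol lim])
  moreover have "w \<notin> P" using w(2) by (auto simp: loops_in_def P_def)
  ultimately show ?thesis using eq[OF w(1)] w(1) by (simp add: h_def h2_def mult.commute)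
qed

text \<open>Apply the integral formula to \<open>f z * (z - w)\<close>, which vanishes at
  \<open>w\<close>. A point \<open>w\<close> of \<open>W\<close> off the paths exists because their
  union is compact, while a nonempty open subset of the plane is not.\<close>

theorem Cauchy_theorem_cycle:
  assumes W: "open W" and f: "f holomorphic_on W"
    and gs: "loops_in W gs"
    and zero: "\<And>w. w \<notin> W \<Longrightarrow> (\<Sum>p\<leftarrow>gs. winding_number p w) = 0"
  shows "cycle_integral gs f = 0"
proof (cases "gs = []")
  case False
  define P where "P = (\<Union>p\<in>set gs. path_image p)"
  have cP: "compact P" unfolding P_def using gs by (intro compact_UN) (auto simp: loops_in_def intro: compact_valid_path_image)
  have PW: "P \<subseteq> W" unfolding P_def using gs by (auto simp: loops_in_def)
  have "hd gs \<in> set gs" using False by simp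
  then have "W \<noteq> {}" using gs path_image_nonempty by (metis loops_in_def subset_empty)
  then have "P \<noteq> W" using cP W compact_open by blast
  then obtain w where w: "w \<in> W" "w \<notin> P" using PW by blast
  have "cycle_integral gs (\<lambda>z. (f z * (z - w)) / (z - w)) = 2 * pi * \<i> * (\<Sum>p\<leftarrow>gs. winding_number p w) * (f w * (w - w))"
    by (rule Cauchy_integral_formula_cycle[OF W _ gs zero w(1)])
       (use w f gs in \<open>auto simp: P_def loops_in_def intro!: holomorphic_intros\<close>)
  moreover have "cycle_integral gs (\<lambda>z. (f z * (z - w)) / (z - w)) = cycle_integral gs f"
    by (rule cycle_integral_cong) (use w in \<open>auto simp: P_def\<close>)
  ultimately show ?thesis by simp
qed (simp add: cycle_integral_def)

subsection \<open>Cycles around a compact set\<close>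

lemma loops_in_mono: "loops_in W gs \<Longrightarrow> W \<subseteq> V \<Longrightarrow> loops_in V gs"
  unfolding loops_in_def by (meson subset_trans)

text \<open>Testing with every \<open>h\<close> says that each point occurs equally often as start
  and as end. A path that is not closed can therefore be continued by another one, and joining the
  two shortens the list, as in the construction of Euler circuits. The conclusion is about
  integrals; winding numbers are recovered from them through the kernel
  \<open>1 / (w - z)\<close>.\<close>

lemma loops_of_balanced_paths:
  assumes "\<forall>g\<in>set gs. valid_path g"
    and "\<And>h::complex \<Rightarrow> int. (\<Sum>g\<leftarrow>gs. h (pathfinish g) - h (pathstart g)) = 0"
  shows "\<exists>hs. loops_in (\<Union>g\<in>set gs. path_image g) hs \<and>
    (\<forall>f. (\<forall>g\<in>set gs. f contour_integrable_on g) \<longrightarrow> cycle_integral hs f = cycle_integral gs f)"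
  using assms
proof (induction "length gs" arbitrary: gs rule: less_induct)
  case less
  show ?case
  proof (cases "\<forall>g\<in>set gs. pathfinish g = pathstart g")
    case True
    then have "loops_in (\<Union>g\<in>set gs. path_image g) gs" using less.prems(1) by (auto simp: loops_in_def)
    then show ?thesis by blast
  next
    case False
    then obtain g where g: "g \<in> set gs" "pathfinish g \<noteq> pathstart g" by blast
    \<comment> \<open>The indicator of the endpoint of \<open>g\<close>: if no path other than
      closed ones started there, all summands would be nonnegative and that of \<open>g\<close>
      would be 1.\<close>
    define h :: "complex \<Rightarrow> int" where "h z = (if z = pathfinish g then 1 else 0)" for z
    have "\<exists>g'\<in>set gs. pathstart g' = pathfinish g \<and> pathfinish g' \<noteq> pathstart g'"
    proof (rule ccontr)
      assume "\<not> ?thesis"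
      then have nn: "0 \<le> h (pathfinish g') - h (pathstart g')" if "g' \<in> set gs" for g'
        using that unfolding h_def by (cases "pathstart g' = pathfinish g") auto
      have "0 \<le> (\<Sum>g'\<leftarrow>remove1 g gs. h (pathfinish g') - h (pathstart g'))"
      proof (rule sum_list_nonneg)
        fix x assume "x \<in> set (map (\<lambda>g'. h (pathfinish g') - h (pathstart g')) (remove1 g gs))"
        then obtain g' where "g' \<in> set (remove1 g gs)" "x = h (pathfinish g') - h (pathstart g')" by auto
        then show "0 \<le> x" using nn notin_set_remove1 by metis
      qed
      moreover have "h (pathfinish g) - h (pathstart g) = 1" using g(2) by (auto simp: h_def)
      ultimately show False
        using less.prems(2)[of h] sum_list_map_remove1[OF g(1), of "\<lambda>g. h (pathfinish g) - h (pathstart g)"] by simp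
    qed
    then obtain g' where g': "g' \<in> set gs" "pathstart g' = pathfinish g" by blast
    have "g' \<noteq> g" using g(2) g'(2) by auto
    then have g1: "g \<in> set (remove1 g' gs)" using g(1) by simp
    define rs where "rs = remove1 g (remove1 g' gs)"
    have rs: "set rs \<subseteq> set gs" unfolding rs_def using set_remove1_subset[of g "remove1 g' gs"] set_remove1_subset[of g' gs] by (rule order_trans)
    have sum: "sum_list (map F gs) = F g + F g' + sum_list (map F rs)" for F :: "(real \<Rightarrow> complex) \<Rightarrow> 'b::ab_group_add"
      unfolding rs_def using sum_list_map_remove1[OF g'(1), of F] sum_list_map_remove1[OF g1, of F]
      by (simp add: algebra_simps)
    have v: "valid_path g" "valid_path g'" using less.prems(1) g g' by auto
    let ?gs' = "(g +++ g') # rs"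
    have "length (remove1 g' gs) < length gs" "length rs < length (remove1 g' gs)"
      using g1 g'(1) length_pos_if_in_set[OF g1] length_pos_if_in_set[OF g'(1)]
      unfolding rs_def by (simp_all add: length_remove1)
    then have len: "length ?gs' < length gs" by simp
    have valid: "\<forall>g\<in>set ?gs'. valid_path g" using v rs less.prems(1) g'(2) by (auto intro: valid_path_join)
    have bal: "(\<Sum>g\<leftarrow>?gs'. h (pathfinish g) - h (pathstart g)) = 0" for h :: "complex \<Rightarrow> int"
      using less.prems(2)[of h] sum[of "\<lambda>g. h (pathfinish g) - h (pathstart g)"] g'(2) by simp
    from less.hyps[OF len valid bal] obtain hs where hs: "loops_in (\<Union>g\<in>set ?gs'. path_image g) hs"
      and hs_int: "\<forall>f. (\<forall>g\<in>set ?gs'. f contour_integrable_on g) \<longrightarrow> cycle_integral hs f = cycle_integral ?gs' f"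
      by blast
    have "(\<Union>g\<in>set ?gs'. path_image g) \<subseteq> (\<Union>g\<in>set gs. path_image g)"
      using rs g g' by (auto simp: path_image_join)
    then have "loops_in (\<Union>g\<in>set gs. path_image g) hs"
      by (rule loops_in_mono[OF hs])
    moreover have "cycle_integral hs f = cycle_integral gs f" if f: "\<forall>g\<in>set gs. f contour_integrable_on g" for f
    proof -
      have fi: "f contour_integrable_on g" "f contour_integrable_on g'" using f g g' by auto
      have "f contour_integrable_on (g +++ g')" using contour_integrable_joinI[OF fi v] .
      then have "\<forall>g\<in>set ?gs'. f contour_integrable_on g" using f rs by auto
      then have "cycle_integral hs f = cycle_integral ?gs' f" using hs_int by blast
      also have "\<dots> = cycle_integral gs f"
        unfolding cycle_integral_def using sum[of "\<lambda>g. contour_integral g f"] fi v g'(2)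
        by (simp add: contour_integral_join)
      finally show ?thesis .
    qed
    ultimately show ?thesis by blast
  qed
qed

section \<open>Squares of a grid\<close>

definition gridpt :: "real \<Rightarrow> int \<Rightarrow> int \<Rightarrow> complex" where
  "gridpt d i j = Complex (d * of_int i) (d * of_int j)"

definition gridsq :: "real \<Rightarrow> int \<times> int \<Rightarrow> complex set" where
  "gridsq d = (\<lambda>(i, j). cbox (gridpt d i j) (gridpt d (i + 1) (j + 1)))"

text \<open>Edges are pairs of start and end, oriented counterclockwise around the square whose
  lower left corner is \<open>gridpt d i j\<close>.\<close>

definition bottom_edge where "bottom_edge d = (\<lambda>(i, j). (gridpt d i j, gridpt d (i + 1) j))"
definition right_edge where "right_edge d = (\<lambda>(i, j). (gridpt d (i + 1) j, gridpt d (i + 1) (j + 1)))"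
definition top_edge where "top_edge d = (\<lambda>(i, j). (gridpt d (i + 1) (j + 1), gridpt d i (j + 1)))"
definition left_edge where "left_edge d = (\<lambda>(i, j). (gridpt d i (j + 1), gridpt d i j))"

lemmas edge_defs = bottom_edge_def right_edge_def top_edge_def left_edge_def

text \<open>Edges shared by two squares of \<^term>\<open>D\<close> are traversed in opposite directions and cancel.\<close>

lemma sum_square_boundaries:
  fixes I :: "complex \<times> complex \<Rightarrow> 'b::ab_group_add"
  assumes fin: "finite D"
    and h: "\<And>i j. I (gridpt d (i + 1) j, gridpt d i j) = - I (gridpt d i j, gridpt d (i + 1) j)"
    and v: "\<And>i j. I (gridpt d i (j + 1), gridpt d i j) = - I (gridpt d i j, gridpt d i (j + 1))"
  shows "(\<Sum>p\<in>D. I (bottom_edge d p) + I (right_edge d p) + I (top_edge d p) + I (left_edge d p)) =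
    (\<Sum>p | p \<in> D \<and> (fst p, snd p - 1) \<notin> D. I (bottom_edge d p)) +
    (\<Sum>p | p \<in> D \<and> (fst p + 1, snd p) \<notin> D. I (right_edge d p)) +
    (\<Sum>p | p \<in> D \<and> (fst p, snd p + 1) \<notin> D. I (top_edge d p)) +
    (\<Sum>p | p \<in> D \<and> (fst p - 1, snd p) \<notin> D. I (left_edge d p))"
proof -
  have split: "sum F D = (\<Sum>p | p \<in> D \<and> \<not> Q p. F p) + (\<Sum>p | p \<in> D \<and> Q p. F p)" for F :: "int \<times> int \<Rightarrow> 'b" and Q
  proof -
    have "D = {p. p \<in> D \<and> \<not> Q p} \<union> {p. p \<in> D \<and> Q p}" by auto
    moreover have "sum F ({p. p \<in> D \<and> \<not> Q p} \<union> {p. p \<in> D \<and> Q p}) = (\<Sum>p | p \<in> D \<and> \<not> Q p. F p) + (\<Sum>p | p \<in> D \<and> Q p. F p)"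
      by (rule sum.union_disjoint) (use fin in auto)
    ultimately show ?thesis by simp
  qed
  have tb: "(\<Sum>p | p \<in> D \<and> (fst p, snd p + 1) \<in> D. I (top_edge d p)) =
      - (\<Sum>p | p \<in> D \<and> (fst p, snd p - 1) \<in> D. I (bottom_edge d p))"
    unfolding sum_negf[symmetric]
    by (rule sum.reindex_bij_witness[where i="\<lambda>p. (fst p, snd p - 1)" and j="\<lambda>p. (fst p, snd p + 1)"])
       (auto simp: edge_defs h)
  have rl: "(\<Sum>p | p \<in> D \<and> (fst p - 1, snd p) \<in> D. I (left_edge d p)) =
      - (\<Sum>p | p \<in> D \<and> (fst p + 1, snd p) \<in> D. I (right_edge d p))"
    unfolding sum_negf[symmetric]
    by (rule sum.reindex_bij_witness[where i="\<lambda>p. (fst p + 1, snd p)" and j="\<lambda>p. (fst p - 1, snd p)"])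
       (auto simp: edge_defs v)
  note s = split[of "\<lambda>p. I (bottom_edge d p)" "\<lambda>p. (fst p, snd p - 1) \<in> D"]
    split[of "\<lambda>p. I (right_edge d p)" "\<lambda>p. (fst p + 1, snd p) \<in> D"]
    split[of "\<lambda>p. I (top_edge d p)" "\<lambda>p. (fst p, snd p + 1) \<in> D"]
    split[of "\<lambda>p. I (left_edge d p)" "\<lambda>p. (fst p - 1, snd p) \<in> D"]
  have ring: "(b1 + b2) + (r1 + r2) + (t1 + - b2) + (l1 + - r2) = b1 + r1 + t1 + l1" for b1 b2 r1 r2 t1 l1 :: 'b
    by (simp add: algebra_simps)
  show ?thesis unfolding sum.distrib s tb rl by (rule ring)
qed

lemma gridsq_iff:
  "z \<in> gridsq d (i, j) \<longleftrightarrow> d * of_int i \<le> Re z \<and> Re z \<le> d * (of_int i + 1) \<and> d * of_int j \<le> Im z \<and> Im z \<le> d * (of_int j + 1)"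
  by (auto simp: gridsq_def gridpt_def in_cbox_complex_iff)

lemma floor_mult_bounds:
  fixes d x :: real
  assumes "0 < d"
  shows "d * of_int \<lfloor>x / d\<rfloor> \<le> x" "x < d * (of_int \<lfloor>x / d\<rfloor> + 1)"
  by (metis assms mult.commute of_int_floor_le pos_le_divide_eq)
     (metis assms mult.commute pos_divide_less_eq real_of_int_floor_add_one_gt)

lemma floor_in_gridsq:
  assumes "0 < d"
  shows "z \<in> gridsq d (\<lfloor>Re z / d\<rfloor>, \<lfloor>Im z / d\<rfloor>)"
  unfolding gridsq_iff using floor_mult_bounds[OF assms, of "Re z"] floor_mult_bounds[OF assms, of "Im z"] by auto

lemma gridsq_dist:
  assumes "0 < d" "z \<in> gridsq d p" "w \<in> gridsq d p" shows "dist z w \<le> 2 * d"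
proof -
  obtain i j where p: "p = (i, j)" by fastforce
  have "\<bar>Re z - Re w\<bar> \<le> d" "\<bar>Im z - Im w\<bar> \<le> d"
    using assms(2,3) unfolding p gridsq_iff by (auto simp: algebra_simps)
  then show ?thesis using cmod_le[of "z - w"] by (simp add: dist_norm)
qed

lemma finite_gridsq_meeting:
  assumes "0 < d" "bounded K"
  shows "finite {p. gridsq d p \<inter> K \<noteq> {}}"
proof -
  obtain B where B: "\<forall>z\<in>K. cmod z \<le> B" using assms(2) unfolding bounded_iff by blast
  define N where "N = \<lceil>B / d\<rceil> + 1"
  have bound: "n \<in> {-N - 1..N}" if "d * of_int n \<le> x" "x \<le> d * (of_int n + 1)" "\<bar>x\<bar> \<le> B" for n :: int and x
  proof -
    have b: "B / d \<le> of_int \<lceil>B / d\<rceil>" by simp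
    have "of_int n \<le> B / d" "- (B / d) \<le> of_int n + 1"
      using that assms(1) by (auto simp: field_simps)
    then have "real_of_int n \<le> of_int \<lceil>B / d\<rceil>" "- real_of_int \<lceil>B / d\<rceil> \<le> of_int n + 1" using b by linarith+
    then have "n \<le> \<lceil>B / d\<rceil>" "- \<lceil>B / d\<rceil> \<le> n + 1" by linarith+
    then show ?thesis by (simp add: N_def)
  qed
  have "{p. gridsq d p \<inter> K \<noteq> {}} \<subseteq> {-N - 1..N} \<times> {-N - 1..N}"
  proof (clarsimp simp del: atLeastAtMost_iff simp: mem_Times_iff)
    fix i j assume "gridsq d (i, j) \<inter> K \<noteq> {}"
    then obtain z where z: "z \<in> gridsq d (i, j)" "cmod z \<le> B" using B by blast
    have "\<bar>Re z\<bar> \<le> B" "\<bar>Im z\<bar> \<le> B" using z(2) abs_Re_le_cmod[of z] abs_Im_le_cmod[of z] by linarith+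
    then show "i \<in> {-N - 1..N} \<and> j \<in> {-N - 1..N}"
      using z(1) bound[of i "Re z"] bound[of j "Im z"] unfolding gridsq_iff by blast
  qed
  then show ?thesis by (rule finite_subset) simp
qed

text \<open>An edge that survives the cancellation lies in a square of the chosen family, hence in
  \<open>U\<close>, and in a neighbouring square outside the family, hence off
  \<open>K\<close>.\<close>

lemma edge_subset:
  assumes "0 < d"
  shows "closed_segment (fst (bottom_edge d (i, j))) (snd (bottom_edge d (i, j))) \<subseteq> gridsq d (i, j) \<inter> gridsq d (i, j - 1)"
    and "closed_segment (fst (right_edge d (i, j))) (snd (right_edge d (i, j))) \<subseteq> gridsq d (i, j) \<inter> gridsq d (i + 1, j)"
    and "closed_segment (fst (top_edge d (i, j))) (snd (top_edge d (i, j))) \<subseteq> gridsq d (i, j) \<inter> gridsq d (i, j + 1)"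
    and "closed_segment (fst (left_edge d (i, j))) (snd (left_edge d (i, j))) \<subseteq> gridsq d (i, j) \<inter> gridsq d (i - 1, j)"
proof -
  have *: "closed_segment a b \<subseteq> gridsq d p \<inter> gridsq d r"
    if "a \<in> gridsq d p" "b \<in> gridsq d p" "a \<in> gridsq d r" "b \<in> gridsq d r" for a b p r
  proof -
    have "convex (gridsq d p)" for p by (simp add: gridsq_def split_beta)
    then show ?thesis using that by (intro le_infI closed_segment_subset)
  qed
  show "closed_segment (fst (bottom_edge d (i, j))) (snd (bottom_edge d (i, j))) \<subseteq> gridsq d (i, j) \<inter> gridsq d (i, j - 1)"
    "closed_segment (fst (right_edge d (i, j))) (snd (right_edge d (i, j))) \<subseteq> gridsq d (i, j) \<inter> gridsq d (i + 1, j)"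
    "closed_segment (fst (top_edge d (i, j))) (snd (top_edge d (i, j))) \<subseteq> gridsq d (i, j) \<inter> gridsq d (i, j + 1)"
    "closed_segment (fst (left_edge d (i, j))) (snd (left_edge d (i, j))) \<subseteq> gridsq d (i, j) \<inter> gridsq d (i - 1, j)"
    by (rule *; use assms in \<open>simp add: edge_defs gridsq_iff gridpt_def mult_left_mono\<close>)+
qed

text \<open>The cycle is the boundary of the union of all grid squares meeting \<open>K\<close>. Off
  the grid lines its winding number is computed square by square; a point on a grid line that lies
  outside \<open>U - K\<close> inherits the value from nearby points, winding numbers being locally
  constant.\<close>

lemma surrounding_cycle_exists:
  assumes K: "compact K" and U: "open U" and KU: "K \<subseteq> U"
  shows "\<exists>hs. loops_in (U - K) hs \<and> (\<forall>z\<in>K. (\<Sum>g\<leftarrow>hs. winding_number g z) = 1) \<and>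
    (\<forall>z. z \<notin> U \<longrightarrow> (\<Sum>g\<leftarrow>hs. winding_number g z) = 0)"
proof -
  obtain e where e: "0 < e" "(\<Union>x\<in>K. ball x e) \<subseteq> U"
    using compact_subset_open_imp_ball_epsilon_subset[OF K U KU] by blast
  \<comment> \<open>Points of one square are at most \<open>2 * d < e\<close> apart, so squares
    meeting \<open>K\<close> stay inside \<open>U\<close>.\<close>
  define d where "d = e / 3"
  have d: "0 < d" "2 * d < e" using e by (auto simp: d_def)
  define D where "D = {p. gridsq d p \<inter> K \<noteq> {}}"
  have fin: "finite D" unfolding D_def by (rule finite_gridsq_meeting[OF d(1) compact_imp_bounded[OF K]])
  have DU: "gridsq d p \<subseteq> U" if p: "p \<in> D" for p
  proof
    fix z assume z: "z \<in> gridsq d p"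
    obtain w where w: "w \<in> gridsq d p" "w \<in> K" using p unfolding D_def by blast
    then have "dist w z < e" using gridsq_dist[OF d(1) w(1) z] d(2) by linarith
    then have "z \<in> ball w e" by simp
    then show "z \<in> U" using e(2) w(2) by blast
  qed
  have DK: "gridsq d p \<inter> K = {}" if "p \<notin> D" for p using that unfolding D_def by blast
  define B where "B = {p. p \<in> D \<and> (fst p, snd p - 1) \<notin> D}"
  define R where "R = {p. p \<in> D \<and> (fst p + 1, snd p) \<notin> D}"
  define T where "T = {p. p \<in> D \<and> (fst p, snd p + 1) \<notin> D}"
  define L where "L = {p. p \<in> D \<and> (fst p - 1, snd p) \<notin> D}"
  have "finite B" "finite R" "finite T" "finite L" using fin unfolding B_def R_def T_def L_def by auto
  then obtain bs rs ts ls where lists: "set bs = B" "distinct bs" "set rs = R" "distinct rs"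
      "set ts = T" "distinct ts" "set ls = L" "distinct ls"
    by (metis finite_distinct_list)
  define es where "es = map (bottom_edge d) bs @ map (right_edge d) rs @ map (top_edge d) ts @ map (left_edge d) ls"
  have es_sum: "sum_list (map I es) = sum (I \<circ> bottom_edge d) B + sum (I \<circ> right_edge d) R
      + sum (I \<circ> top_edge d) T + sum (I \<circ> left_edge d) L" for I :: "complex \<times> complex \<Rightarrow> 'b::ab_group_add"
    unfolding es_def using lists by (simp add: sum_list_distinct_conv_sum_set add.assoc)
  have es_sum': "sum_list (map I es) = (\<Sum>p\<in>D. I (bottom_edge d p) + I (right_edge d p) + I (top_edge d p) + I (left_edge d p))"
    if "\<And>i j. I (gridpt d (i + 1) j, gridpt d i j) = - I (gridpt d i j, gridpt d (i + 1) j)"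
      "\<And>i j. I (gridpt d i (j + 1), gridpt d i j) = - I (gridpt d i j, gridpt d i (j + 1))"
    for I :: "complex \<times> complex \<Rightarrow> 'b::ab_group_add"
    unfolding sum_square_boundaries[of D I, OF fin that] es_sum B_def R_def T_def L_def by simp
  define gs where "gs = map (\<lambda>(a, b). linepath a b) es"
  have gs_valid: "\<forall>g\<in>set gs. valid_path g" by (auto simp: gs_def)
  \<comment> \<open>The boundary of a single square is balanced, and cancelling shared edges leaves
    the sum unchanged.\<close>
  have gs_bal: "(\<Sum>g\<leftarrow>gs. h (pathfinish g) - h (pathstart g)) = 0" for h :: "complex \<Rightarrow> int"
  proof -
    have "(\<Sum>g\<leftarrow>gs. h (pathfinish g) - h (pathstart g)) = (\<Sum>e\<leftarrow>es. h (snd e) - h (fst e))"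
      unfolding gs_def map_map by (intro arg_cong[where f=sum_list] map_cong) auto
    also have "\<dots> = 0"
      by (subst es_sum') (auto simp: edge_defs split_beta)
    finally show ?thesis .
  qed
  have edge_in: "closed_segment (fst x) (snd x) \<subseteq> U - K" if x: "x \<in> set es" for x
  proof -
    consider p where "p \<in> B" "x = bottom_edge d p" | p where "p \<in> R" "x = right_edge d p"
      | p where "p \<in> T" "x = top_edge d p" | p where "p \<in> L" "x = left_edge d p"
      using x unfolding es_def set_append set_map lists by blast
    then have "\<exists>p r. p \<in> D \<and> r \<notin> D \<and> closed_segment (fst x) (snd x) \<subseteq> gridsq d p \<inter> gridsq d r"
    proof cases
      case (1 p)
      then show ?thesis using edge_subset(1)[OF d(1), of "fst p" "snd p"]
        unfolding B_def by (intro exI[of _ p] exI[of _ "(fst p, snd p - 1)"]) simp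
    next
      case (2 p)
      then show ?thesis using edge_subset(2)[OF d(1), of "fst p" "snd p"]
        unfolding R_def by (intro exI[of _ p] exI[of _ "(fst p + 1, snd p)"]) simp
    next
      case (3 p)
      then show ?thesis using edge_subset(3)[OF d(1), of "fst p" "snd p"]
        unfolding T_def by (intro exI[of _ p] exI[of _ "(fst p, snd p + 1)"]) simp
    next
      case (4 p)
      then show ?thesis using edge_subset(4)[OF d(1), of "fst p" "snd p"]
        unfolding L_def by (intro exI[of _ p] exI[of _ "(fst p - 1, snd p)"]) simp
    qed
    then show ?thesis using DU DK by blast
  qed
  have gs_images: "(\<Union>g\<in>set gs. path_image g) = (\<Union>x\<in>set es. closed_segment (fst x) (snd x))"
    by (simp add: gs_def split_beta)
  have gs_image: "(\<Union>g\<in>set gs. path_image g) \<subseteq> U - K"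
    unfolding gs_images using edge_in by (rule UN_least)
  obtain hs where hs: "loops_in (\<Union>g\<in>set gs. path_image g) hs"
    and hs_int: "\<forall>f. (\<forall>g\<in>set gs. f contour_integrable_on g) \<longrightarrow> cycle_integral hs f = cycle_integral gs f"
    using loops_of_balanced_paths[OF gs_valid gs_bal] by (elim exE conjE) (rule that)
  have hsUK: "loops_in (U - K) hs" by (rule loops_in_mono[OF hs gs_image])
  have off_grid: "(\<Sum>g\<leftarrow>hs. winding_number g z) = (if (i, j) \<in> D then 1 else 0)"
    if z: "d * of_int i < Re z" "Re z < d * (of_int i + 1)" "d * of_int j < Im z" "Im z < d * (of_int j + 1)" for z i j
  proof -
    have ne: "x \<noteq> d * of_int n" if "d * of_int k < x" "x < d * (of_int k + 1)" for k n :: int and x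
    proof
      assume "x = d * of_int n"
      then have "of_int k < real_of_int n" "real_of_int n < of_int k + 1" using that d(1) by auto
      then have "k < n" "n < k + 1" by linarith+
      then show False by simp
    qed
    have Re: "Re z \<noteq> d * of_int n" and Im: "Im z \<noteq> d * of_int n" for n using ne z by blast+
    have seg: "z \<notin> closed_segment (gridpt d k l) (gridpt d (k + 1) l)" "z \<notin> closed_segment (gridpt d k l) (gridpt d k (l + 1))" for k l
    proof -
      have "Im w = d * of_int l" if w: "w \<in> closed_segment (gridpt d k l) (gridpt d (k + 1) l)" for w
      proof -
        obtain u where "w = (1 - u) *\<^sub>R gridpt d k l + u *\<^sub>R gridpt d (k + 1) l"
          using w by (auto simp: in_segment)
        then have "Im w = (1 - u) * (d * of_int l) + u * (d * of_int l)" by (simp add: gridpt_def)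
        then show ?thesis by (simp add: algebra_simps)
      qed
      then show "z \<notin> closed_segment (gridpt d k l) (gridpt d (k + 1) l)" using Im by blast
      have "Re w = d * of_int k" if w: "w \<in> closed_segment (gridpt d k l) (gridpt d k (l + 1))" for w
      proof -
        obtain u where "w = (1 - u) *\<^sub>R gridpt d k l + u *\<^sub>R gridpt d k (l + 1)"
          using w by (auto simp: in_segment)
        then have "Re w = (1 - u) * (d * of_int k) + u * (d * of_int k)" by (simp add: gridpt_def)
        then show ?thesis by (simp add: algebra_simps)
      qed
      then show "z \<notin> closed_segment (gridpt d k l) (gridpt d k (l + 1))" using Re by blast
    qed
    let ?f = "\<lambda>w. 1 / (w - z)"
    have cont: "continuous_on S ?f" if "z \<notin> S" for S
      using that by (intro continuous_intros) auto
    have int: "?f contour_integrable_on (linepath a b)" if "z \<notin> closed_segment a b" for a b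
      using cont[OF that] by (rule contour_integrable_continuous_linepath)
    have rev: "contour_integral (linepath b a) ?f = - contour_integral (linepath a b) ?f" if "z \<notin> closed_segment a b" for a b
      using contour_integral_reverse_linepath[OF cont, of b a] that by (simp add: closed_segment_commute)
    define I where "I x = contour_integral (linepath (fst x) (snd x)) ?f" for x
    have "cycle_integral gs ?f = sum_list (map I es)"
      unfolding cycle_integral_def gs_def map_map by (intro arg_cong[where f=sum_list] map_cong) (auto simp: I_def)
    also have "\<dots> = (\<Sum>p\<in>D. I (bottom_edge d p) + I (right_edge d p) + I (top_edge d p) + I (left_edge d p))"
      by (rule es_sum') (simp_all add: I_def rev seg)
    also have "\<dots> = (\<Sum>p\<in>D. if p = (i, j) then 2 * pi * \<i> else 0)"
    proof (rule sum.cong[OF refl])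
      fix p assume "p \<in> D"
      obtain k l where p: "p = (k, l)" by fastforce
      let ?a = "gridpt d k l" and ?b = "gridpt d (k + 1) l" and ?c = "gridpt d (k + 1) (l + 1)" and ?d = "gridpt d k (l + 1)"
      have rp: "rectpath ?a ?c = linepath ?a ?b +++ linepath ?b ?c +++ linepath ?c ?d +++ linepath ?d ?a"
        by (simp add: rectpath_def Let_def gridpt_def)
      have ints: "?f contour_integrable_on linepath ?a ?b" "?f contour_integrable_on linepath ?b ?c"
        "?f contour_integrable_on linepath ?c ?d" "?f contour_integrable_on linepath ?d ?a"
        using seg(1)[of k l] seg(2)[of "k + 1" l] seg(1)[of k "l + 1"] seg(2)[of k l]
        by (auto intro!: int simp: closed_segment_commute)
      have le: "Re ?a \<le> Re ?c" "Im ?a \<le> Im ?c" using d(1) by (auto simp: gridpt_def)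
      have "z \<notin> path_image (rectpath ?a ?c)"
        unfolding path_image_rectpath[OF le]
        using Re[of k] Re[of "k + 1"] Im[of l] Im[of "l + 1"] by (auto simp: gridpt_def)
      then have "2 * pi * \<i> * winding_number (rectpath ?a ?c) z = contour_integral (rectpath ?a ?c) ?f"
        using winding_number_valid_path[of "rectpath ?a ?c" z] by simp
      also have "\<dots> = I (bottom_edge d p) + I (right_edge d p) + I (top_edge d p) + I (left_edge d p)"
        unfolding rp using ints by (simp add: contour_integral_join contour_integrable_joinI valid_path_join I_def edge_defs p add.assoc)
      finally have eq: "I (bottom_edge d p) + I (right_edge d p) + I (top_edge d p) + I (left_edge d p)
        = 2 * pi * \<i> * winding_number (rectpath ?a ?c) z" by simp
      have "winding_number (rectpath ?a ?c) z = (if p = (i, j) then 1 else 0)"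
      proof (cases "p = (i, j)")
        case True
        then have "z \<in> box ?a ?c" using z p by (auto simp: in_box_complex_iff gridpt_def)
        then show ?thesis using winding_number_rectpath True by simp
      next
        case False
        have uniq: "m = n" if "d * of_int m < x" "x < d * (of_int m + 1)" "d * of_int n \<le> x" "x \<le> d * (of_int n + 1)" for m n :: int and x
        proof -
          have "d * of_int m < d * (of_int n + 1)" "d * of_int n < d * (of_int m + 1)" using that by linarith+
          then have "real_of_int m < of_int n + 1" "real_of_int n < of_int m + 1" using d(1) by auto
          then have "m < n + 1" "n < m + 1" by linarith+
          then show ?thesis by simp
        qed
        have "z \<notin> gridsq d p" using False uniq z unfolding p gridsq_iff by blast
        then have "z \<notin> cbox ?a ?c" by (simp add: gridsq_def p)
        then show ?thesis using winding_number_rectpath_outside[OF le] False by simp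
      qed
      then show "I (bottom_edge d p) + I (right_edge d p) + I (top_edge d p) + I (left_edge d p)
        = (if p = (i, j) then 2 * pi * \<i> else 0)" using eq by simp
    qed
    also have "\<dots> = (if (i, j) \<in> D then 2 * pi * \<i> else 0)" using fin by simp
    finally have gsf: "cycle_integral gs ?f = (if (i, j) \<in> D then 2 * pi * \<i> else 0)" .
    have seg_es: "z \<notin> closed_segment (fst x) (snd x)" if "x \<in> set es" for x
    proof -
      have "z \<notin> closed_segment (gridpt d (k + 1) l) (gridpt d k l)" "z \<notin> closed_segment (gridpt d k (l + 1)) (gridpt d k l)" for k l
        using seg[of k l] by (simp_all add: closed_segment_commute)
      then show ?thesis using that seg unfolding es_def by (auto simp: edge_defs)
    qed
    have "\<forall>g\<in>set gs. ?f contour_integrable_on g"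
      unfolding gs_def using int[OF seg_es] by (simp add: split_beta)
    then have "cycle_integral hs ?f = cycle_integral gs ?f" using hs_int by blast
    moreover have "paths_in (- {z}) hs"
    proof -
      have "z \<notin> (\<Union>g\<in>set gs. path_image g)" unfolding gs_images using seg_es by blast
      then show ?thesis using loops_in_imp_paths_in[OF loops_in_mono[OF hs, of "- {z}"]] by blast
    qed
    then have "cycle_integral hs ?f = 2 * pi * \<i> * (\<Sum>g\<leftarrow>hs. winding_number g z)" by (rule cycle_winding_number)
    ultimately show ?thesis using gsf by (auto split: if_splits)
  qed
  have wind: "(\<Sum>g\<leftarrow>hs. winding_number g z) = (if (\<lfloor>Re z / d\<rfloor>, \<lfloor>Im z / d\<rfloor>) \<in> D then 1 else 0)"
    if z: "z \<notin> U - K" for z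
  proof -
    define i where "i = \<lfloor>Re z / d\<rfloor>"
    define j where "j = \<lfloor>Im z / d\<rfloor>"
    note fl = floor_mult_bounds[OF d(1)]
    have "loops_in (- {z}) hs" by (rule loops_in_mono[OF hsUK]) (use z in auto)
    from cycle_winding_locally_constant[OF this] obtain r where r: "0 < r"
      "\<forall>w\<in>ball z r. (\<Sum>g\<leftarrow>hs. winding_number g w) = (\<Sum>g\<leftarrow>hs. winding_number g z) \<and> (\<forall>g\<in>set hs. w \<notin> path_image g)"
      by blast
    \<comment> \<open>A small diagonal shift of \<open>z\<close> stays in its half-open square and
      leaves the grid lines. Halving the distance to the right and upper edges keeps the shifted
      point strictly inside.\<close>
    define a where "a = (d * (of_int i + 1) - Re z) / 2"
    define b where "b = (d * (of_int j + 1) - Im z) / 2"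
    have "0 < a" "0 < b" using fl[of "Re z"] fl[of "Im z"] by (auto simp: i_def j_def a_def b_def)
    then obtain t where t: "0 < t" "t \<le> r / 3" "t \<le> a" "t \<le> b"
      using r(1) by (intro that[of "min (r / 3) (min a b)"]) auto
    define w where "w = z + Complex t t"
    have "dist z w = cmod (Complex t t)" by (simp add: w_def dist_norm norm_minus_commute)
    also have "\<dots> \<le> 2 * t" using cmod_le[of "Complex t t"] t(1) by simp
    also have "\<dots> < r" using t r(1) by linarith
    finally have "w \<in> ball z r" by simp
    then have "(\<Sum>g\<leftarrow>hs. winding_number g z) = (\<Sum>g\<leftarrow>hs. winding_number g w)" using r(2) by metis
    also have "\<dots> = (if (i, j) \<in> D then 1 else 0)"
    proof (rule off_grid)
      show "d * of_int i < Re w" "d * of_int j < Im w"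
        using fl[of "Re z"] fl[of "Im z"] t(1) unfolding i_def j_def w_def by auto
      have "2 * t \<le> d * (of_int i + 1) - Re z" "2 * t \<le> d * (of_int j + 1) - Im z" using t unfolding a_def b_def by auto
      then show "Re w < d * (of_int i + 1)" "Im w < d * (of_int j + 1)"
        using t(1) unfolding w_def by auto
    qed
    finally show ?thesis by (simp add: i_def j_def)
  qed
  have "(\<Sum>g\<leftarrow>hs. winding_number g z) = 1" if "z \<in> K" for z
    using wind[of z] that floor_in_gridsq[OF d(1), of z] by (auto simp: D_def)
  moreover have "(\<Sum>g\<leftarrow>hs. winding_number g z) = 0" if "z \<notin> U" for z
    using wind[of z] that floor_in_gridsq[OF d(1), of z] DU by auto
  ultimately show ?thesis using hsUK by blast
qed

subsection \<open>The Riesz integral\<close>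

text \<open>Holomorphy of vector-valued functions is used in its weak form, tested by functionals.\<close>

definition whol_on :: "(complex \<Rightarrow> 'a::cbanach_algebra) \<Rightarrow> complex set \<Rightarrow> bool" where
  "whol_on h W \<longleftrightarrow> continuous_on W h \<and> (\<forall>\<phi>. cfunctional \<phi> \<longrightarrow> (\<lambda>w. \<phi> (h w)) holomorphic_on W)"

lemma whol_on_subset: "whol_on h W \<Longrightarrow> V \<subseteq> W \<Longrightarrow> whol_on h V"
  unfolding whol_on_def by (meson continuous_on_subset holomorphic_on_subset)

lemma whol_on_resolvent: "whol_on (resolvent T) (- bspec T)"
  unfolding whol_on_def using continuous_on_resolvent holomorphic_cfunctional_resolvent by blast

lemma whol_on_cscale:
  assumes f: "f holomorphic_on W" and h: "whol_on h W"
  shows "whol_on (\<lambda>w. cscale (f w) (h w)) W"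
  unfolding whol_on_def
proof (intro conjI allI impI)
  show "continuous_on W (\<lambda>w. cscale (f w) (h w))"
    using h holomorphic_on_imp_continuous_on[OF f] unfolding whol_on_def
    by (intro cscale.continuous_on) auto
  fix \<phi> :: "'a \<Rightarrow> complex" assume \<phi>: "cfunctional \<phi>"
  have "(\<lambda>w. \<phi> (h w)) holomorphic_on W" using h \<phi> by (simp add: whol_on_def)
  then have "(\<lambda>w. f w * \<phi> (h w)) holomorphic_on W" by (intro holomorphic_intros f)
  then show "(\<lambda>w. \<phi> (cscale (f w) (h w))) holomorphic_on W" by (simp add: cfunctionalD(2)[OF \<phi>])
qed

text \<open>Integrate along segments from the centre. Path independence on triangles is an identity
  of vectors and so follows from the scalar Cauchy theorem by testing; differentiability is then a
  norm estimate from the continuity of \<open>h\<close>.\<close>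

lemma whol_on_local_primitive:
  fixes h :: "complex \<Rightarrow> 'a::cbanach_algebra"
  assumes h: "whol_on h (ball a r)"
  shows "\<exists>P. \<forall>w\<in>ball a r. (P has_derivative (\<lambda>v. cscale v (h w))) (at w)"
proof -
  define seg where "seg b w = integral {0..1} (\<lambda>s. h (linepath b w s))" for b w
  define P where "P w = cscale (w - a) (seg a w)" for w
  have hc: "continuous_on (ball a r) h" using h by (simp add: whol_on_def)
  have int: "(\<lambda>s. h (linepath b w s)) integrable_on {0..1}" if "b \<in> ball a r" "w \<in> ball a r" for b w
  proof (rule integrable_continuous_real, rule continuous_on_compose2[OF hc])
    show "linepath b w ` {0..1} \<subseteq> ball a r"
      using that closed_segment_subset[OF _ _ convex_ball] linepath_in_path by blast
  qed (intro continuous_intros)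
  have \<phi>seg: "\<phi> (cscale (w - b) (seg b w)) = contour_integral (linepath b w) (\<lambda>z. \<phi> (h z))"
    if \<phi>: "cfunctional \<phi>" and "b \<in> ball a r" "w \<in> ball a r" for \<phi> b w
  proof -
    have "\<phi> (seg b w) = integral {0..1} (\<lambda>s. \<phi> (h (linepath b w s)))"
      unfolding seg_def using integral_linear[OF int[OF that(2,3)] cfunctionalD(1)[OF \<phi>]] by (simp add: o_def)
    then show ?thesis
      by (simp add: cfunctionalD(2)[OF \<phi>] contour_integral_integral mult.commute)
  qed
  have diff: "P w - P b = cscale (w - b) (seg b w)" if b: "b \<in> ball a r" and w: "w \<in> ball a r" for b w
  proof (rule cfunctional_eqI)
    fix \<phi> :: "'a \<Rightarrow> complex" assume \<phi>: "cfunctional \<phi>"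
    interpret phi: bounded_linear \<phi> using \<phi> cfunctionalD by blast
    have a: "a \<in> ball a r" using b by (metis centre_in_ball dist_self mem_ball not_less order.strict_trans2 zero_le_dist)
    have hol: "(\<lambda>z. \<phi> (h z)) holomorphic_on ball a r" using h \<phi> by (simp add: whol_on_def)
    have sub: "convex hull {a, b, w} \<subseteq> ball a r" using a b w by (intro hull_minimal) auto
    then have "((\<lambda>z. \<phi> (h z)) has_contour_integral 0) (linepath a b +++ linepath b w +++ linepath w a)"
      by (intro Cauchy_theorem_triangle holomorphic_on_subset[OF hol])
    moreover have c: "continuous_on (closed_segment x y) (\<lambda>z. \<phi> (h z))" if "x \<in> ball a r" "y \<in> ball a r" for x y
      using holomorphic_on_imp_continuous_on[OF hol] continuous_on_subset closed_segment_subset[OF that convex_ball] by blast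
    ultimately have "contour_integral (linepath a b) (\<lambda>z. \<phi> (h z)) + contour_integral (linepath b w) (\<lambda>z. \<phi> (h z))
        + contour_integral (linepath w a) (\<lambda>z. \<phi> (h z)) = 0"
      using has_chain_integral_chain_integral3 by blast
    moreover have "contour_integral (linepath w a) (\<lambda>z. \<phi> (h z)) = - contour_integral (linepath a w) (\<lambda>z. \<phi> (h z))"
      by (rule contour_integral_reverse_linepath[OF c[OF w a]])
    ultimately show "\<phi> (P w - P b) = \<phi> (cscale (w - b) (seg b w))"
      unfolding phi.diff P_def \<phi>seg[OF \<phi> a w] \<phi>seg[OF \<phi> a b] \<phi>seg[OF \<phi> b w] by (simp add: algebra_simps)
  qed
  have "(P has_derivative (\<lambda>v. cscale v (h b))) (at b)" if b: "b \<in> ball a r" for b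
    unfolding has_derivative_at_alt
  proof (intro conjI allI impI)
    show "bounded_linear (\<lambda>v. cscale v (h b))" by (rule cscale.bounded_linear_left)
    fix e :: real assume e: "0 < e"
    have "isCont h b" using hc b continuous_on_eq_continuous_at[OF open_ball] by blast
    then obtain d1 where d1: "0 < d1" "\<forall>z. dist z b < d1 \<longrightarrow> dist (h z) (h b) < e"
      using e unfolding continuous_at_eps_delta by blast
    obtain d2 where d2: "0 < d2" "ball b d2 \<subseteq> ball a r" using openE[OF open_ball b] by blast
    show "\<exists>d>0. \<forall>w. cmod (w - b) < d \<longrightarrow> norm (P w - P b - cscale (w - b) (h b)) \<le> e * cmod (w - b)"
    proof (intro exI[of _ "min d1 d2"] conjI allI impI)
      show "0 < min d1 d2" using d1 d2 by simp
      fix w assume w: "cmod (w - b) < min d1 d2"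
      have wB: "w \<in> ball a r" using d2(2) w by (auto simp: dist_norm norm_minus_commute subset_iff)
      have "seg b w - h b = integral {0..1} (\<lambda>s. h (linepath b w s) - h b)"
        unfolding seg_def using int[OF b wB] by (subst integral_diff) auto
      also have "norm \<dots> \<le> e * (1 - 0)"
      proof (rule integral_bound)
        show "continuous_on {0..1} (\<lambda>s. h (linepath b w s) - h b)"
        proof (intro continuous_intros continuous_on_compose2[OF hc])
          show "linepath b w ` {0..1} \<subseteq> ball a r"
            using closed_segment_subset[OF b wB convex_ball] linepath_in_path by blast
        qed
        fix s :: real assume s: "s \<in> {0..1}"
        have "linepath b w s - b = s *\<^sub>R (w - b)" by (simp add: linepath_def algebra_simps)
        then have "dist (linepath b w s) b = s * cmod (w - b)" using s by (simp add: dist_norm)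
        also have "\<dots> \<le> 1 * cmod (w - b)" using s by (intro mult_right_mono) auto
        finally have "dist (linepath b w s) b < d1" using w by simp
        then show "norm (h (linepath b w s) - h b) \<le> e" using d1(2) by (simp add: dist_norm less_imp_le)
      qed simp
      finally have sb: "norm (seg b w - h b) \<le> e" by simp
      have "P w - P b - cscale (w - b) (h b) = cscale (w - b) (seg b w - h b)"
        using diff[OF b wB] by (simp add: cscale_diff_right)
      then have "norm (P w - P b - cscale (w - b) (h b)) = cmod (w - b) * norm (seg b w - h b)"
        by (simp add: norm_cscale)
      also have "\<dots> \<le> cmod (w - b) * e" using sb by (intro mult_left_mono) auto
      finally show "norm (P w - P b - cscale (w - b) (h b)) \<le> e * cmod (w - b)" by (simp add: mult.commute)
    qed
  qed
  then show ?thesis by blast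
qed

text \<open>Locally, outside finitely many parameters, the integrand is the derivative of
  \<open>P \<circ> g\<close> for a primitive \<open>P\<close>, so the fundamental theorem gives
  integrability on short intervals. Without integrability \<open>integral\<close> would be a default
  value that cannot be exchanged with functionals.\<close>

lemma whol_on_path_integrable:
  fixes h :: "complex \<Rightarrow> 'a::cbanach_algebra"
  assumes W: "open W" and h: "whol_on h W" and g: "valid_path g" "path_image g \<subseteq> W"
  shows "(\<lambda>t. cscale (vector_derivative g (at t)) (h (g t))) integrable_on {0..1}"
proof -
  obtain S where S: "finite S" and gd: "\<forall>x\<in>{0..1} - S. g differentiable at x" and gc: "continuous_on {0..1} g"
    using g(1) unfolding valid_path_def piecewise_C1_differentiable_on_def C1_differentiable_on_eq by blast
  have "(\<lambda>t. cscale (vector_derivative g (at t)) (h (g t))) integrable_on cbox 0 (1::real)"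
  proof (rule integrable_on_little_subintervals, intro ballI)
    fix x :: real assume "x \<in> cbox 0 1"
    then have x: "x \<in> {0..1}" by simp
    then have "g x \<in> W" using g(2) by (auto simp: path_image_def)
    then obtain r where r: "0 < r" "ball (g x) r \<subseteq> W" using W open_contains_ball by blast
    from whol_on_local_primitive[OF whol_on_subset[OF h r(2)]]
    obtain P where P: "\<forall>w\<in>ball (g x) r. (P has_derivative (\<lambda>v. cscale v (h w))) (at w)"
      by blast
    from gc[unfolded continuous_on_iff, rule_format, OF x r(1)]
    obtain d where d: "0 < d" "\<forall>y\<in>{0..1}. dist y x < d \<longrightarrow> dist (g y) (g x) < r"
      by blast
    have "(\<lambda>t. cscale (vector_derivative g (at t)) (h (g t))) integrable_on cbox u v"
      if uv: "x \<in> cbox u v" "cbox u v \<subseteq> ball x d" "cbox u v \<subseteq> cbox 0 1" for u v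
    proof -
      have ball: "g t \<in> ball (g x) r" if "t \<in> {u..v}" for t
      proof -
        have "t \<in> {0..1}" "dist t x < d" using that uv(2,3) by (auto simp: dist_commute subset_iff)
        then show ?thesis using d(2) by (simp add: dist_commute)
      qed
      have "((\<lambda>t. cscale (vector_derivative g (at t)) (h (g t))) has_integral (P \<circ> g) v - (P \<circ> g) u) {u..v}"
      proof (rule fundamental_theorem_of_calculus_interior_strong[OF S])
        show "u \<le> v" using uv(1) by simp
        show "continuous_on {u..v} (P \<circ> g)"
        proof (rule continuous_on_compose)
          show "continuous_on {u..v} g" using gc uv(3) by (intro continuous_on_subset[OF gc]) auto
          show "continuous_on (g ` {u..v}) P"
          proof (intro continuous_at_imp_continuous_on ballI)
            fix w assume "w \<in> g ` {u..v}"
            then have "w \<in> ball (g x) r" using ball by blast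
            then show "isCont P w" using P has_derivative_continuous by blast
          qed
        qed
        fix t assume t: "t \<in> {u<..<v} - S"
        then have "t \<in> {0..1} - S" using uv(3) by (auto simp: subset_iff)
        then have "(g has_vector_derivative vector_derivative g (at t)) (at t)"
          using gd vector_derivative_works by blast
        then have "(g has_derivative (\<lambda>s. s *\<^sub>R vector_derivative g (at t))) (at t)"
          by (simp add: has_vector_derivative_def)
        then have "((P \<circ> g) has_derivative (\<lambda>v. cscale v (h (g t))) \<circ> (\<lambda>s. s *\<^sub>R vector_derivative g (at t))) (at t)"
          by (rule diff_chain_at) (use P ball t in auto)
        then show "((P \<circ> g) has_vector_derivative cscale (vector_derivative g (at t)) (h (g t))) (at t)"
          by (simp add: has_vector_derivative_def o_def cscale_scaleR)
      qed
      then show ?thesis by (auto simp: integrable_on_def)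
    qed
    then show "\<exists>d>0. \<forall>u v. x \<in> cbox u v \<and> cbox u v \<subseteq> ball x d \<and> cbox u v \<subseteq> cbox 0 1 \<longrightarrow>
        (\<lambda>t. cscale (vector_derivative g (at t)) (h (g t))) integrable_on cbox u v"
      using d(1) by blast
  qed
  then show ?thesis by simp
qed

lemma cfunctional_sum_list:
  assumes "cfunctional \<phi>" shows "\<phi> (\<Sum>x\<leftarrow>xs. F x) = (\<Sum>x\<leftarrow>xs. \<phi> (F x))"
proof -
  interpret bounded_linear \<phi> using assms cfunctionalD by blast
  show ?thesis by (induction xs) (auto simp: add zero)
qed

lemma cfunctional_cycle:
  assumes W: "open W" and h: "whol_on h W" and gs: "paths_in W gs" and \<phi>: "cfunctional \<phi>"
  shows "\<phi> (\<Sum>g\<leftarrow>gs. integral {0..1} (\<lambda>t. cscale (vector_derivative g (at t)) (h (g t))))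
    = cycle_integral gs (\<lambda>w. \<phi> (h w))"
  unfolding cycle_integral_def cfunctional_sum_list[OF \<phi>]
proof (intro arg_cong[where f=sum_list] map_cong refl)
  fix g assume "g \<in> set gs"
  then have "(\<lambda>t. cscale (vector_derivative g (at t)) (h (g t))) integrable_on {0..1}"
    using gs by (intro whol_on_path_integrable[OF W h]) (auto simp: paths_in_def)
  from integral_linear[OF this cfunctionalD(1)[OF \<phi>]]
  show "\<phi> (integral {0..1} (\<lambda>t. cscale (vector_derivative g (at t)) (h (g t)))) = contour_integral g (\<lambda>w. \<phi> (h w))"
    by (simp add: o_def cfunctionalD(2)[OF \<phi>] contour_integral_integral mult.commute)
qed

lemma admissible_cycleD:
  assumes "admissible_cycle U T gs"
  shows "loops_in (U - bspec T) gs" "\<And>z. z \<in> bspec T \<Longrightarrow> (\<Sum>g\<leftarrow>gs. winding_number g z) = 1"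
    "\<And>z. z \<notin> U \<Longrightarrow> (\<Sum>g\<leftarrow>gs. winding_number g z) = 0"
  using assms by (auto simp: admissible_cycle_def loops_in_def)

text \<open>The scalar form through which the Riesz integral is handled from here on.\<close>

lemma cfunctional_riesz_integral:
  assumes U: "open U" and f: "f holomorphic_on U" and gs: "loops_in (U - bspec T) gs" and \<phi>: "cfunctional \<phi>"
  shows "\<phi> (riesz_integral f T gs) = cycle_integral gs (\<lambda>w. f w * \<phi> (resolvent T w)) / (2 * pi * \<i>)"
proof -
  have W: "open (U - bspec T)" using U closed_bspec by blast
  have "whol_on (\<lambda>w. cscale (f w) (resolvent T w)) (U - bspec T)"
    by (intro whol_on_cscale holomorphic_on_subset[OF f] whol_on_subset[OF whol_on_resolvent]) auto
  from cfunctional_cycle[OF W this loops_in_imp_paths_in[OF gs] \<phi>]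
  show ?thesis
    unfolding riesz_integral_def by (simp add: cfunctionalD(2)[OF \<phi>] resolvent_def)
qed

subsection \<open>The holomorphic functional calculus\<close>

lemma cycle_integral_append: "cycle_integral (gs @ hs) f = cycle_integral gs f + cycle_integral hs f"
  by (simp add: cycle_integral_def)

text \<open>Cauchy's theorem on the complement of the spectrum replaces the cycle by any large
  circle. There \<open>R(w) = 1/w + R(w) T / w\<close>, and the second term contributes at most a
  multiple of \<open>1 / (r - norm T)\<close>. The value does not depend on \<open>r\<close>, so it
  is exactly the contribution of \<open>1/w\<close>.\<close>

lemma riesz_integral_one:
  fixes T :: "'a::cbanach_algebra"
  assumes U: "open U" and adm: "admissible_cycle U T gs"
  shows "riesz_integral (\<lambda>_. 1) T gs = 1"
proof (rule cfunctional_eqI)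
  fix \<phi> :: "'a \<Rightarrow> complex" assume \<phi>: "cfunctional \<phi>"
  interpret phi: bounded_linear \<phi> using \<phi> cfunctionalD by blast
  note gs = admissible_cycleD[OF adm]
  have W: "open (- bspec T)" using closed_bspec by blast
  define h where "h w = \<phi> (resolvent T w)" for w
  have h: "h holomorphic_on (- bspec T)" unfolding h_def by (rule holomorphic_cfunctional_resolvent[OF \<phi>])
  define A where "A = cycle_integral gs h"
  obtain C where C: "0 < C" "\<And>x. cmod (\<phi> x) \<le> norm x * C" using phi.pos_bounded by blast
  define C' where "C' = 2 * pi * (norm T * C)"
  have C': "0 \<le> C'" using C by (simp add: C'_def)
  have circ: "A = contour_integral (circlepath 0 r) h" if r: "norm T < r" for r
  proof -
    have r0: "0 < r" using r norm_ge_zero[of T] by linarith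
    have out: "w \<notin> bspec T" if "r \<le> cmod w" for w using resolvent_large(1)[of T w] r that by linarith
    \<comment> \<open>The reversed circle makes the total winding number zero at every point of the
      spectrum.\<close>
    have lo: "loops_in (- bspec T) (gs @ [reversepath (circlepath 0 r)])"
      using loops_in_mono[OF gs(1), of "- bspec T"] out r0 by (auto simp: loops_in_def path_image_circlepath)
    have "cycle_integral (gs @ [reversepath (circlepath 0 r)]) h = 0"
    proof (rule Cauchy_theorem_cycle[OF W h lo])
      fix w assume "w \<notin> - bspec T"
      then have w: "w \<in> bspec T" by simp
      then have "cmod w < r" using out[of w] by linarith
      then have "winding_number (circlepath 0 r) w = 1" "w \<notin> path_image (circlepath 0 r)"
        using winding_number_circlepath[of w 0 r] r0 by (auto simp: path_image_circlepath)
      then show "(\<Sum>\<gamma>\<leftarrow>gs @ [reversepath (circlepath 0 r)]. winding_number \<gamma> w) = 0"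
        using gs(2)[OF w] by (simp add: winding_number_reversepath)
    qed
    then show ?thesis
      by (simp add: A_def cycle_integral_append) (simp add: cycle_integral_def contour_integral_reversepath)
  qed
  have bound: "cmod (A - 2 * pi * \<i> * \<phi> 1) \<le> C' / (r - norm T)" if r: "norm T < r" for r
  proof -
    have r0: "0 < r" using r norm_ge_zero[of T] by linarith
    have out: "w \<notin> bspec T" if "r \<le> cmod w" for w using resolvent_large(1)[of T w] r that by linarith
    have sub: "path_image (circlepath 0 r) \<subseteq> - bspec T"
      using out r0 by (auto simp: path_image_circlepath)
    have "(h has_contour_integral A) (circlepath 0 r)"
      unfolding circ[OF r] using contour_integrable_holomorphic_simple[OF h W _ sub] has_contour_integral_integral by simp
    moreover have "((\<lambda>w. \<phi> 1 / (w - 0)) has_contour_integral 2 * pi * \<i> * \<phi> 1) (circlepath 0 r)"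
      using Cauchy_integral_circlepath_simple[of "\<lambda>_. \<phi> 1" 0 r 0] r0 by simp
    ultimately have "((\<lambda>w. h w - \<phi> 1 / (w - 0)) has_contour_integral (A - 2 * pi * \<i> * \<phi> 1)) (circlepath 0 r)"
      by (rule has_contour_integral_diff)
    then have "cmod (A - 2 * pi * \<i> * \<phi> 1) \<le> (norm T / (r * (r - norm T)) * C) * (2 * pi * r)"
    proof (rule has_contour_integral_bound_circlepath)
      show "0 \<le> norm T / (r * (r - norm T)) * C" using r r0 C by simp
      fix w :: complex assume "cmod (w - 0) = r"
      then have w: "cmod w = r" "w \<noteq> 0" using r0 by auto
      have wb: "w \<notin> bspec T" using out w by simp
      have "h w - \<phi> 1 / (w - 0) = \<phi> (cscale (inverse w) (resolvent T w * T))"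
        unfolding resolvent_mult_T(1)[OF wb] h_def cfunctionalD(2)[OF \<phi>] phi.diff using w by (simp add: field_simps)
      also have "cmod \<dots> \<le> norm (cscale (inverse w) (resolvent T w * T)) * C" by (rule C)
      also have "norm (cscale (inverse w) (resolvent T w * T)) \<le> inverse r * (norm (resolvent T w) * norm T)"
        unfolding norm_cscale norm_inverse w by (intro mult_left_mono norm_mult_ineq) (use r0 in simp)
      also have "\<dots> \<le> inverse r * (1 / (r - norm T) * norm T)"
        using resolvent_large(2)[of T w] w r r0 by (intro mult_left_mono mult_right_mono) auto
      also have "\<dots> = norm T / (r * (r - norm T))" using r r0 by (simp add: field_simps)
      finally show "cmod (h w - \<phi> 1 / (w - 0)) \<le> norm T / (r * (r - norm T)) * C" using C by simp
    qed (use r0 in auto)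
    also have "\<dots> = C' / (r - norm T)" using r r0 by (simp add: C'_def field_simps)
    finally show ?thesis .
  qed
  have "A = 2 * pi * \<i> * \<phi> 1"
  proof (rule ccontr)
    assume "\<not> ?thesis"
    then have d: "0 < cmod (A - 2 * pi * \<i> * \<phi> 1)" (is "0 < ?d") by simp
    \<comment> \<open>The radius \<open>norm T + 1 + C' / ?d\<close> is chosen so that the bound
      falls below \<open>?d\<close> itself.\<close>
    have "?d \<le> C' / (norm T + 1 + C' / ?d - norm T)"
      by (rule bound) (use C' d in \<open>simp add: add_pos_nonneg\<close>)
    also have "\<dots> = C' / (1 + C' / ?d)" by simp
    also have "\<dots> < ?d"
    proof -
      have "0 < 1 + C' / ?d" using C' d by (simp add: add_pos_nonneg)
      moreover have "?d * (1 + C' / ?d) = ?d + C'" using d by (simp add: distrib_left)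
      ultimately show ?thesis using d by (simp add: pos_divide_less_eq)
    qed
    finally show False by simp
  qed
  then show "\<phi> (riesz_integral (\<lambda>_. 1) T gs) = \<phi> 1"
    using cfunctional_riesz_integral[OF U _ gs(1) \<phi>, of "\<lambda>_. 1"] by (simp add: A_def h_def[abs_def])
qed

section \<open>Module maps over the holomorphic functions\<close>

text \<open>The common features of \<open>f \<mapsto> f(T)\<close>, of
  \<open>f \<mapsto> (f g)(T)\<close>, of \<open>f \<mapsto> S * f(T)\<close> with operator
  \<open>cscale q T\<close>, and of a homomorphism on \<open>Oq_set\<close> restricted to functions
  of \<open>x\<close>.\<close>

definition module_map :: "complex set \<Rightarrow> 'a::cbanach_algebra \<Rightarrow> ((complex \<Rightarrow> complex) \<Rightarrow> 'a) \<Rightarrow> bool" where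
  "module_map U T M \<longleftrightarrow>
     (\<forall>f g. f holomorphic_on U \<longrightarrow> g holomorphic_on U \<longrightarrow> M (\<lambda>z. f z + g z) = M f + M g) \<and>
     (\<forall>f c. f holomorphic_on U \<longrightarrow> M (\<lambda>z. c * f z) = cscale c (M f)) \<and>
     (\<forall>f. f holomorphic_on U \<longrightarrow> M (\<lambda>z. z * f z) = T * M f) \<and>
     (\<exists>K L. compact K \<and> K \<subseteq> U \<and> 0 \<le> L \<and>
        (\<forall>f B. f holomorphic_on U \<longrightarrow> (\<forall>z\<in>K. cmod (f z) \<le> B) \<longrightarrow> norm (M f) \<le> L * B))"

lemma module_mapD:
  assumes "module_map U T M" "f holomorphic_on U"
  shows "g holomorphic_on U \<Longrightarrow> M (\<lambda>z. f z + g z) = M f + M g" "M (\<lambda>z. c * f z) = cscale c (M f)"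
    "M (\<lambda>z. z * f z) = T * M f"
  using assms by (auto simp: module_map_def)

lemma module_map_bound:
  assumes "module_map U T M"
  shows "\<exists>K L. compact K \<and> K \<subseteq> U \<and> 0 \<le> L \<and>
    (\<forall>f B. f holomorphic_on U \<longrightarrow> (\<forall>z\<in>K. cmod (f z) \<le> B) \<longrightarrow> norm (M f) \<le> L * B)"
  using assms unfolding module_map_def by simp

text \<open>The bound applied with \<open>B = 0\<close> to the difference shows that values off
  \<open>U\<close> are irrelevant. This matters because coefficients of elements of
  \<open>Oq_set\<close> are cut off outside \<open>Ux\<close>.\<close>

lemma module_map_cong:
  assumes M: "module_map U T M" and f: "f holomorphic_on U" and eq: "\<And>z. z \<in> U \<Longrightarrow> f z = g z"
  shows "M f = M g"
proof -
  have g: "g holomorphic_on U" using f eq by (simp cong: holomorphic_cong)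
  from module_map_bound[OF M] obtain K L where K: "K \<subseteq> U"
    and L: "\<forall>f B. f holomorphic_on U \<longrightarrow> (\<forall>z\<in>K. cmod (f z) \<le> B) \<longrightarrow> norm (M f) \<le> L * B" by blast
  have "(\<lambda>z. f z + (-1) * g z) holomorphic_on U" by (intro holomorphic_intros f g)
  moreover have "\<forall>z\<in>K. cmod (f z + (-1) * g z) \<le> 0" using eq K by auto
  ultimately have "norm (M (\<lambda>z. f z + (-1) * g z)) \<le> L * 0" using L by blast
  moreover have "M (\<lambda>z. f z + (-1) * g z) = M f - M g"
    using module_mapD(1)[OF M f, of "\<lambda>z. (-1) * g z"] module_mapD(2)[OF M g, of "-1"] g
    by (simp add: holomorphic_on_minus)
  ultimately show ?thesis by simp
qed

text \<open>Division with remainder, \<open>f z = f w + (z - w) * diff_quot f w z\<close>, turns the resolvent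
identity into a formula whose correction term is holomorphic on all of \<^term>\<open>U\<close>, including the
spectrum, so that it integrates to zero.\<close>

lemma module_map_unique:
  fixes T :: "'a::cbanach_algebra"
  assumes U: "open U" and adm: "admissible_cycle U T gs" and M: "module_map U T M" and f: "f holomorphic_on U"
  shows "riesz_integral f T gs * M (\<lambda>_. 1) = M f"
proof (rule cfunctional_eqI)
  fix \<phi> :: "'a \<Rightarrow> complex" assume \<phi>: "cfunctional \<phi>"
  interpret phi: bounded_linear \<phi> using \<phi> cfunctionalD by blast
  note gs = admissible_cycleD[OF adm]
  have W: "open (U - bspec T)" using U closed_bspec by blast
  note paths = loops_in_imp_paths_in[OF gs(1)]
  have one: "(\<lambda>_. 1) holomorphic_on U" by simp
  have eq: "f w * \<phi> (resolvent T w * M (\<lambda>_. 1)) = \<phi> (resolvent T w * M f) + \<phi> (M (diff_quot f w))"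
    if w: "w \<in> U - bspec T" for w
  proof -
    have d: "diff_quot f w holomorphic_on U" by (rule holomorphic_diff_quot[OF f U])
    have d': "(\<lambda>z. z * diff_quot f w z) holomorphic_on U" "(\<lambda>z. (- w) * diff_quot f w z) holomorphic_on U"
      by (intro holomorphic_intros d)+
    have "M f = M (\<lambda>z. f w * 1 + (z * diff_quot f w z + (- w) * diff_quot f w z))"
      using diff_quot_mult[of _ w f] by (intro arg_cong[where f=M] ext) (simp add: algebra_simps)
    also have "\<dots> = cscale (f w) (M (\<lambda>_. 1)) + (T * M (diff_quot f w) + cscale (- w) (M (diff_quot f w)))"
      using module_mapD(1)[OF M, of "\<lambda>_. f w * 1" "\<lambda>z. z * diff_quot f w z + (- w) * diff_quot f w z"]
        module_mapD(1)[OF M d'] module_mapD(2)[OF M one, of "f w"] module_mapD(3)[OF M d]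
        module_mapD(2)[OF M d, of "- w"] holomorphic_on_add[OF d'] by simp
    also have "\<dots> = cscale (f w) (M (\<lambda>_. 1)) - (cscale w 1 - T) * M (diff_quot f w)"
      by (simp add: left_diff_distrib cscale_mult_left)
    finally have Mf: "M f = cscale (f w) (M (\<lambda>_. 1)) - (cscale w 1 - T) * M (diff_quot f w)" .
    have "resolvent T w * ((cscale w 1 - T) * x) = x" for x
      using w by (simp add: mult.assoc[symmetric] resolvent_works(1) del: mult.assoc)
    then have "resolvent T w * M f = cscale (f w) (resolvent T w * M (\<lambda>_. 1)) - M (diff_quot f w)"
      unfolding Mf right_diff_distrib[of "resolvent T w"] cscale_mult_right by simp
    then show ?thesis by (simp add: cfunctionalD(2)[OF \<phi>] phi.diff)
  qed
  have hol1: "(\<lambda>w. \<phi> (resolvent T w * M f)) holomorphic_on U - bspec T"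
    using holomorphic_cfunctional_resolvent[OF cfunctional_mult(2)[OF \<phi>]] by (rule holomorphic_on_subset) auto
  have hf: "hol_functional U (\<lambda>k. \<phi> (M k))"
  proof -
    obtain C where C: "0 < C" "\<And>x. cmod (\<phi> x) \<le> norm x * C" using phi.pos_bounded by blast
    from module_map_bound[OF M] obtain K L where K: "compact K" "K \<subseteq> U" "0 \<le> L"
      and L: "\<forall>f B. f holomorphic_on U \<longrightarrow> (\<forall>z\<in>K. cmod (f z) \<le> B) \<longrightarrow> norm (M f) \<le> L * B" by blast
    show ?thesis unfolding hol_functional_def
    proof (intro conjI allI impI)
      show "\<phi> (M (\<lambda>z. f z + g z)) = \<phi> (M f) + \<phi> (M g)" if "f holomorphic_on U" "g holomorphic_on U" for f g
        using module_mapD(1)[OF M that] by (simp add: phi.add)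
      show "\<phi> (M (\<lambda>z. c * f z)) = c * \<phi> (M f)" if "f holomorphic_on U" for f c
        using module_mapD(2)[OF M that] by (simp add: cfunctionalD(2)[OF \<phi>])
      show "\<exists>K L. compact K \<and> K \<subseteq> U \<and> 0 \<le> L \<and>
        (\<forall>f B. f holomorphic_on U \<longrightarrow> (\<forall>z\<in>K. cmod (f z) \<le> B) \<longrightarrow> cmod (\<phi> (M f)) \<le> L * B)"
      proof (intro exI conjI allI impI)
        show "compact K" "K \<subseteq> U" "0 \<le> L * C" using K C by auto
        fix f B assume "f holomorphic_on U" "\<forall>z\<in>K. cmod (f z) \<le> B"
        then have "norm (M f) * C \<le> (L * B) * C" using L C by (intro mult_right_mono) auto
        also have "(L * B) * C = L * C * B" by simp
        finally show "cmod (\<phi> (M f)) \<le> L * C * B" using C(2)[of "M f"] by linarith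
      qed
    qed
  qed
  have hol2: "(\<lambda>w. \<phi> (M (diff_quot f w))) holomorphic_on U"
    by (rule holomorphic_hol_functional[where \<Phi>="\<lambda>k. \<phi> (M k)" and G="diff_quot f", OF hf U])
       (rule holomorphic_diff_quot[OF f U] diff_quot_locally_bounded[OF f U]; assumption)+
  have "\<phi> (riesz_integral f T gs * M (\<lambda>_. 1)) * (2 * pi * \<i>) =
      cycle_integral gs (\<lambda>w. f w * \<phi> (resolvent T w * M (\<lambda>_. 1)))"
    using cfunctional_riesz_integral[OF U f gs(1) cfunctional_mult(2)[OF \<phi>]] by simp
  also have "\<dots> = cycle_integral gs (\<lambda>w. \<phi> (resolvent T w * M f) + \<phi> (M (diff_quot f w)))"
    by (rule cycle_integral_cong, rule eq) (use paths in \<open>auto simp: paths_in_def\<close>)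
  also have "\<dots> = cycle_integral gs (\<lambda>w. \<phi> (resolvent T w * M f)) + cycle_integral gs (\<lambda>w. \<phi> (M (diff_quot f w)))"
    by (rule cycle_integral_add[OF W paths hol1]) (rule holomorphic_on_subset[OF hol2], auto)
  also have "cycle_integral gs (\<lambda>w. \<phi> (M (diff_quot f w))) = 0"
    by (rule Cauchy_theorem_cycle[OF U hol2 loops_in_mono[OF gs(1)] gs(3)]) auto
  also have "cycle_integral gs (\<lambda>w. \<phi> (resolvent T w * M f)) = \<phi> (riesz_integral (\<lambda>_. 1) T gs * M f) * (2 * pi * \<i>)"
    using cfunctional_riesz_integral[OF U one gs(1) cfunctional_mult(2)[OF \<phi>], of "M f"] by simp
  finally show "\<phi> (riesz_integral f T gs * M (\<lambda>_. 1)) = \<phi> (M f)"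
    by (simp add: riesz_integral_one[OF U adm])
qed

text \<open>Multiplication by \<open>z\<close> becomes multiplication by \<open>T\<close> through
  \<open>w R(w) = T R(w) + 1\<close>: the last term leaves the integral of \<open>f\<close> over a
  cycle without winding around points outside \<open>U\<close>, which is zero.\<close>

lemma module_map_riesz_integral:
  fixes T :: "'a::cbanach_algebra"
  assumes U: "open U" and adm: "admissible_cycle U T gs"
  shows "module_map U T (\<lambda>f. riesz_integral f T gs)"
proof -
  note gs = admissible_cycleD[OF adm]
  note riesz = cfunctional_riesz_integral[OF U _ gs(1)]
  note paths = loops_in_imp_paths_in[OF gs(1)]
  have W: "open (U - bspec T)" using U closed_bspec by blast
  have hol: "(\<lambda>w. f w * \<phi> (resolvent T w)) holomorphic_on U - bspec T"
    if "f holomorphic_on U" "cfunctional \<phi>" for f \<phi>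
    using that by (intro holomorphic_on_mult holomorphic_on_subset[OF that(1)]
        holomorphic_on_subset[OF holomorphic_cfunctional_resolvent[OF that(2)]]) auto
  show ?thesis
    unfolding module_map_def
  proof (intro conjI allI impI)
    fix f g assume f: "f holomorphic_on U" and g: "g holomorphic_on U"
    show "riesz_integral (\<lambda>z. f z + g z) T gs = riesz_integral f T gs + riesz_integral g T gs"
    proof (rule cfunctional_eqI)
      fix \<phi> :: "'a \<Rightarrow> complex" assume \<phi>: "cfunctional \<phi>"
      interpret phi: bounded_linear \<phi> using \<phi> cfunctionalD by blast
      have "cycle_integral gs (\<lambda>w. (f w + g w) * \<phi> (resolvent T w)) =
          cycle_integral gs (\<lambda>w. f w * \<phi> (resolvent T w)) + cycle_integral gs (\<lambda>w. g w * \<phi> (resolvent T w))"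
        using cycle_integral_add[OF W paths hol[OF f \<phi>] hol[OF g \<phi>]] by (simp add: distrib_right)
      then show "\<phi> (riesz_integral (\<lambda>z. f z + g z) T gs) = \<phi> (riesz_integral f T gs + riesz_integral g T gs)"
        by (simp add: phi.add riesz[OF _ \<phi>] f g holomorphic_on_add add_divide_distrib)
    qed
  next
    fix f c assume f: "f holomorphic_on U"
    show "riesz_integral (\<lambda>z. c * f z) T gs = cscale c (riesz_integral f T gs)"
    proof (rule cfunctional_eqI)
      fix \<phi> :: "'a \<Rightarrow> complex" assume \<phi>: "cfunctional \<phi>"
      have "cycle_integral gs (\<lambda>w. (c * f w) * \<phi> (resolvent T w)) = c * cycle_integral gs (\<lambda>w. f w * \<phi> (resolvent T w))"
        using cycle_integral_cmult[OF W paths hol[OF f \<phi>], of c] by (simp add: mult.assoc)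
      then show "\<phi> (riesz_integral (\<lambda>z. c * f z) T gs) = \<phi> (cscale c (riesz_integral f T gs))"
        by (simp add: cfunctionalD(2)[OF \<phi>] riesz[OF _ \<phi>] f holomorphic_on_mult)
    qed
  next
    fix f assume f: "f holomorphic_on U"
    show "riesz_integral (\<lambda>z. z * f z) T gs = T * riesz_integral f T gs"
    proof (rule cfunctional_eqI)
      fix \<phi> :: "'a \<Rightarrow> complex" assume \<phi>: "cfunctional \<phi>"
      interpret phi: bounded_linear \<phi> using \<phi> cfunctionalD by blast
      note \<phi>' = cfunctional_mult(1)[OF \<phi>, of T]
      have zf: "(\<lambda>z. z * f z) holomorphic_on U" by (intro holomorphic_intros f)
      have fc: "(\<lambda>w. \<phi> 1 * f w) holomorphic_on U" by (intro holomorphic_intros f)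
      have "cycle_integral gs (\<lambda>w. (w * f w) * \<phi> (resolvent T w)) =
          cycle_integral gs (\<lambda>w. f w * \<phi> (T * resolvent T w) + \<phi> 1 * f w)"
      proof (rule cycle_integral_cong)
        fix \<gamma> w assume "\<gamma> \<in> set gs" "w \<in> path_image \<gamma>"
        then have "w \<notin> bspec T" using paths by (auto simp: paths_in_def)
        then show "(w * f w) * \<phi> (resolvent T w) = f w * \<phi> (T * resolvent T w) + \<phi> 1 * f w"
          by (simp add: resolvent_mult_T phi.diff cfunctionalD(2)[OF \<phi>] algebra_simps)
      qed
      also have "\<dots> = cycle_integral gs (\<lambda>w. f w * \<phi> (T * resolvent T w)) + cycle_integral gs (\<lambda>w. \<phi> 1 * f w)"
        by (rule cycle_integral_add[OF W paths hol[OF f \<phi>']]) (rule holomorphic_on_subset[OF fc], auto)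
      also have "cycle_integral gs (\<lambda>w. \<phi> 1 * f w) = 0"
        by (rule Cauchy_theorem_cycle[OF U fc loops_in_mono[OF gs(1)] gs(3)]) auto
      finally show "\<phi> (riesz_integral (\<lambda>z. z * f z) T gs) = \<phi> (T * riesz_integral f T gs)"
        using riesz[OF f \<phi>'] riesz[OF zf \<phi>] by simp
    qed
  next
    from cycle_integral_bound[OF W paths] obtain K L where K: "compact K" "K \<subseteq> U - bspec T" "0 \<le> L"
      and L: "\<forall>f B. f holomorphic_on (U - bspec T) \<longrightarrow> (\<forall>z\<in>K. cmod (f z) \<le> B) \<longrightarrow> cmod (cycle_integral gs f) \<le> L * B"
      by blast
    have KU: "K \<subseteq> U" "K \<subseteq> - bspec T" using K(2) by auto
    have "continuous_on K (resolvent T)" using continuous_on_resolvent KU(2) continuous_on_subset by blast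
    then have "bounded (resolvent T ` K)" using K(1) compact_continuous_image compact_imp_bounded by blast
    then obtain N where "0 < N" "\<forall>x\<in>resolvent T ` K. norm x \<le> N" unfolding bounded_pos by blast
    then have N: "0 < N" "\<forall>z\<in>K. norm (resolvent T z) \<le> N" by auto
    show "\<exists>K L. compact K \<and> K \<subseteq> U \<and> 0 \<le> L \<and>
      (\<forall>f B. f holomorphic_on U \<longrightarrow> (\<forall>z\<in>K. cmod (f z) \<le> B) \<longrightarrow> norm (riesz_integral f T gs) \<le> L * B)"
    proof (intro exI conjI allI impI)
      \<comment> \<open>\<open>K\<close> and \<open>L\<close> come from the scalar integral,
        \<open>N\<close> bounds the resolvent on \<open>K\<close>, and the factor 2 in
        \<open>2 * N\<close> is the bound on the test functionals.\<close>
      show "compact K" "K \<subseteq> U" "0 \<le> L * (2 * N) / (2 * pi)" using K KU N by auto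
      fix f B assume f: "f holomorphic_on U" and B: "\<forall>z\<in>K. cmod (f z) \<le> B"
      show "norm (riesz_integral f T gs) \<le> L * (2 * N) / (2 * pi) * B"
      proof (rule norm_le_cfunctional)
        fix \<phi> :: "'a \<Rightarrow> complex" assume \<phi>: "cfunctional \<phi>" and \<phi>b: "\<And>y. cmod (\<phi> y) \<le> 2 * norm y"
        have "\<forall>z\<in>K. cmod (f z * \<phi> (resolvent T z)) \<le> B * (2 * N)"
        proof
          fix z assume z: "z \<in> K"
          have "cmod (\<phi> (resolvent T z)) \<le> 2 * N" using \<phi>b[of "resolvent T z"] N(2) z by fastforce
          then show "cmod (f z * \<phi> (resolvent T z)) \<le> B * (2 * N)"
            unfolding norm_mult using B z by (intro mult_mono) (auto intro: order_trans[OF norm_ge_zero])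
        qed
        then have "cmod (cycle_integral gs (\<lambda>w. f w * \<phi> (resolvent T w))) \<le> L * (B * (2 * N))"
          using L hol[OF f \<phi>] by blast
        then show "cmod (\<phi> (riesz_integral f T gs)) \<le> L * (2 * N) / (2 * pi) * B"
          unfolding riesz[OF f \<phi>] by (simp add: norm_divide norm_mult field_simps)
      qed
    qed
  qed
qed

section \<open>Existence and algebraic properties of the calculus\<close>

lemma admissible_cycle_exists:
  assumes "open U" "bspec T \<subseteq> U" shows "\<exists>gs. admissible_cycle U T gs"
proof -
  from surrounding_cycle_exists[OF compact_bspec assms] obtain hs
    where "loops_in (U - bspec T) hs" "\<forall>z\<in>bspec T. (\<Sum>\<gamma>\<leftarrow>hs. winding_number \<gamma> z) = 1"
      "\<forall>z. z \<notin> U \<longrightarrow> (\<Sum>\<gamma>\<leftarrow>hs. winding_number \<gamma> z) = 0"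
    by (elim exE conjE) (rule that)
  then have "admissible_cycle U T hs" unfolding admissible_cycle_def loops_in_def by simp
  then show ?thesis by blast
qed

text \<open>Uniqueness for one cycle, applied to the module map given by another cycle, whose value
  at the constant 1 is 1.\<close>

lemma hfc_eq_riesz_integral:
  assumes U: "open U" and adm: "admissible_cycle U T gs" and f: "f holomorphic_on U"
  shows "hfc U f T = riesz_integral f T gs"
proof -
  have eq: "riesz_integral f T hs = riesz_integral f T gs" if "admissible_cycle U T hs" for hs
    using module_map_unique[OF U that module_map_riesz_integral[OF U adm] f] riesz_integral_one[OF U adm] by simp
  show ?thesis unfolding hfc_def
  proof (rule some_equality)
    show "\<exists>hs. admissible_cycle U T hs \<and> riesz_integral f T gs = riesz_integral f T hs"
      using adm by blast
    fix v assume "\<exists>hs. admissible_cycle U T hs \<and> v = riesz_integral f T hs"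
    then show "v = riesz_integral f T gs" using eq by metis
  qed
qed

context
  fixes U :: "complex set" and T :: "'a::cbanach_algebra"
  assumes U: "open U" and TU: "bspec T \<subseteq> U"
begin

lemma module_map_hfc: "module_map U T (\<lambda>f. hfc U f T)"
proof -
  obtain gs where gs: "admissible_cycle U T gs" using admissible_cycle_exists[OF U TU] by blast
  have eq: "hfc U f T = riesz_integral f T gs" if "f holomorphic_on U" for f
    by (rule hfc_eq_riesz_integral[OF U gs that])
  have zf: "(\<lambda>z. z * f z) holomorphic_on U" if "f holomorphic_on U" for f
    using that by (intro holomorphic_intros)
  show ?thesis
    using module_map_riesz_integral[OF U gs] unfolding module_map_def
    by (simp add: eq zf holomorphic_on_add holomorphic_on_mult)
qed

lemma hfc_one: "hfc U (\<lambda>_. 1) T = 1"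
proof -
  obtain gs where "admissible_cycle U T gs" using admissible_cycle_exists[OF U TU] by blast
  then show ?thesis by (simp add: hfc_eq_riesz_integral[OF U] riesz_integral_one[OF U])
qed

lemma hfc_unique:
  assumes "module_map U T M" "f holomorphic_on U"
  shows "M f = hfc U f T * M (\<lambda>_. 1)"
proof -
  obtain gs where gs: "admissible_cycle U T gs" using admissible_cycle_exists[OF U TU] by blast
  show ?thesis unfolding hfc_eq_riesz_integral[OF U gs assms(2)] by (rule module_map_unique[OF U gs assms, symmetric])
qed

text \<open>For fixed \<open>g\<close> the left-hand side is a module map in \<open>f\<close> with
  value \<open>hfc U g T\<close> at the constant 1, so uniqueness is the claim and no product of
  contour integrals appears.\<close>

lemma hfc_mult:
  assumes f: "f holomorphic_on U" and g: "g holomorphic_on U"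
  shows "hfc U (\<lambda>z. f z * g z) T = hfc U f T * hfc U g T"
proof -
  let ?M = "\<lambda>f. hfc U (\<lambda>z. f z * g z) T"
  note M = module_map_hfc
  have "module_map U T ?M"
    unfolding module_map_def
  proof (intro conjI allI impI)
    fix f h assume fh: "f holomorphic_on U" "h holomorphic_on U"
    show "?M (\<lambda>z. f z + h z) = ?M f + ?M h"
      using module_mapD(1)[OF M holomorphic_on_mult[OF fh(1) g] holomorphic_on_mult[OF fh(2) g]]
      by (simp add: distrib_right)
  next
    fix f c assume f: "f holomorphic_on U"
    show "?M (\<lambda>z. c * f z) = cscale c (?M f)"
      using module_mapD(2)[OF M holomorphic_on_mult[OF f g], of c] by (simp add: mult.assoc)
  next
    fix f assume f: "f holomorphic_on U"
    show "?M (\<lambda>z. z * f z) = T * ?M f"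
      using module_mapD(3)[OF M holomorphic_on_mult[OF f g]] by (simp add: mult.assoc)
  next
    from module_map_bound[OF M] obtain K L where K: "compact K" "K \<subseteq> U" "0 \<le> L"
      and L: "\<forall>f B. f holomorphic_on U \<longrightarrow> (\<forall>z\<in>K. cmod (f z) \<le> B) \<longrightarrow> norm (hfc U f T) \<le> L * B" by blast
    have "continuous_on K g" using holomorphic_on_imp_continuous_on[OF g] K(2) continuous_on_subset by blast
    then have "bounded (g ` K)" using K(1) compact_continuous_image compact_imp_bounded by blast
    then obtain N where "0 < N" "\<forall>x\<in>g ` K. norm x \<le> N" unfolding bounded_pos by blast
    then have N: "0 < N" "\<forall>z\<in>K. norm (g z) \<le> N" by auto
    show "\<exists>K L. compact K \<and> K \<subseteq> U \<and> 0 \<le> L \<and>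
      (\<forall>f B. f holomorphic_on U \<longrightarrow> (\<forall>z\<in>K. cmod (f z) \<le> B) \<longrightarrow> norm (?M f) \<le> L * B)"
    proof (intro exI conjI allI impI)
      show "compact K" "K \<subseteq> U" "0 \<le> L * N" using K N by auto
      fix f B assume f: "f holomorphic_on U" and B: "\<forall>z\<in>K. cmod (f z) \<le> B"
      have "\<forall>z\<in>K. cmod (f z * g z) \<le> B * N"
        unfolding norm_mult using B N by (auto intro!: mult_mono intro: order_trans[OF norm_ge_zero])
      then have "norm (?M f) \<le> L * (B * N)" using L holomorphic_on_mult[OF f g] by blast
      then show "norm (?M f) \<le> L * N * B" by (simp add: mult.assoc mult.commute[of N])
    qed
  qed
  from hfc_unique[OF this f] show ?thesis by simp
qed

end

lemma bspec_cscale: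
  assumes "q \<noteq> 0" "w \<in> bspec (cscale q T)"
  shows "w / q \<in> bspec T"
proof (rule ccontr)
  assume "w / q \<notin> bspec T"
  then have i: "ainvertible (cscale (w / q) 1 - T)" by (simp add: not_in_bspec)
  have q: "ainvertible (cscale q (1::'a))"
    using assms(1) ainv_unique(1)[of "cscale (inverse q) 1" "cscale q (1::'a)"]
    by (auto simp: cscale_mult_left cscale_mult_right cscale_assoc)
  have "cscale q 1 * (cscale (w / q) 1 - T) = cscale w 1 - cscale q T"
    using assms(1) by (simp add: cscale_mult_left cscale_diff_right cscale_assoc)
  then have "w \<notin> bspec (cscale q T)" unfolding not_in_bspec using ainv_mult(1)[OF q i] by simp
  then show False using assms(2) by blast
qed

text \<open>Both sides, as functions of \<open>g\<close>, are module maps for the operator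
  \<open>cscale q T\<close>, and both send the constant 1 to \<open>S\<close>. Invariance of
  \<open>U\<close> under multiplication by \<open>q\<close> puts the spectrum of
  \<open>cscale q T\<close> inside \<open>U\<close>.\<close>

lemma hfc_intertwine:
  fixes S T :: "'a::cbanach_algebra"
  assumes U: "open U" and TU: "bspec T \<subseteq> U" and q: "q \<noteq> 0" "\<And>z. z \<in> U \<Longrightarrow> q * z \<in> U"
    and ST: "S * T = cscale q (T * S)" and g: "g holomorphic_on U"
  shows "S * hfc U g T = hfc U (\<lambda>z. g (q * z)) T * S"
proof -
  let ?T' = "cscale q T"
  note M = module_map_hfc[OF U TU]
  have sub: "bspec ?T' \<subseteq> U"
  proof
    fix w assume "w \<in> bspec ?T'"
    then have "q * (w / q) \<in> U" using bspec_cscale[OF q(1)] TU q(2) by blast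
    then show "w \<in> U" using q(1) by simp
  qed
  have gq: "(\<lambda>z. f (q * z)) holomorphic_on U" if "f holomorphic_on U" for f
  proof -
    have "f \<circ> (\<lambda>z. q * z) holomorphic_on U"
      by (rule holomorphic_on_compose_gen[OF _ that]) (use q(2) in \<open>auto intro!: holomorphic_intros\<close>)
    then show ?thesis by (simp add: o_def)
  qed
  from module_map_bound[OF M] obtain K L where K: "compact K" "K \<subseteq> U" "0 \<le> L"
    and L: "\<forall>f B. f holomorphic_on U \<longrightarrow> (\<forall>z\<in>K. cmod (f z) \<le> B) \<longrightarrow> norm (hfc U f T) \<le> L * B" by blast
  have "module_map U ?T' (\<lambda>f. S * hfc U f T)"
    unfolding module_map_def
  proof (intro conjI allI impI)
    show "S * hfc U (\<lambda>z. f z + g z) T = S * hfc U f T + S * hfc U g T"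
      if "f holomorphic_on U" "g holomorphic_on U" for f g
      using module_mapD(1)[OF M that] by (simp add: distrib_left)
    show "S * hfc U (\<lambda>z. c * f z) T = cscale c (S * hfc U f T)" if "f holomorphic_on U" for f c
      using module_mapD(2)[OF M that] by (simp add: cscale_mult_right)
    show "S * hfc U (\<lambda>z. z * f z) T = ?T' * (S * hfc U f T)" if "f holomorphic_on U" for f
    proof -
      have "S * hfc U (\<lambda>z. z * f z) T = (S * T) * hfc U f T"
        using module_mapD(3)[OF M that] by (simp add: mult.assoc)
      then show ?thesis unfolding ST by (simp add: cscale_mult_left mult.assoc)
    qed
    show "\<exists>K L. compact K \<and> K \<subseteq> U \<and> 0 \<le> L \<and>
      (\<forall>f B. f holomorphic_on U \<longrightarrow> (\<forall>z\<in>K. cmod (f z) \<le> B) \<longrightarrow> norm (S * hfc U f T) \<le> L * B)"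
    proof (intro exI conjI allI impI)
      show "compact K" "K \<subseteq> U" "0 \<le> norm S * L" using K by auto
      fix f B assume "f holomorphic_on U" "\<forall>z\<in>K. cmod (f z) \<le> B"
      then have "norm S * norm (hfc U f T) \<le> norm S * (L * B)" using L by (intro mult_left_mono) auto
      then show "norm (S * hfc U f T) \<le> norm S * L * B" using norm_mult_ineq[of S "hfc U f T"] by (simp add: mult.assoc)
    qed
  qed
  from hfc_unique[OF U sub this g] have 1: "S * hfc U g T = hfc U g ?T' * S"
    by (simp add: hfc_one[OF U TU])
  have "module_map U ?T' (\<lambda>f. hfc U (\<lambda>z. f (q * z)) T * S)"
    unfolding module_map_def
  proof (intro conjI allI impI)
    fix f g assume "f holomorphic_on U" "g holomorphic_on U"
    then show "hfc U (\<lambda>z. f (q * z) + g (q * z)) T * S = hfc U (\<lambda>z. f (q * z)) T * S + hfc U (\<lambda>z. g (q * z)) T * S"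
      using module_mapD(1)[OF M gq gq] by (simp add: distrib_right)
  next
    fix f c assume "f holomorphic_on U"
    then show "hfc U (\<lambda>z. c * f (q * z)) T * S = cscale c (hfc U (\<lambda>z. f (q * z)) T * S)"
      using module_mapD(2)[OF M gq] by (simp add: cscale_mult_left)
  next
    fix f assume f: "f holomorphic_on U"
    have "(\<lambda>z. z * f (q * z)) holomorphic_on U" by (intro holomorphic_intros gq f)
    then show "hfc U (\<lambda>z. q * z * f (q * z)) T * S = cscale q T * (hfc U (\<lambda>z. f (q * z)) T * S)"
      using module_mapD(2)[OF M, of "\<lambda>z. z * f (q * z)" q] module_mapD(3)[OF M gq[OF f]]
      by (simp add: cscale_mult_left mult.assoc)
  next
    show "\<exists>K L. compact K \<and> K \<subseteq> U \<and> 0 \<le> L \<and>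
      (\<forall>f B. f holomorphic_on U \<longrightarrow> (\<forall>z\<in>K. cmod (f z) \<le> B) \<longrightarrow> norm (hfc U (\<lambda>z. f (q * z)) T * S) \<le> L * B)"
    proof (intro exI conjI allI impI)
      show "compact ((\<lambda>z. q * z) ` K)" using K(1) by (intro compact_continuous_image continuous_intros)
      show "(\<lambda>z. q * z) ` K \<subseteq> U" using K(2) q(2) by blast
      show "0 \<le> norm S * L" using K by auto
      fix f B assume f: "f holomorphic_on U" and "\<forall>z\<in>(\<lambda>z. q * z) ` K. cmod (f z) \<le> B"
      then have "norm (hfc U (\<lambda>z. f (q * z)) T) \<le> L * B" using L gq[OF f] by blast
      then have "norm (hfc U (\<lambda>z. f (q * z)) T) * norm S \<le> (L * B) * norm S" by (intro mult_right_mono) auto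
      also have "\<dots> = norm S * L * B" by simp
      finally show "norm (hfc U (\<lambda>z. f (q * z)) T * S) \<le> norm S * L * B"
        using norm_mult_ineq[of "hfc U (\<lambda>z. f (q * z)) T" S] by linarith
    qed
  qed
  from hfc_unique[OF U sub this g] have "hfc U (\<lambda>z. g (q * z)) T * S = hfc U g ?T' * S"
    by (simp add: hfc_one[OF U TU])
  then show ?thesis using 1 by simp
qed

text \<open>In place of the spectral radius formula, the Riesz integral of \<open>z ^ n\<close> over
  the circle of radius \<open>r\<close> is estimated. The set \<open>UNIV\<close> makes this circle
  an admissible cycle, and the constant is \<open>2 * N * r\<close> with \<open>N\<close> a bound of
  the resolvent on the circle.\<close>

lemma power_norm_bound:
  fixes T :: "'a::cbanach_algebra"
  assumes r: "0 < r" and sp: "\<And>w. w \<in> bspec T \<Longrightarrow> cmod w < r"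
  shows "\<exists>C\<ge>0. \<forall>n. norm (T ^ n) \<le> C * r ^ n"
proof -
  have adm: "admissible_cycle UNIV T [circlepath 0 r]"
    unfolding admissible_cycle_def
  proof (intro conjI ballI allI impI)
    fix z assume "z \<in> bspec T"
    then show "(\<Sum>g\<leftarrow>[circlepath 0 r]. winding_number g z) = 1"
      using sp winding_number_circlepath[of z 0 r] by simp
  next
    fix g assume "g \<in> set [circlepath 0 r]"
    moreover have "w \<notin> bspec T" if "cmod w = r" for w using sp[of w] that by auto
    ultimately show "path_image g \<subseteq> UNIV - bspec T" using r by (auto simp: path_image_circlepath)
  qed auto
  note M = module_map_riesz_integral[OF open_UNIV adm]
  have pow: "riesz_integral (\<lambda>z. z ^ n) T [circlepath 0 r] = T ^ n" for n
  proof (induction n)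
    case 0 show ?case using riesz_integral_one[OF open_UNIV adm] by simp
  next
    case (Suc n)
    then show ?case using module_mapD(3)[OF M, of "\<lambda>z. z ^ n"] by (simp add: holomorphic_intros)
  qed
  have sub: "sphere 0 r \<subseteq> - bspec T" using sp by force
  have "bounded (resolvent T ` sphere 0 r)"
    by (intro compact_imp_bounded compact_continuous_image continuous_on_subset[OF continuous_on_resolvent sub]) auto
  then obtain N where "0 < N" "\<forall>x\<in>resolvent T ` sphere 0 r. norm x \<le> N" unfolding bounded_pos by blast
  then have N: "0 < N" "\<And>z. cmod z = r \<Longrightarrow> norm (resolvent T z) \<le> N" by auto
  have "norm (T ^ n) \<le> 2 * N * r * r ^ n" for n
  proof (rule norm_le_cfunctional)
    fix \<phi> :: "'a \<Rightarrow> complex" assume \<phi>: "cfunctional \<phi>" and \<phi>b: "\<And>y. cmod (\<phi> y) \<le> 2 * norm y"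
    let ?h = "\<lambda>w. w ^ n * \<phi> (resolvent T w)"
    have op: "open (- bspec T)" using closed_bspec by blast
    have hol: "?h holomorphic_on - bspec T"
      by (intro holomorphic_intros holomorphic_cfunctional_resolvent[OF \<phi>])
    have "?h contour_integrable_on circlepath 0 r"
      by (rule contour_integrable_holomorphic_simple[OF hol op]) (use sub r in \<open>auto simp: path_image_circlepath\<close>)
    then have "(?h has_contour_integral contour_integral (circlepath 0 r) ?h) (circlepath 0 r)"
      by (rule has_contour_integral_integral)
    then have "cmod (contour_integral (circlepath 0 r) ?h) \<le> (r ^ n * (2 * N)) * (2 * pi * r)"
    proof (rule has_contour_integral_bound_circlepath)
      fix w :: complex assume "cmod (w - 0) = r"
      then have w: "cmod w = r" by simp
      have "cmod (\<phi> (resolvent T w)) \<le> 2 * N" using \<phi>b[of "resolvent T w"] N(2)[OF w] by linarith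
      then show "cmod (?h w) \<le> r ^ n * (2 * N)"
        unfolding norm_mult norm_power w using r by (intro mult_left_mono) auto
    qed (use N r in auto)
    then have "cmod (contour_integral (circlepath 0 r) ?h) / (2 * pi) \<le> (r ^ n * (2 * N)) * (2 * pi * r) / (2 * pi)"
      by (rule divide_right_mono) simp
    moreover have "\<phi> (T ^ n) = contour_integral (circlepath 0 r) ?h / (2 * pi * \<i>)"
      using cfunctional_riesz_integral[OF open_UNIV _ admissible_cycleD(1)[OF adm] \<phi>, of "\<lambda>z. z ^ n"]
      unfolding pow by (simp add: holomorphic_intros cycle_integral_def)
    then have "cmod (\<phi> (T ^ n)) = cmod (contour_integral (circlepath 0 r) ?h) / (2 * pi)"
      by (simp add: norm_divide norm_mult)
    ultimately have "cmod (\<phi> (T ^ n)) \<le> (r ^ n * (2 * N)) * (2 * pi * r) / (2 * pi)" by linarith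
    then show "cmod (\<phi> (T ^ n)) \<le> 2 * N * r * r ^ n" by (simp add: field_simps)
  qed
  then show ?thesis using N r by (intro exI[of _ "2 * N * r"]) auto
qed

subsection \<open>The algebra of the quantum plane\<close>

lemma bdd_above_cmod_image:
  assumes "continuous_on K h" "compact K" shows "bdd_above ((\<lambda>z. cmod (h z)) ` K)"
  by (intro bounded_imp_bdd_above compact_imp_bounded compact_continuous_image continuous_on_norm assms)

lemma supnorm_ge:
  assumes "continuous_on K h" "compact K" "z \<in> K" shows "cmod (h z) \<le> supnorm K h"
  unfolding supnorm_def using assms by (auto intro!: cSUP_upper bdd_above_cmod_image)

lemma supnorm_le:
  assumes "0 \<le> B" "\<And>z. z \<in> K \<Longrightarrow> cmod (h z) \<le> B" shows "supnorm K h \<le> B"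
  unfolding supnorm_def using assms by (auto intro!: cSUP_least)

lemma supnorm_nonneg:
  assumes "continuous_on K h" "compact K" shows "0 \<le> supnorm K h"
proof (cases "K = {}")
  case False
  then obtain z where "z \<in> K" by blast
  then show ?thesis using supnorm_ge[OF assms] norm_ge_zero order_trans by blast
qed (simp add: supnorm_def)

lemma supnorm_zero [simp]: "supnorm K (\<lambda>_. 0) = 0"
  by (simp add: supnorm_def)

lemma supnorm_cong: "(\<And>z. z \<in> K \<Longrightarrow> f z = g z) \<Longrightarrow> supnorm K f = supnorm K g"
  by (simp add: supnorm_def)

lemma supnorm_mono:
  assumes "continuous_on K' h" "compact K'" "K \<subseteq> K'" shows "supnorm K h \<le> supnorm K' h"
  by (rule supnorm_le[OF supnorm_nonneg[OF assms(1,2)]]) (use supnorm_ge[OF assms(1,2)] assms(3) in blast)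

lemma supnorm_add:
  assumes "continuous_on K f" "continuous_on K g" "compact K"
  shows "supnorm K (\<lambda>z. f z + g z) \<le> supnorm K f + supnorm K g"
proof (rule supnorm_le)
  show "0 \<le> supnorm K f + supnorm K g" using supnorm_nonneg assms by (simp add: add_nonneg_nonneg)
  fix z assume "z \<in> K"
  then show "cmod (f z + g z) \<le> supnorm K f + supnorm K g"
    using supnorm_ge[OF assms(1,3)] supnorm_ge[OF assms(2,3)] norm_triangle_mono by blast
qed

lemma supnorm_cmult:
  assumes "continuous_on K f" "compact K"
  shows "supnorm K (\<lambda>z. c * f z) \<le> cmod c * supnorm K f"
proof (rule supnorm_le)
  show "0 \<le> cmod c * supnorm K f" using supnorm_nonneg assms by simp
  fix z assume "z \<in> K"
  then show "cmod (c * f z) \<le> cmod c * supnorm K f"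
    using supnorm_ge[OF assms] by (simp add: norm_mult mult_left_mono)
qed

section \<open>The function space, its seminorms and its topology\<close>

locale Oq_algebra =
  fixes q :: complex and Ux :: "complex set" and ry :: ereal
  assumes q0: "q \<noteq> 0" and q_open: "q_open q Ux" and ry: "0 < ry"
begin

lemma open_Ux: "open Ux" and zero_Ux: "0 \<in> Ux" and q_Ux: "z \<in> Ux \<Longrightarrow> q ^ n * z \<in> Ux"
  using q_open by (auto simp: q_open_def)

abbreviation "Oq \<equiv> Oq_set Ux ry"

lemma Oq_hol: "F \<in> Oq \<Longrightarrow> F n holomorphic_on Ux"
  and Oq_outside: "F \<in> Oq \<Longrightarrow> z \<notin> Ux \<Longrightarrow> F n z = 0"
  by (auto simp: Oq_set_def)

lemma Oq_cont: "F \<in> Oq \<Longrightarrow> K \<subseteq> Ux \<Longrightarrow> continuous_on K (F n)"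
  using Oq_hol holomorphic_on_imp_continuous_on continuous_on_subset by blast

lemma Oq_summable:
  "F \<in> Oq \<Longrightarrow> compact K \<Longrightarrow> K \<subseteq> Ux \<Longrightarrow> 0 < r \<Longrightarrow> ereal r < ry \<Longrightarrow> summable (\<lambda>n. supnorm K (F n) * r ^ n)"
  by (auto simp: Oq_set_def)

lemma Oq_add: assumes F: "F \<in> Oq" and G: "G \<in> Oq" shows "(\<lambda>n z. F n z + G n z) \<in> Oq"
  unfolding Oq_set_def
proof (intro CollectI conjI allI impI)
  show "(\<lambda>z. F n z + G n z) holomorphic_on Ux" for n using Oq_hol F G by (intro holomorphic_intros)
  show "F n z + G n z = 0" if "z \<notin> Ux" for n z by (simp add: Oq_outside[OF F] Oq_outside[OF G] that)
  fix K r assume K: "compact K" "K \<subseteq> Ux" and r: "0 < r" "ereal r < ry"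
  have "summable (\<lambda>n. supnorm K (F n) * r ^ n + supnorm K (G n) * r ^ n)"
    by (intro summable_add Oq_summable F G K r)
  then show "summable (\<lambda>n. supnorm K (\<lambda>z. F n z + G n z) * r ^ n)"
  proof (rule summable_comparison_test')
    fix n :: nat assume "0 \<le> n"
    have c: "continuous_on K (F n)" "continuous_on K (G n)" using Oq_cont F G K by auto
    have "supnorm K (\<lambda>z. F n z + G n z) * r ^ n \<le> (supnorm K (F n) + supnorm K (G n)) * r ^ n"
      using supnorm_add[OF c K(1)] r by (intro mult_right_mono) auto
    moreover have "0 \<le> supnorm K (\<lambda>z. F n z + G n z)" using supnorm_nonneg[OF continuous_on_add[OF c] K(1)] .
    ultimately show "norm (supnorm K (\<lambda>z. F n z + G n z) * r ^ n) \<le> supnorm K (F n) * r ^ n + supnorm K (G n) * r ^ n"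
      using r by (simp add: distrib_right)
  qed
qed

lemma Oq_cmult: assumes F: "F \<in> Oq" shows "(\<lambda>n z. c * F n z) \<in> Oq"
  unfolding Oq_set_def
proof (intro CollectI conjI allI impI)
  show "(\<lambda>z. c * F n z) holomorphic_on Ux" for n using Oq_hol F by (intro holomorphic_intros)
  show "c * F n z = 0" if "z \<notin> Ux" for n z by (simp add: Oq_outside[OF F] that)
  fix K r assume K: "compact K" "K \<subseteq> Ux" and r: "0 < r" "ereal r < ry"
  have "summable (\<lambda>n. cmod c * (supnorm K (F n) * r ^ n))"
    by (intro summable_mult Oq_summable F K r)
  then show "summable (\<lambda>n. supnorm K (\<lambda>z. c * F n z) * r ^ n)"
  proof (rule summable_comparison_test')
    fix n :: nat assume "0 \<le> n"
    have c: "continuous_on K (F n)" using Oq_cont F K by auto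
    have "supnorm K (\<lambda>z. c * F n z) * r ^ n \<le> (cmod c * supnorm K (F n)) * r ^ n"
      using supnorm_cmult[OF c K(1)] r by (intro mult_right_mono) auto
    moreover have "0 \<le> supnorm K (\<lambda>z. c * F n z)"
      using supnorm_nonneg[OF continuous_on_mult_left[OF c] K(1)] .
    ultimately show "norm (supnorm K (\<lambda>z. c * F n z) * r ^ n) \<le> cmod c * (supnorm K (F n) * r ^ n)"
      using r by (simp add: mult.assoc)
  qed
qed

lemma Oq_diff: assumes "F \<in> Oq" "G \<in> Oq" shows "(\<lambda>n z. F n z - G n z) \<in> Oq"
  using Oq_add[OF assms(1) Oq_cmult[OF assms(2), of "-1"]] by simp

text \<open>Makes the seminorms directed: finitely many are dominated by the one for the union of
  the compact sets and the largest radius.\<close>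

lemma Oq_seminorm_mono:
  assumes F: "F \<in> Oq" and K: "compact K'" "K' \<subseteq> Ux" "compact K" "K \<subseteq> K'"
    and r: "0 < r" "r \<le> r'" "ereal r' < ry"
  shows "Oq_seminorm K r F \<le> Oq_seminorm K' r' F"
  unfolding Oq_seminorm_def
proof (rule suminf_le)
  have lt: "ereal r < ry" using r by (metis ereal_less_eq(3) order.strict_trans1)
  show "summable (\<lambda>n. supnorm K (F n) * r ^ n)" by (rule Oq_summable[OF F]) (use K r lt in auto)
  show "summable (\<lambda>n. supnorm K' (F n) * r' ^ n)" by (rule Oq_summable[OF F]) (use K r in auto)
  fix n
  have c: "continuous_on K' (F n)" by (rule Oq_cont[OF F K(2)])
  show "supnorm K (F n) * r ^ n \<le> supnorm K' (F n) * r' ^ n"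
    using supnorm_mono[OF c K(1,4)] supnorm_nonneg[OF c K(1)] r by (intro mult_mono power_mono) auto
qed

lemma Oq_seminorm_nonneg:
  assumes F: "F \<in> Oq" and K: "compact K" "K \<subseteq> Ux" and r: "0 < r" "ereal r < ry"
  shows "0 \<le> Oq_seminorm K r F"
  unfolding Oq_seminorm_def
  using supnorm_nonneg[OF Oq_cont[OF F K(2)] K(1)] r by (intro suminf_nonneg Oq_summable F K) auto

lemma Oq_seminorm_cmult:
  assumes F: "F \<in> Oq" and K: "compact K" "K \<subseteq> Ux" and r: "0 < r" "ereal r < ry"
  shows "Oq_seminorm K r (\<lambda>n z. c * F n z) \<le> cmod c * Oq_seminorm K r F"
proof -
  have "Oq_seminorm K r (\<lambda>n z. c * F n z) \<le> (\<Sum>n. cmod c * (supnorm K (F n) * r ^ n))"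
    unfolding Oq_seminorm_def
  proof (rule suminf_le)
    show "summable (\<lambda>n. supnorm K (\<lambda>z. c * F n z) * r ^ n)" by (rule Oq_summable[OF Oq_cmult[OF F] K r])
    show "summable (\<lambda>n. cmod c * (supnorm K (F n) * r ^ n))" by (intro summable_mult Oq_summable F K r)
    fix n
    show "supnorm K (\<lambda>z. c * F n z) * r ^ n \<le> cmod c * (supnorm K (F n) * r ^ n)"
      unfolding mult.assoc[symmetric]
      using supnorm_cmult[OF Oq_cont[OF F K(2)] K(1)] r by (intro mult_right_mono) auto
  qed
  then show ?thesis unfolding Oq_seminorm_def by (simp add: suminf_mult Oq_summable F K r)
qed

definition Oq_nbhd where
  "Oq_nbhd V F \<longleftrightarrow> (\<exists>K r d. compact K \<and> K \<subseteq> Ux \<and> 0 < r \<and> ereal r < ry \<and> 0 < d \<and>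
     {G\<in>Oq. Oq_seminorm K r (\<lambda>n z. G n z - F n z) < d} \<subseteq> V)"

lemma Oq_nbhd_mono: "Oq_nbhd V F \<Longrightarrow> V \<subseteq> V' \<Longrightarrow> Oq_nbhd V' F"
  unfolding Oq_nbhd_def by (meson subset_trans)

lemma Oq_nbhd_Int:
  assumes "Oq_nbhd V F" "Oq_nbhd V' F" and F: "F \<in> Oq"
  shows "Oq_nbhd (V \<inter> V') F"
proof -
  from assms(1) obtain K r d where 1: "compact K" "K \<subseteq> Ux" "0 < r" "ereal r < ry" "0 < d"
    and V: "{G\<in>Oq. Oq_seminorm K r (\<lambda>n z. G n z - F n z) < d} \<subseteq> V" unfolding Oq_nbhd_def by (elim exE conjE) (rule that)
  from assms(2) obtain K' r' d' where 2: "compact K'" "K' \<subseteq> Ux" "0 < r'" "ereal r' < ry" "0 < d'"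
    and V': "{G\<in>Oq. Oq_seminorm K' r' (\<lambda>n z. G n z - F n z) < d'} \<subseteq> V'" unfolding Oq_nbhd_def by (elim exE conjE) (rule that)
  show ?thesis unfolding Oq_nbhd_def
  proof (intro exI conjI)
    show "compact (K \<union> K')" "K \<union> K' \<subseteq> Ux" "0 < max r r'" "ereal (max r r') < ry" "0 < min d d'"
      using 1 2 by (auto simp: max_def)
    show "{G\<in>Oq. Oq_seminorm (K \<union> K') (max r r') (\<lambda>n z. G n z - F n z) < min d d'} \<subseteq> V \<inter> V'"
    proof
    fix G assume "G \<in> {G\<in>Oq. Oq_seminorm (K \<union> K') (max r r') (\<lambda>n z. G n z - F n z) < min d d'}"
    then have G: "G \<in> Oq" "Oq_seminorm (K \<union> K') (max r r') (\<lambda>n z. G n z - F n z) < min d d'" by auto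
    have m: "ereal (max r r') < ry" "compact (K \<union> K')" using 1 2 by (auto simp: max_def intro: compact_Un)
    have "Oq_seminorm K r (\<lambda>n z. G n z - F n z) < d"
      using Oq_seminorm_mono[OF Oq_diff[OF G(1) F], of "K \<union> K'" K r "max r r'"] 1 2 G(2) m by simp
    moreover have "Oq_seminorm K' r' (\<lambda>n z. G n z - F n z) < d'"
      using Oq_seminorm_mono[OF Oq_diff[OF G(1) F], of "K \<union> K'" K' r' "max r r'"] 1 2 G(2) m by simp
    ultimately show "G \<in> V \<inter> V'" using V V' G(1) by blast
    qed
  qed
qed

text \<open>The predicate inside \<open>topology\<close> describes the open sets only once it is
  known to satisfy the axioms; directedness of the seminorms gives closure under
  intersection.\<close>

lemma openin_Oq_top: "openin (Oq_top Ux ry) V \<longleftrightarrow> V \<subseteq> Oq \<and> (\<forall>F\<in>V. Oq_nbhd V F)"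
proof -
  define L where "L V \<longleftrightarrow> V \<subseteq> Oq \<and> (\<forall>F\<in>V. Oq_nbhd V F)" for V
  have "L (V \<inter> V')" if "L V" "L V'" for V V'
    using that Oq_nbhd_Int unfolding L_def by blast
  moreover have "L (\<Union>\<V>)" if \<V>: "\<forall>V\<in>\<V>. L V" for \<V>
    unfolding L_def
  proof (intro conjI ballI)
    show "\<Union>\<V> \<subseteq> Oq" using \<V> unfolding L_def by blast
    fix F assume "F \<in> \<Union>\<V>"
    then obtain V where "V \<in> \<V>" "F \<in> V" by blast
    then show "Oq_nbhd (\<Union>\<V>) F" using \<V> Oq_nbhd_mono[of V F "\<Union>\<V>"] unfolding L_def by blast
  qed
  ultimately have "istopology L" unfolding istopology_def by blast
  moreover have "Oq_top Ux ry = topology L" unfolding Oq_top_def L_def Oq_nbhd_def ..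
  ultimately show ?thesis by (simp add: topology_inverse' L_def)
qed

lemma topspace_Oq_top: "topspace (Oq_top Ux ry) = Oq"
proof -
  obtain r where r: "0 < ereal r" "ereal r < ry" using ereal_dense2[OF ry] by blast
  have "Oq_nbhd Oq F" for F
    unfolding Oq_nbhd_def by (intro exI[of _ "{}"] exI[of _ r] exI[of _ 1]) (use r in auto)
  then have "openin (Oq_top Ux ry) Oq" unfolding openin_Oq_top by simp
  then show ?thesis by (metis openin_Oq_top openin_subset openin_topspace subset_antisym)
qed

definition Oq_linear :: "((nat \<Rightarrow> complex \<Rightarrow> complex) \<Rightarrow> 'a::cbanach_algebra) \<Rightarrow> bool" where
  "Oq_linear \<Phi> \<longleftrightarrow> (\<forall>F\<in>Oq. \<forall>G\<in>Oq. \<Phi> (\<lambda>n z. F n z + G n z) = \<Phi> F + \<Phi> G) \<and>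
     (\<forall>F\<in>Oq. \<forall>c. \<Phi> (\<lambda>n z. c * F n z) = cscale c (\<Phi> F))"

definition Oq_bounded :: "((nat \<Rightarrow> complex \<Rightarrow> complex) \<Rightarrow> 'a::cbanach_algebra) \<Rightarrow> bool" where
  "Oq_bounded \<Phi> \<longleftrightarrow> (\<exists>K r C. compact K \<and> K \<subseteq> Ux \<and> 0 < r \<and> ereal r < ry \<and> 0 \<le> C \<and>
     (\<forall>F\<in>Oq. norm (\<Phi> F) \<le> C * Oq_seminorm K r F))"

lemma Oq_linearD:
  assumes "Oq_linear \<Phi>" "F \<in> Oq"
  shows "G \<in> Oq \<Longrightarrow> \<Phi> (\<lambda>n z. F n z + G n z) = \<Phi> F + \<Phi> G" "\<Phi> (\<lambda>n z. c * F n z) = cscale c (\<Phi> F)"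
    "G \<in> Oq \<Longrightarrow> \<Phi> (\<lambda>n z. F n z - G n z) = \<Phi> F - \<Phi> G"
proof -
  have 1: "\<Phi> (\<lambda>n z. F n z + G n z) = \<Phi> F + \<Phi> G" if "F \<in> Oq" "G \<in> Oq" for F G
    using assms(1) that unfolding Oq_linear_def by blast
  have 2: "\<Phi> (\<lambda>n z. c * F n z) = cscale c (\<Phi> F)" if "F \<in> Oq" for F c
    using assms(1) that unfolding Oq_linear_def by blast
  show "G \<in> Oq \<Longrightarrow> \<Phi> (\<lambda>n z. F n z + G n z) = \<Phi> F + \<Phi> G" "\<Phi> (\<lambda>n z. c * F n z) = cscale c (\<Phi> F)"
    by (rule 1[OF assms(2)], assumption, rule 2[OF assms(2)])
  show "\<Phi> (\<lambda>n z. F n z - G n z) = \<Phi> F - \<Phi> G" if "G \<in> Oq"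
    using 1[OF assms(2) Oq_cmult[OF that, of "-1"]] 2[OF that, of "-1"] by simp
qed

lemma continuous_imp_Oq_bounded:
  assumes lin: "Oq_linear \<Phi>" and cont: "continuous_map (Oq_top Ux ry) euclidean \<Phi>"
  shows "Oq_bounded \<Phi>"
proof -
  define Z :: "nat \<Rightarrow> complex \<Rightarrow> complex" where "Z = (\<lambda>_ _. 0)"
  have Z: "Z \<in> Oq" by (simp add: Z_def Oq_set_def)
  have \<Phi>Z: "\<Phi> Z = 0" using Oq_linearD(2)[OF lin Z, of 0] by (simp add: Z_def)
  have "openin (Oq_top Ux ry) {F \<in> Oq. \<Phi> F \<in> ball 0 1}"
    using openin_continuous_map_preimage[OF cont, of "ball 0 1"] by (simp add: topspace_Oq_top)
  then have "Oq_nbhd {F \<in> Oq. \<Phi> F \<in> ball 0 1} Z"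
    unfolding openin_Oq_top using Z \<Phi>Z by simp
  then obtain K r d where K: "compact K" "K \<subseteq> Ux" and r: "0 < r" "ereal r < ry" and d: "0 < d"
    and V: "{G\<in>Oq. Oq_seminorm K r (\<lambda>n z. G n z - Z n z) < d} \<subseteq> {F \<in> Oq. \<Phi> F \<in> ball 0 1}"
    unfolding Oq_nbhd_def by (elim exE conjE) (rule that)
  have small: "norm (\<Phi> G) < 1" if "G \<in> Oq" "Oq_seminorm K r G < d" for G
    using V that by (auto simp: Z_def)
  show ?thesis unfolding Oq_bounded_def
  proof (intro exI conjI ballI)
    show "compact K" "K \<subseteq> Ux" "0 < r" "ereal r < ry" "0 \<le> 2 / d" using K r d by auto
    fix F assume F: "F \<in> Oq"
    note s0 = Oq_seminorm_nonneg[OF F K r]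
    show "norm (\<Phi> F) \<le> 2 / d * Oq_seminorm K r F"
    proof (rule field_le_epsilon)
      fix e :: real assume e: "0 < e"
      \<comment> \<open>The seminorm of \<open>F\<close> may vanish, so a positive term is added
        before dividing by it; in the final estimate it costs \<open>e / 2\<close>.\<close>
      define s where "s = Oq_seminorm K r F + e * d / 2"
      have s: "0 < s" "Oq_seminorm K r F < s" using s0 e d by (auto simp: s_def add_nonneg_pos)
      define t where "t = d / s"
      have t: "0 < t" using d s by (simp add: t_def)
      have "Oq_seminorm K r (\<lambda>n z. of_real t * F n z) \<le> t * Oq_seminorm K r F"
        using Oq_seminorm_cmult[OF F K r, of "of_real t"] t by simp
      also have "\<dots> < t * s" using s t by simp
      also have "\<dots> = d" using s by (simp add: t_def)
      finally have "norm (\<Phi> (\<lambda>n z. of_real t * F n z)) < 1" using small[OF Oq_cmult[OF F]] by blast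
      then have "t * norm (\<Phi> F) < 1" using Oq_linearD(2)[OF lin F] t by (simp add: norm_cscale)
      then have "norm (\<Phi> F) < s / d" using s d by (simp add: t_def field_simps)
      also have "s / d = Oq_seminorm K r F / d + e / 2" using d by (simp add: s_def add_divide_distrib)
      also have "\<dots> \<le> 2 / d * Oq_seminorm K r F + e"
        using s0 d e by (intro add_mono) (auto simp: field_simps)
      finally show "norm (\<Phi> F) \<le> 2 / d * Oq_seminorm K r F + e" by simp
    qed
  qed
qed

lemma Oq_bounded_imp_continuous:
  assumes lin: "Oq_linear \<Phi>" and bd: "Oq_bounded \<Phi>"
  shows "continuous_map (Oq_top Ux ry) euclidean \<Phi>"
  unfolding continuous_map_def topspace_Oq_top
proof (intro conjI allI impI)
  show "\<Phi> \<in> Oq \<rightarrow> topspace euclidean" by simp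
  fix W :: "'a set" assume "openin euclidean W"
  then have W: "open W" by simp
  from bd obtain K r C where K: "compact K" "K \<subseteq> Ux" and r: "0 < r" "ereal r < ry" and C: "0 \<le> C"
    and b: "\<forall>F\<in>Oq. norm (\<Phi> F) \<le> C * Oq_seminorm K r F" unfolding Oq_bounded_def by (elim exE conjE) (rule that)
  show "openin (Oq_top Ux ry) {F \<in> Oq. \<Phi> F \<in> W}" unfolding openin_Oq_top
  proof (intro conjI ballI)
    fix F assume "F \<in> {F \<in> Oq. \<Phi> F \<in> W}"
    then have F: "F \<in> Oq" "\<Phi> F \<in> W" by auto
    obtain e where e: "0 < e" "ball (\<Phi> F) e \<subseteq> W" using W F(2) open_contains_ball by blast
    show "Oq_nbhd {F \<in> Oq. \<Phi> F \<in> W} F" unfolding Oq_nbhd_def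
    proof (intro exI conjI)
      \<comment> \<open>\<open>C + 1\<close> replaces \<open>C\<close> to cover the case
        \<open>C = 0\<close>.\<close>
      show "compact K" "K \<subseteq> Ux" "0 < r" "ereal r < ry" "0 < e / (C + 1)" using K r C e by auto
      show "{G \<in> Oq. Oq_seminorm K r (\<lambda>n z. G n z - F n z) < e / (C + 1)} \<subseteq> {F \<in> Oq. \<Phi> F \<in> W}"
      proof
      fix G assume "G \<in> {G \<in> Oq. Oq_seminorm K r (\<lambda>n z. G n z - F n z) < e / (C + 1)}"
      then have G: "G \<in> Oq" "Oq_seminorm K r (\<lambda>n z. G n z - F n z) < e / (C + 1)" by auto
      have "norm (\<Phi> G - \<Phi> F) \<le> C * Oq_seminorm K r (\<lambda>n z. G n z - F n z)"
        using b Oq_diff[OF G(1) F(1)] Oq_linearD(3)[OF lin G(1) F(1)] by metis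
      also have "\<dots> \<le> C * (e / (C + 1))" using G(2) C by (intro mult_left_mono) auto
      also have "\<dots> < e" using C e(1) by (simp add: field_simps)
      finally have "\<Phi> G \<in> ball (\<Phi> F) e" by (simp add: dist_norm norm_minus_commute)
      then show "G \<in> {F \<in> Oq. \<Phi> F \<in> W}" using e(2) G(1) by blast
      qed
    qed
  qed auto
qed

text \<open>The element \<open>f(x) y^m\<close>, cut off outside \<open>Ux\<close> as the
  normalisation in \<open>Oq_set\<close> demands.\<close>

definition Oq_monom :: "nat \<Rightarrow> (complex \<Rightarrow> complex) \<Rightarrow> nat \<Rightarrow> complex \<Rightarrow> complex" where
  "Oq_monom m f = (\<lambda>n z. if n = m \<and> z \<in> Ux then f z else 0)"

lemma Oq_gens_monom: "Oq_one Ux = Oq_monom 0 (\<lambda>_. 1)" "Oq_x Ux = Oq_monom 0 (\<lambda>z. z)" "Oq_y Ux = Oq_monom 1 (\<lambda>_. 1)"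
  by (auto simp: Oq_one_def Oq_x_def Oq_y_def Oq_monom_def fun_eq_iff)

lemma supnorm_Oq_monom:
  assumes "K \<subseteq> Ux" shows "supnorm K (Oq_monom m f n) = (if n = m then supnorm K f else 0)"
proof (cases "n = m")
  case True
  then show ?thesis using assms by (auto simp: Oq_monom_def intro!: supnorm_cong)
next
  case False
  then have "Oq_monom m f n = (\<lambda>_. 0)" by (auto simp: Oq_monom_def)
  then show ?thesis using False by simp
qed

lemma Oq_monom_sums:
  assumes "K \<subseteq> Ux" shows "(\<lambda>n. supnorm K (Oq_monom m f n) * r ^ n) sums (supnorm K f * r ^ m)"
proof -
  have "(\<lambda>n. supnorm K (Oq_monom m f n) * r ^ n) = (\<lambda>n. if n = m then supnorm K f * r ^ n else 0)"
    using supnorm_Oq_monom[OF assms] by auto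
  then show ?thesis using sums_single[of m "\<lambda>n. supnorm K f * r ^ n"] by simp
qed

lemma Oq_monom_in: assumes f: "f holomorphic_on Ux" shows "Oq_monom m f \<in> Oq"
  unfolding Oq_set_def
proof (intro CollectI conjI allI impI)
  fix n
  show "Oq_monom m f n holomorphic_on Ux"
  proof (cases "n = m")
    case True
    then show ?thesis using holomorphic_transform[OF f, of "Oq_monom m f n"] by (simp add: Oq_monom_def)
  next
    case False
    then have "Oq_monom m f n = (\<lambda>_. 0)" by (auto simp: Oq_monom_def)
    then show ?thesis by simp
  qed
next
  show "summable (\<lambda>n. supnorm K (Oq_monom m f n) * r ^ n)" if "K \<subseteq> Ux" for K r
    using sums_summable[OF Oq_monom_sums[OF that]] .
qed (simp add: Oq_monom_def)

text \<open>The rule \<open>y^m g(x) = g(q^m x) y^m\<close>. Since \<open>Ux\<close> is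
  \<open>q\<close>-open, the cut-off of the second factor is not met at \<open>q ^ m * z\<close>
  when \<open>z\<close> is in \<open>Ux\<close>.\<close>

lemma Oq_mult_monom:
  "Oq_mult q (Oq_monom m f) (Oq_monom n g) = Oq_monom (m + n) (\<lambda>z. f z * g (q ^ m * z))"
proof (intro ext)
  fix N z
  have "Oq_mult q (Oq_monom m f) (Oq_monom n g) N z =
      (\<Sum>i\<le>N. if i = m then f z * (if N - m = n \<and> z \<in> Ux then g (q ^ m * z) else 0) else 0)"
    unfolding Oq_mult_def by (rule sum.cong) (auto simp: Oq_monom_def q_Ux)
  also have "\<dots> = Oq_monom (m + n) (\<lambda>z. f z * g (q ^ m * z)) N z"
    by (auto simp: Oq_monom_def)
  finally show "Oq_mult q (Oq_monom m f) (Oq_monom n g) N z = Oq_monom (m + n) (\<lambda>z. f z * g (q ^ m * z)) N z" .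
qed

lemma Oq_mult_monom0: "Oq_mult q (Oq_monom 0 f) (Oq_monom n g) = Oq_monom n (\<lambda>z. f z * g z)"
  using Oq_mult_monom[of 0 f n g] by simp

end

section \<open>Consequences of a continuous homomorphism\<close>

locale Oq_hom = Oq_algebra +
  fixes T S :: "'a::cbanach_algebra" and \<Phi>
  assumes is_ext: "Oq_ext q Ux ry T S \<Phi>"
begin

lemma \<Phi>_linear: "Oq_linear \<Phi>"
  using is_ext unfolding Oq_ext_def Oq_linear_def by simp

lemma \<Phi>_bounded: "Oq_bounded \<Phi>"
  using is_ext unfolding Oq_ext_def by (intro continuous_imp_Oq_bounded[OF \<Phi>_linear]) simp

lemma \<Phi>_mult: "F \<in> Oq \<Longrightarrow> G \<in> Oq \<Longrightarrow> \<Phi> (Oq_mult q F G) = \<Phi> F * \<Phi> G"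
  and \<Phi>_gens: "\<Phi> (Oq_monom 0 (\<lambda>_. 1)) = 1" "\<Phi> (Oq_monom 0 (\<lambda>z. z)) = T" "\<Phi> (Oq_monom 1 (\<lambda>_. 1)) = S"
  using is_ext unfolding Oq_ext_def Oq_gens_monom by auto

lemma module_map_\<Phi>: "module_map Ux T (\<lambda>f. \<Phi> (Oq_monom 0 f))"
  unfolding module_map_def
proof (intro conjI allI impI)
  fix f g assume "f holomorphic_on Ux" "g holomorphic_on Ux"
  then have "\<Phi> (\<lambda>n z. Oq_monom 0 f n z + Oq_monom 0 g n z) = \<Phi> (Oq_monom 0 f) + \<Phi> (Oq_monom 0 g)"
    using Oq_linearD(1)[OF \<Phi>_linear] Oq_monom_in by blast
  moreover have "(\<lambda>n z. Oq_monom 0 f n z + Oq_monom 0 g n z) = Oq_monom 0 (\<lambda>z. f z + g z)"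
    by (auto simp: Oq_monom_def fun_eq_iff)
  ultimately show "\<Phi> (Oq_monom 0 (\<lambda>z. f z + g z)) = \<Phi> (Oq_monom 0 f) + \<Phi> (Oq_monom 0 g)" by simp
next
  fix f c assume "f holomorphic_on Ux"
  then have "\<Phi> (\<lambda>n z. c * Oq_monom 0 f n z) = cscale c (\<Phi> (Oq_monom 0 f))"
    using Oq_linearD(2)[OF \<Phi>_linear] Oq_monom_in by blast
  moreover have "(\<lambda>n z. c * Oq_monom 0 f n z) = Oq_monom 0 (\<lambda>z. c * f z)"
    by (auto simp: Oq_monom_def fun_eq_iff)
  ultimately show "\<Phi> (Oq_monom 0 (\<lambda>z. c * f z)) = cscale c (\<Phi> (Oq_monom 0 f))" by simp
next
  fix f assume f: "f holomorphic_on Ux"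
  have "\<Phi> (Oq_mult q (Oq_monom 0 (\<lambda>z. z)) (Oq_monom 0 f)) = T * \<Phi> (Oq_monom 0 f)"
    using \<Phi>_mult[OF Oq_monom_in Oq_monom_in[OF f], of "\<lambda>z. z"] \<Phi>_gens(2) by (simp add: holomorphic_on_id[unfolded id_def])
  then show "\<Phi> (Oq_monom 0 (\<lambda>z. z * f z)) = T * \<Phi> (Oq_monom 0 f)" by (simp add: Oq_mult_monom0)
next
  from \<Phi>_bounded obtain K r C where K: "compact K" "K \<subseteq> Ux" and r: "0 < r" "ereal r < ry" and C: "0 \<le> C"
    and b: "\<forall>F\<in>Oq. norm (\<Phi> F) \<le> C * Oq_seminorm K r F" unfolding Oq_bounded_def by (elim exE conjE) (rule that)
  show "\<exists>K L. compact K \<and> K \<subseteq> Ux \<and> 0 \<le> L \<and>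
      (\<forall>f B. f holomorphic_on Ux \<longrightarrow> (\<forall>z\<in>K. cmod (f z) \<le> B) \<longrightarrow> norm (\<Phi> (Oq_monom 0 f)) \<le> L * B)"
  proof (intro exI conjI allI impI)
    \<comment> \<open>The added point makes the compact set nonempty, which forces
      \<open>0 \<le> B\<close>, as \<open>supnorm_le\<close> demands.\<close>
    show "compact (insert 0 K)" "insert 0 K \<subseteq> Ux" "0 \<le> C" using K C zero_Ux by auto
    fix f B assume f: "f holomorphic_on Ux" and B: "\<forall>z\<in>insert 0 K. cmod (f z) \<le> B"
    have "norm (\<Phi> (Oq_monom 0 f)) \<le> C * Oq_seminorm K r (Oq_monom 0 f)" using b Oq_monom_in[OF f] by blast
    also have "Oq_seminorm K r (Oq_monom 0 f) = supnorm K f"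
      unfolding Oq_seminorm_def using sums_unique[OF Oq_monom_sums[OF K(2), of 0 f r]] by simp
    also have "C * supnorm K f \<le> C * B"
    proof (intro mult_left_mono supnorm_le)
      show "0 \<le> B" using B norm_ge_zero[of "f 0"] by (meson insertI1 order_trans)
    qed (use B C in auto)
    finally show "norm (\<Phi> (Oq_monom 0 f)) \<le> C * B" .
  qed
qed

lemma bspec_T: "bspec T \<subseteq> Ux"
proof
  fix w assume w: "w \<in> bspec T"
  show "w \<in> Ux"
  proof (rule ccontr)
    assume nw: "w \<notin> Ux"
    have h: "(\<lambda>z. 1 / (z - w)) holomorphic_on Ux" "(\<lambda>z. z + (- w) * 1) holomorphic_on Ux"
      using nw by (auto intro!: holomorphic_intros)
    note M = module_map_\<Phi>
    have T: "\<Phi> (Oq_monom 0 (\<lambda>z. z + (- w) * 1)) = T - cscale w 1"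
      using module_mapD(1)[OF M, of "\<lambda>z. z" "\<lambda>z. (- w) * 1"] module_mapD(2)[OF M, of "\<lambda>_. 1" "- w"] \<Phi>_gens
      by (simp add: holomorphic_on_id[unfolded id_def])
    have e: "Oq_monom 0 (\<lambda>z. (z + (- w) * 1) * (1 / (z - w))) = Oq_monom 0 (\<lambda>_. 1)"
      "Oq_monom 0 (\<lambda>z. (1 / (z - w)) * (z + (- w) * 1)) = Oq_monom 0 (\<lambda>_. 1)"
      using nw by (auto simp: Oq_monom_def fun_eq_iff)
    have "(T - cscale w 1) * \<Phi> (Oq_monom 0 (\<lambda>z. 1 / (z - w))) = 1"
      using \<Phi>_mult[OF Oq_monom_in[OF h(2), of 0] Oq_monom_in[OF h(1), of 0]] unfolding Oq_mult_monom0 e \<Phi>_gens T by simp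
    moreover have "\<Phi> (Oq_monom 0 (\<lambda>z. 1 / (z - w))) * (T - cscale w 1) = 1"
      using \<Phi>_mult[OF Oq_monom_in[OF h(1), of 0] Oq_monom_in[OF h(2), of 0]] unfolding Oq_mult_monom0 e \<Phi>_gens T by simp
    ultimately show False using w unfolding bspec_def ainvertible_def by blast
  qed
qed

text \<open>If \<open>ry \<le> cmod w\<close>, the inverse of \<open>y - w\<close> is the geometric
  series with coefficients \<open>- 1 / w^(n+1)\<close>, which converges for every radius below
  \<open>ry\<close>. Constant coefficients commute with \<open>y\<close>, so it is an inverse on
  both sides.\<close>

lemma bspec_S:
  assumes w: "w \<in> bspec S" shows "ereal (cmod w) < ry"
proof (rule ccontr)
  assume "\<not> ereal (cmod w) < ry"
  then have wr: "ry \<le> ereal (cmod w)" by simp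
  then have w0: "w \<noteq> 0" using ry by (auto simp flip: zero_ereal_def)
  define Y where "Y = (\<lambda>n z. Oq_monom 1 (\<lambda>_. 1) n z + (- w) * Oq_monom 0 (\<lambda>_. 1) n z)"
  define G where "G = (\<lambda>n z. if z \<in> Ux then - (1 / w ^ Suc n) else (0::complex))"
  have in1: "Oq_monom n (\<lambda>_. 1) \<in> Oq" for n by (rule Oq_monom_in) simp
  have Y: "Y \<in> Oq" unfolding Y_def by (intro Oq_add Oq_cmult in1)
  have \<Phi>Y: "\<Phi> Y = S - cscale w 1"
    unfolding Y_def using Oq_linearD(1)[OF \<Phi>_linear in1[of 1] Oq_cmult[OF in1[of 0], of "- w"]]
      Oq_linearD(2)[OF \<Phi>_linear in1[of 0], of "- w"] \<Phi>_gens by simp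
  have G: "G \<in> Oq" unfolding Oq_set_def
  proof (intro CollectI conjI allI impI)
    fix n
    have "(\<lambda>_. - (1 / w ^ Suc n)) holomorphic_on Ux" by simp
    then show "G n holomorphic_on Ux" by (rule holomorphic_transform) (simp add: G_def)
  next
    fix K r assume K: "compact K" "K \<subseteq> Ux" and r: "0 < r" "ereal r < ry"
    have "r < cmod w" using less_le_trans[OF r(2) wr] by simp
    then have "summable (\<lambda>n. 1 / cmod w * (r / cmod w) ^ n)"
      using r w0 by (intro summable_mult summable_geometric) auto
    then show "summable (\<lambda>n. supnorm K (G n) * r ^ n)"
    proof (rule summable_comparison_test')
      fix n :: nat assume "0 \<le> n"
      have c: "continuous_on K (G n)"
        by (rule continuous_on_eq[of _ "\<lambda>_. - (1 / w ^ Suc n)"]) (use K in \<open>auto simp: G_def\<close>)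
      have "supnorm K (G n) \<le> 1 / cmod w ^ Suc n"
        by (rule supnorm_le) (use K in \<open>auto simp: G_def norm_divide norm_power norm_mult\<close>)
      then have "supnorm K (G n) * r ^ n \<le> 1 / cmod w ^ Suc n * r ^ n"
        using r by (intro mult_right_mono) auto
      also have "\<dots> = 1 / cmod w * (r / cmod w) ^ n" by (simp add: power_divide)
      finally show "norm (supnorm K (G n) * r ^ n) \<le> 1 / cmod w * (r / cmod w) ^ n"
        using supnorm_nonneg[OF c K(1)] r by simp
    qed
  qed (simp add: G_def)
  have "Oq_mult q Y G = Oq_monom 0 (\<lambda>_. 1)"
  proof (intro ext)
    fix N z
    have "Oq_mult q Y G N z = (\<Sum>i\<le>N. (if i = 0 then - w * G N z else 0) + (if i = 1 then G (N - 1) z else 0))"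
      unfolding Oq_mult_def using q_Ux[of z 1] by (intro sum.cong) (auto simp: Y_def Oq_monom_def G_def)
    also have "\<dots> = Oq_monom 0 (\<lambda>_. 1) N z"
      unfolding sum.distrib using w0 by (cases N) (auto simp: G_def Oq_monom_def)
    finally show "Oq_mult q Y G N z = Oq_monom 0 (\<lambda>_. 1) N z" .
  qed
  then have 1: "(S - cscale w 1) * \<Phi> G = 1" using \<Phi>_mult[OF Y G] \<Phi>_gens \<Phi>Y by simp
  have "Oq_mult q G Y = Oq_monom 0 (\<lambda>_. 1)"
  proof (intro ext)
    fix N z
    \<comment> \<open>For \<open>N = 0\<close> the truncated difference \<open>N - 1\<close> is
      \<open>0\<close>, so the inner \<open>if\<close> has to suppress the second term.\<close>
    have "Oq_mult q G Y N z = (\<Sum>i\<le>N. (if i = N then - w * G N z else 0) + (if i = N - 1 then (if N = 0 then 0 else G (N - 1) z) else 0))"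
      unfolding Oq_mult_def using q_Ux[of z] by (intro sum.cong) (auto simp: Y_def Oq_monom_def G_def)
    also have "\<dots> = Oq_monom 0 (\<lambda>_. 1) N z"
      unfolding sum.distrib using w0 by (cases N) (auto simp: G_def Oq_monom_def)
    finally show "Oq_mult q G Y N z = Oq_monom 0 (\<lambda>_. 1) N z" .
  qed
  then have "\<Phi> G * (S - cscale w 1) = 1" using \<Phi>_mult[OF G Y] \<Phi>_gens \<Phi>Y by simp
  with 1 show False using w unfolding bspec_def ainvertible_def by blast
qed

lemma \<Phi>_y_power: "\<Phi> (Oq_monom n (\<lambda>_. 1)) = S ^ n"
proof (induction n)
  case (Suc n)
  have in1: "Oq_monom n (\<lambda>_. 1) \<in> Oq" for n by (rule Oq_monom_in) simp
  have "\<Phi> (Oq_mult q (Oq_monom 1 (\<lambda>_. 1)) (Oq_monom n (\<lambda>_. 1))) = S * S ^ n"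
    using \<Phi>_mult[OF in1[of 1] in1[of n]] \<Phi>_gens Suc by simp
  then show ?case by (simp add: Oq_mult_monom)
qed (simp add: \<Phi>_gens)

lemma \<Phi>_monom:
  assumes f: "f holomorphic_on Ux" shows "\<Phi> (Oq_monom n f) = hfc Ux f T * S ^ n"
proof -
  have "\<Phi> (Oq_mult q (Oq_monom 0 f) (Oq_monom n (\<lambda>_. 1))) = \<Phi> (Oq_monom 0 f) * S ^ n"
    using \<Phi>_mult[OF Oq_monom_in[OF f] Oq_monom_in] \<Phi>_y_power by simp
  moreover have "\<Phi> (Oq_monom 0 f) = hfc Ux f T"
    using hfc_unique[OF open_Ux bspec_T module_map_\<Phi> f] \<Phi>_gens by simp
  ultimately show ?thesis by (simp add: Oq_mult_monom0)
qed

text \<open>\<open>\<Phi>\<close> is bounded by a single seminorm, in which the truncations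
  \<open>P N\<close> tend to \<open>F\<close>: the error is the tail of the convergent series
  defining that seminorm. Convergence of the series in the algebra is part of the result.\<close>

lemma \<Phi>_eq:
  assumes F: "F \<in> Oq" shows "\<Phi> F = (\<Sum>n. hfc Ux (F n) T * S ^ n)"
proof -
  from \<Phi>_bounded obtain K r C where K: "compact K" "K \<subseteq> Ux" and r: "0 < r" "ereal r < ry" and C: "0 \<le> C"
    and b: "\<forall>F\<in>Oq. norm (\<Phi> F) \<le> C * Oq_seminorm K r F" unfolding Oq_bounded_def by (elim exE conjE) (rule that)
  define P where "P N = (\<lambda>n z. if n < N then F n z else 0)" for N
  have P_Suc: "P (Suc N) = (\<lambda>n z. P N n z + Oq_monom N (F N) n z)" for N
    using Oq_outside[OF F] by (auto simp: P_def Oq_monom_def fun_eq_iff less_Suc_eq)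
  have P: "P N \<in> Oq \<and> \<Phi> (P N) = (\<Sum>n<N. hfc Ux (F n) T * S ^ n)" for N
  proof (induction N)
    case 0
    have "P 0 = (\<lambda>n z. 0 * F n z)" by (simp add: P_def)
    then show ?case using Oq_cmult[OF F, of 0] Oq_linearD(2)[OF \<Phi>_linear F, of 0] by simp
  next
    case (Suc N)
    note m = Oq_monom_in[OF Oq_hol[OF F]]
    have PN: "P N \<in> Oq" using Suc by simp
    have "\<Phi> (P (Suc N)) = \<Phi> (P N) + \<Phi> (Oq_monom N (F N))"
      unfolding P_Suc by (rule Oq_linearD(1)[OF \<Phi>_linear PN m])
    moreover have "P (Suc N) \<in> Oq" unfolding P_Suc by (rule Oq_add[OF PN m])
    ultimately show ?case using Suc \<Phi>_monom[OF Oq_hol[OF F]] by simp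
  qed
  let ?a = "\<lambda>n. supnorm K (F n) * r ^ n"
  have sm: "summable ?a" by (rule Oq_summable[OF F K r])
  have tail: "Oq_seminorm K r (\<lambda>n z. F n z - P N n z) = suminf ?a - sum ?a {..<N}" for N
  proof -
    have "(\<lambda>n. supnorm K (\<lambda>z. F n z - P N n z) * r ^ n) = (\<lambda>n. ?a n - (if n < N then ?a n else 0))"
      by (auto simp: P_def fun_eq_iff)
    moreover have "(\<lambda>n. ?a n - (if n < N then ?a n else 0)) sums (suminf ?a - sum ?a {..<N})"
      by (intro sums_diff summable_sums[OF sm]) (use sums_If_finite_set[of "{..<N}" ?a] in simp)
    ultimately have "(\<lambda>n. supnorm K (\<lambda>z. F n z - P N n z) * r ^ n) sums (suminf ?a - sum ?a {..<N})" by simp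
    then show ?thesis unfolding Oq_seminorm_def by (rule sums_unique[symmetric])
  qed
  have "(\<lambda>N. C * (suminf ?a - sum ?a {..<N})) \<longlonglongrightarrow> C * (suminf ?a - suminf ?a)"
    by (intro tendsto_intros summable_LIMSEQ[OF sm])
  then have lim: "(\<lambda>N. C * (suminf ?a - sum ?a {..<N})) \<longlonglongrightarrow> 0" by simp
  have "norm (\<Phi> F - (\<Sum>n<N. hfc Ux (F n) T * S ^ n)) \<le> C * (suminf ?a - sum ?a {..<N})" for N
  proof -
    have "\<Phi> F - (\<Sum>n<N. hfc Ux (F n) T * S ^ n) = \<Phi> (\<lambda>n z. F n z - P N n z)"
      using P[of N] Oq_linearD(3)[OF \<Phi>_linear F, of "P N"] by simp
    moreover have "(\<lambda>n z. F n z - P N n z) \<in> Oq" using Oq_diff[OF F, of "P N"] P[of N] by blast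
    then have "norm (\<Phi> (\<lambda>n z. F n z - P N n z)) \<le> C * Oq_seminorm K r (\<lambda>n z. F n z - P N n z)" using b by blast
    ultimately show ?thesis unfolding tail[of N] by simp
  qed
  then have "(\<lambda>N. \<Phi> F - (\<Sum>n<N. hfc Ux (F n) T * S ^ n)) \<longlonglongrightarrow> 0"
    by (intro Lim_null_comparison[OF always_eventually lim] allI)
  then have "(\<lambda>N. \<Sum>n<N. hfc Ux (F n) T * S ^ n) \<longlonglongrightarrow> \<Phi> F"
    using tendsto_diff[OF tendsto_const[of "\<Phi> F"], of "\<lambda>N. \<Phi> F - (\<Sum>n<N. hfc Ux (F n) T * S ^ n)" 0] by simp
  then have "(\<lambda>n. hfc Ux (F n) T * S ^ n) sums \<Phi> F" by (simp only: sums_def)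
  then show ?thesis by (rule sums_unique)
qed

end

section \<open>Construction of the extension\<close>

text \<open>Compactness turns the pointwise strict bound into one radius strictly between the
  spectrum and \<open>ry\<close>: the power estimate needs the lower side, the seminorm the upper
  one.\<close>

lemma compact_spectral_radius:
  assumes ry: "0 < (ry::ereal)" and sp: "\<forall>w\<in>bspec (S::'a::cbanach_algebra). ereal (cmod w) < ry"
  obtains r where "0 < r" "ereal r < ry" "\<forall>w\<in>bspec S. cmod w < r"
proof (cases "bspec S = {}")
  case True
  obtain r where "0 < ereal r" "ereal r < ry" using ereal_dense2[OF ry] by blast
  then show ?thesis using that[of r] True by simp
next
  case False
  obtain v where v: "v \<in> bspec S" "\<forall>w\<in>bspec S. cmod w \<le> cmod v"
    using continuous_attains_sup[OF compact_bspec[of S] False, of cmod] continuous_on_norm_id by blast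
  obtain r where r: "ereal (cmod v) < ereal r" "ereal r < ry" using ereal_dense2 sp v(1) by blast
  have "cmod v < r" using r(1) by simp
  then have "0 < r" "\<forall>w\<in>bspec S. cmod w < r" using v(2) norm_ge_zero[of v] by (auto simp del: norm_ge_zero)
  then show ?thesis using that r(2) by blast
qed

context Oq_algebra
begin

text \<open>One seminorm, with \<open>K\<close> from the bound on \<open>f \<mapsto> f(T)\<close>
  and \<open>r\<close> from the powers of \<open>S\<close>, dominates the series term by term and so
  yields both absolute convergence and continuity. Multiplicativity is the Cauchy product, once
  \<open>S ^ i\<close> has been moved past the functions of \<open>T\<close>.\<close>

lemma Oq_ext_hfc:
  fixes T S :: "'a::cbanach_algebra"
  assumes ST: "S * T = cscale q (T * S)" and TU: "bspec T \<subseteq> Ux" and SU: "\<forall>w\<in>bspec S. ereal (cmod w) < ry"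
  shows "Oq_ext q Ux ry T S (\<lambda>F. \<Sum>n. hfc Ux (F n) T * S ^ n)"
proof -
  note M = module_map_hfc[OF open_Ux TU]
  obtain r where r: "0 < r" "ereal r < ry" "\<forall>w\<in>bspec S. cmod w < r"
    by (rule compact_spectral_radius[OF ry SU])
  obtain C where C: "0 \<le> C" "\<forall>n. norm (S ^ n) \<le> C * r ^ n" using power_norm_bound[OF r(1)] r(3) by blast
  from module_map_bound[OF M] obtain K L where K: "compact K" "K \<subseteq> Ux" "0 \<le> L"
    and L: "\<forall>f B. f holomorphic_on Ux \<longrightarrow> (\<forall>z\<in>K. cmod (f z) \<le> B) \<longrightarrow> norm (hfc Ux f T) \<le> L * B"
    by (elim exE conjE) (rule that)
  define a where "a F n = hfc Ux (F n) T * S ^ n" for F :: "nat \<Rightarrow> complex \<Rightarrow> complex" and n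
  define \<Phi> where "\<Phi> F = (\<Sum>n. a F n)" for F
  have an: "norm (a F n) \<le> L * C * (supnorm K (F n) * r ^ n)" if F: "F \<in> Oq" for F n
  proof -
    note c = Oq_cont[OF F K(2), of n]
    have "norm (hfc Ux (F n) T) \<le> L * supnorm K (F n)"
      using L Oq_hol[OF F] supnorm_ge[OF c K(1)] by blast
    then have "norm (hfc Ux (F n) T) * norm (S ^ n) \<le> (L * supnorm K (F n)) * (C * r ^ n)"
      using C(2) K(3) supnorm_nonneg[OF c K(1)] by (intro mult_mono) auto
    then show ?thesis using norm_mult_ineq[of "hfc Ux (F n) T" "S ^ n"] by (simp add: a_def mult_ac)
  qed
  have maj: "summable (\<lambda>n. L * C * (supnorm K (F n) * r ^ n))" if F: "F \<in> Oq" for F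
    by (intro summable_mult Oq_summable F K r)
  have nsum: "summable (\<lambda>n. norm (a F n))" if F: "F \<in> Oq" for F
    by (rule summable_comparison_test'[OF maj[OF F]]) (use an[OF F] in simp)
  note sum = summable_norm_cancel[OF nsum]
  have lin: "Oq_linear \<Phi>" unfolding Oq_linear_def
  proof (intro conjI ballI allI)
    fix F G assume F: "F \<in> Oq" and G: "G \<in> Oq"
    have "a (\<lambda>n z. F n z + G n z) = (\<lambda>n. a F n + a G n)"
      using module_mapD(1)[OF M Oq_hol[OF F] Oq_hol[OF G]] by (auto simp: a_def distrib_right)
    then show "\<Phi> (\<lambda>n z. F n z + G n z) = \<Phi> F + \<Phi> G"
      unfolding \<Phi>_def using suminf_add[OF sum[OF F] sum[OF G]] by simp
  next
    fix F c assume F: "F \<in> Oq"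
    have "a (\<lambda>n z. c * F n z) = (\<lambda>n. cscale c (a F n))"
      using module_mapD(2)[OF M Oq_hol[OF F]] by (auto simp: a_def cscale_mult_left)
    then show "\<Phi> (\<lambda>n z. c * F n z) = cscale c (\<Phi> F)"
      unfolding \<Phi>_def using bounded_linear.suminf[OF cscale.bounded_linear_right sum[OF F], of c] by simp
  qed
  have bd: "Oq_bounded \<Phi>" unfolding Oq_bounded_def
  proof (intro exI conjI ballI)
    show "compact K" "K \<subseteq> Ux" "0 < r" "ereal r < ry" "0 \<le> L * C" using K r C by auto
    fix F assume F: "F \<in> Oq"
    have "norm (\<Phi> F) \<le> (\<Sum>n. L * C * (supnorm K (F n) * r ^ n))"
      unfolding \<Phi>_def by (rule norm_suminf_le[OF an[OF F] maj[OF F]])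
    then show "norm (\<Phi> F) \<le> L * C * Oq_seminorm K r F"
      unfolding Oq_seminorm_def using suminf_mult[OF Oq_summable[OF F K(1,2) r(1,2)], of "L * C"] by simp
  qed
  have SnT: "S ^ n * T = cscale (q ^ n) (T * S ^ n)" for n
  proof (induction n)
    case (Suc n)
    have "S ^ Suc n * T = S * (S ^ n * T)" by (simp add: mult.assoc)
    also have "\<dots> = cscale (q ^ n) ((S * T) * S ^ n)" by (simp add: Suc cscale_mult_right mult.assoc)
    also have "\<dots> = cscale (q ^ Suc n) (T * S ^ Suc n)"
      by (simp add: ST cscale_mult_left cscale_assoc mult.assoc mult.commute)
    finally show ?case .
  qed simp
  have gq: "(\<lambda>z. f (q ^ n * z)) holomorphic_on Ux" if "f holomorphic_on Ux" for f n
  proof -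
    have "f \<circ> (\<lambda>z. q ^ n * z) holomorphic_on Ux"
      by (rule holomorphic_on_compose_gen[OF _ that]) (use q_Ux in \<open>auto intro!: holomorphic_intros\<close>)
    then show ?thesis by (simp add: o_def)
  qed
  \<comment> \<open>The intertwining relation is used with \<open>S ^ n\<close> and
    \<open>q ^ n\<close> in place of \<open>S\<close> and \<open>q\<close>.\<close>
  have swap: "S ^ n * hfc Ux g T = hfc Ux (\<lambda>z. g (q ^ n * z)) T * S ^ n" if "g holomorphic_on Ux" for g n
    by (rule hfc_intertwine[OF open_Ux TU _ q_Ux SnT that]) (use q0 in auto)
  have hfc_sum: "finite I \<Longrightarrow> (\<And>i. i \<in> I \<Longrightarrow> f i holomorphic_on Ux) \<Longrightarrow>
      hfc Ux (\<lambda>z. \<Sum>i\<in>I. f i z) T = (\<Sum>i\<in>I. hfc Ux (f i) T)" for f :: "nat \<Rightarrow> complex \<Rightarrow> complex" and I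
  proof (induction I rule: finite_induct)
    case empty
    show ?case using module_mapD(2)[OF M, of "\<lambda>_. 0" 0] by simp
  next
    case (insert i I)
    have "(\<lambda>z. \<Sum>i\<in>I. f i z) holomorphic_on Ux" using insert by (intro holomorphic_on_sum) auto
    then show ?case using insert module_mapD(1)[OF M, of "f i" "\<lambda>z. \<Sum>i\<in>I. f i z"] by simp
  qed
  have mult: "\<Phi> (Oq_mult q F G) = \<Phi> F * \<Phi> G" if F: "F \<in> Oq" and G: "G \<in> Oq" for F G
  proof -
    have "a (Oq_mult q F G) n = (\<Sum>i\<le>n. a F i * a G (n - i))" for n
    proof -
      have "hfc Ux (Oq_mult q F G n) T = (\<Sum>i\<le>n. hfc Ux (\<lambda>z. F i z * G (n - i) (q ^ i * z)) T)"
        unfolding Oq_mult_def using Oq_hol[OF F] gq[OF Oq_hol[OF G]]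
        by (intro hfc_sum holomorphic_on_mult) auto
      also have "\<dots> = (\<Sum>i\<le>n. hfc Ux (F i) T * hfc Ux (\<lambda>z. G (n - i) (q ^ i * z)) T)"
        by (intro sum.cong refl hfc_mult[OF open_Ux TU] Oq_hol[OF F] gq Oq_hol[OF G])
      finally have "a (Oq_mult q F G) n = (\<Sum>i\<le>n. hfc Ux (F i) T * hfc Ux (\<lambda>z. G (n - i) (q ^ i * z)) T * S ^ n)"
        by (simp add: a_def sum_distrib_right)
      also have "\<dots> = (\<Sum>i\<le>n. a F i * a G (n - i))"
      proof (rule sum.cong[OF refl])
        fix i assume "i \<in> {..n}"
        then have "S ^ n = S ^ i * S ^ (n - i)" by (simp flip: power_add)
        then have "hfc Ux (F i) T * hfc Ux (\<lambda>z. G (n - i) (q ^ i * z)) T * S ^ n =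
            hfc Ux (F i) T * (hfc Ux (\<lambda>z. G (n - i) (q ^ i * z)) T * S ^ i) * S ^ (n - i)" by (simp add: mult.assoc)
        also have "\<dots> = a F i * a G (n - i)"
          unfolding swap[OF Oq_hol[OF G], symmetric] a_def by (simp add: mult.assoc)
        finally show "hfc Ux (F i) T * hfc Ux (\<lambda>z. G (n - i) (q ^ i * z)) T * S ^ n = a F i * a G (n - i)" .
      qed
      finally show ?thesis .
    qed
    then have "a (Oq_mult q F G) = (\<lambda>n. \<Sum>i\<le>n. a F i * a G (n - i))" by (rule ext)
    then show ?thesis unfolding \<Phi>_def using Cauchy_product[OF nsum[OF F] nsum[OF G]] by simp
  qed
  have monom: "\<Phi> (Oq_monom m f) = hfc Ux f T * S ^ m" if f: "f holomorphic_on Ux" for f m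
  proof -
    have "hfc Ux (Oq_monom m f n) T = (if n = m then hfc Ux f T else 0)" for n
    proof (cases "n = m")
      case True
      have "hfc Ux f T = hfc Ux (Oq_monom m f n) T"
        by (rule module_map_cong[OF M f]) (simp add: True Oq_monom_def)
      then show ?thesis using True by simp
    next
      case False
      then have "Oq_monom m f n = (\<lambda>_. 0 * 0)" by (auto simp: Oq_monom_def)
      then show ?thesis using module_mapD(2)[OF M, of "\<lambda>_. 0" 0] False by simp
    qed
    then have "a (Oq_monom m f) = (\<lambda>n. if n = m then hfc Ux f T * S ^ n else 0)" by (auto simp: a_def)
    then show ?thesis unfolding \<Phi>_def using sums_unique[OF sums_single[of m "\<lambda>n. hfc Ux f T * S ^ n"]] by simp
  qed
  note one = hfc_one[OF open_Ux TU]
  have x: "hfc Ux (\<lambda>z. z) T = T" using module_mapD(3)[OF M, of "\<lambda>_. 1"] one by simp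
  have "Oq_ext q Ux ry T S \<Phi>"
    unfolding Oq_ext_def Oq_gens_monom
  proof (intro conjI ballI allI)
    show "continuous_map (Oq_top Ux ry) euclidean \<Phi>" by (rule Oq_bounded_imp_continuous[OF lin bd])
    show "\<Phi> (Oq_monom 0 (\<lambda>z. z)) = T" using monom[of "\<lambda>z. z" 0] x by (simp add: holomorphic_on_id[unfolded id_def])
  qed (use lin mult monom one in \<open>auto simp: Oq_linear_def\<close>)
  then show ?thesis unfolding \<Phi>_def[abs_def] a_def .
qed

end

theorem theorem5p2:
  fixes q :: complex and T S :: "'a::cbanach_algebra" and Ux :: "complex set" and ry :: ereal
  assumes "0 < cmod q" and "cmod q < 1"
    and "T * S = cscale (inverse q) (S * T)"
    and "q_open q Ux" and "0 < ry"
  shows "((\<exists>\<Phi>. Oq_ext q Ux ry T S \<Phi>) \<longleftrightarrow>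
            (bspec T \<subseteq> Ux \<and> (\<forall>w\<in>bspec S. ereal (cmod w) < ry))) \<and>
         ((bspec T \<subseteq> Ux \<and> (\<forall>w\<in>bspec S. ereal (cmod w) < ry)) \<longrightarrow>
            Oq_ext q Ux ry T S (\<lambda>F. \<Sum>n. hfc Ux (F n) T * S ^ n) \<and>
            (\<forall>\<Phi>. Oq_ext q Ux ry T S \<Phi> \<longrightarrow>
               (\<forall>F\<in>Oq_set Ux ry. \<Phi> F = (\<Sum>n. hfc Ux (F n) T * S ^ n))))"
proof -
  have q0: "q \<noteq> 0" using assms(1) by auto
  interpret Oq_algebra q Ux ry by unfold_locales (use q0 assms in auto)
  have ST: "S * T = cscale q (T * S)" using q0 by (simp add: assms(3) cscale_assoc)
  have ex: "Oq_ext q Ux ry T S (\<lambda>F. \<Sum>n. hfc Ux (F n) T * S ^ n)"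
    if "bspec T \<subseteq> Ux" "\<forall>w\<in>bspec S. ereal (cmod w) < ry"
    by (rule Oq_ext_hfc[OF ST that])
  have hom: "bspec T \<subseteq> Ux \<and> (\<forall>w\<in>bspec S. ereal (cmod w) < ry) \<and>
      (\<forall>F\<in>Oq_set Ux ry. \<Phi> F = (\<Sum>n. hfc Ux (F n) T * S ^ n))" if "Oq_ext q Ux ry T S \<Phi>" for \<Phi>
  proof -
    interpret Oq_hom q Ux ry T S \<Phi> by unfold_locales (rule that)
    show ?thesis using bspec_T bspec_S \<Phi>_eq by blast
  qed
  show ?thesis using ex hom by blast
qed

end
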